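(* Let $(B,L_B)$ be a $C^*$-algebraic compact quantum metric space, where $L_B$ has domain $V_B \subseteq B$, let $\beta \colon B \to B$ be a $*$-automorphism, and suppose that the semi-norm $L_B$ is lower semi-continuous on its domain $V_B$ and that $\beta(V_B) = V_B$. Let $|||\cdot||| \colon C_c(\mathbb{Z}) \to [0,\infty)$ be a norm which is order preserving in the sense that $|||h||| \leq |||k|||$ whenever $0 \leq h(n) \leq k(n)$ for all $n \in \mathbb{Z}$. Then the semi-norm $L \colon C_c(\mathbb{Z},V_B) \to [0,\infty)$ defined by \[ L(x) := \max\Big\{ \Big\| \sum_n n\, x(n) U^n \Big\|,\ |||L_B \circ x|||,\ |||L_B \circ x^*||| \Big\} \] provides the reduced crossed product $C_r^*(\mathbb{Z},B,\beta)$ with the structure of a $C^*$-algebraic compact quantum metric space, i.e. $(C_r^*(\mathbb{Z},B,\beta), L)$ is a $C^*$-algebraic compact quantum metric space.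
   Context: **Compact quantum metric spaces.** Let $A$ be a unital $C^*$-algebra, $V \subseteq A$ a norm-dense complex subspace with $1 \in V$ and $\xi^* \in V$ for all $\xi \in V$, and $L \colon V \to [0,\infty)$ a semi-norm with $L(1)=0$ and $L(\xi)=L(\xi^* )$ for all $\xi\in V$. The pair $(A,L)$ is a ($C^*$-algebraic) compact quantum metric space when $\rho_L(\mu,\nu) := \sup\{ |\mu(\xi)-\nu(\xi)| \mid \xi \in V, L(\xi) \leq 1\}$ is a metric on the state space $S(A)$ which metrizes the weak $*$-topology. Lower semi-continuity of $L$ is with respect to the $C^*$-norm topology on $V$. **Crossed products.** For a unital $C^*$-algebra $B$ and a $*$-automorphism $\beta$ of $B$, $C_r^*(\mathbb{Z},B,\beta)$ denotes the reduced crossed product of $B$ by the $\mathbb{Z}$-action generated by $\beta$, represented on the Hilbert $C^*$-module $\ell^2(\mathbb{Z}) \widehat{\otimes} B$ by $b(e_m \otimes c) = e_m \otimes \beta^{-m}(b)c$ and $U(e_m\otimes c) = e_{m+1} \otimes c$, so that $UbU^* = \beta(b)$. $C_c(\mathbb{Z})$ is the complex vector space of finitely supported functions on $\mathbb{Z}$. A finitely supported function $x \colon \mathbb{Z} \to V_B$ is identified with $\sum_n x(n)U^n \in C_r^*(\mathbb{Z},B,\beta)$, and $C_c(\mathbb{Z},V_B)$ is the subspace of all such elements. The norm $\|\cdot\|$ is the $C^*$-norm of the crossed product, $x^*$ is the adjoint in the crossed product, so $x^*(n) = \beta^n(x(-n)^* )$, and $L_B\circ x \in C_c(\mathbb{Z})$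 is the function $n\mapsto L_B(x(n))$. *)

theory Defs
  imports "HOL-Analysis.Analysis" "HOL-Algebra.Ring"
begin

section \<open>Unital \<open>C\<^sup>*\<close>-algebras\<close>

text \<open>
  Unital \<open>C\<^sup>*\<close>-algebras occur in two forms.  The coefficient algebra is a type of the class below.
  The crossed product depends on the automorphism, which is a term, so it cannot be a type; it is a
  record with a carrier set.  Compact quantum metric spaces are defined for records, and
  \<open>type_cstar\<close> is the record of a type of the class.  Neither form excludes the zero algebra.
\<close>

class unital_cstar = real_normed_algebra + monoid_mult + banach +
  fixes scaleC :: "complex \<Rightarrow> 'a \<Rightarrow> 'a"
    and star :: "'a \<Rightarrow> 'a"
  assumes scaleC_add_right: "scaleC c (x + y) = scaleC c x + scaleC c y"
    and scaleC_add_left: "scaleC (c + d) x = scaleC c x + scaleC d x"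
    and scaleC_scaleC: "scaleC c (scaleC d x) = scaleC (c * d) x"
    and scaleC_of_real: "scaleC (complex_of_real r) x = scaleR r x"
    and scaleC_mult_left: "scaleC c x * y = scaleC c (x * y)"
    and scaleC_mult_right: "x * scaleC c y = scaleC c (x * y)"
    and norm_scaleC: "norm (scaleC c x) = cmod c * norm x"
    and star_star: "star (star x) = x"
    and star_add: "star (x + y) = star x + star y"
    and star_scaleC: "star (scaleC c x) = scaleC (cnj c) (star x)"
    and star_mult: "star (x * y) = star y * star x"
    and cstar_identity: "norm (star x * x) = (norm x)\<^sup>2"

record 'a cstar = "'a ring" +
  scal :: "complex \<Rightarrow> 'a \<Rightarrow> 'a"
  adj :: "'a \<Rightarrow> 'a"
  nrm :: "'a \<Rightarrow> real"

text \<open>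
  The locale \<open>Metric_space\<close> demands nonnegativity and symmetry also outside the carrier,
  hence the value \<open>0\<close> there.
\<close>

definition cstar_dist :: "('a, 'm) cstar_scheme \<Rightarrow> 'a \<Rightarrow> 'a \<Rightarrow> real" where
  "cstar_dist A x y = (if x \<in> carrier A \<and> y \<in> carrier A then nrm A (x \<ominus>\<^bsub>A\<^esub> y) else 0)"

definition norm_topology :: "('a, 'm) cstar_scheme \<Rightarrow> 'a topology" where
  "norm_topology A = Metric_space.mtopology (carrier A) (cstar_dist A)"

locale unital_cstar_algebra = ring A for A (structure) +
  assumes scal_closed: "x \<in> carrier A \<Longrightarrow> scal A c x \<in> carrier A"
    and scal_add_right: "\<lbrakk>x \<in> carrier A; y \<in> carrier A\<rbrakk> \<Longrightarrow> scal A c (x \<oplus> y) = scal A c x \<oplus> scal A c y"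
    and scal_add_left: "x \<in> carrier A \<Longrightarrow> scal A (c + d) x = scal A c x \<oplus> scal A d x"
    and scal_scal: "x \<in> carrier A \<Longrightarrow> scal A c (scal A d x) = scal A (c * d) x"
    and scal_one: "x \<in> carrier A \<Longrightarrow> scal A 1 x = x"
    and scal_mult_left: "\<lbrakk>x \<in> carrier A; y \<in> carrier A\<rbrakk> \<Longrightarrow> scal A c x \<otimes> y = scal A c (x \<otimes> y)"
    and scal_mult_right: "\<lbrakk>x \<in> carrier A; y \<in> carrier A\<rbrakk> \<Longrightarrow> x \<otimes> scal A c y = scal A c (x \<otimes> y)"
    and adj_closed: "x \<in> carrier A \<Longrightarrow> adj A x \<in> carrier A"
    and adj_adj: "x \<in> carrier A \<Longrightarrow> adj A (adj A x) = x"
    and adj_add: "\<lbrakk>x \<in> carrier A; y \<in> carrier A\<rbrakk> \<Longrightarrow> adj A (x \<oplus> y) = adj A x \<oplus> adj A y"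
    and adj_scal: "x \<in> carrier A \<Longrightarrow> adj A (scal A c x) = scal A (cnj c) (adj A x)"
    and adj_mult: "\<lbrakk>x \<in> carrier A; y \<in> carrier A\<rbrakk> \<Longrightarrow> adj A (x \<otimes> y) = adj A y \<otimes> adj A x"
    and nrm_nonneg: "x \<in> carrier A \<Longrightarrow> 0 \<le> nrm A x"
    and nrm_eq_0_iff: "x \<in> carrier A \<Longrightarrow> nrm A x = 0 \<longleftrightarrow> x = \<zero>"
    and nrm_triangle: "\<lbrakk>x \<in> carrier A; y \<in> carrier A\<rbrakk> \<Longrightarrow> nrm A (x \<oplus> y) \<le> nrm A x + nrm A y"
    and nrm_scal: "x \<in> carrier A \<Longrightarrow> nrm A (scal A c x) = cmod c * nrm A x"
    and nrm_mult: "\<lbrakk>x \<in> carrier A; y \<in> carrier A\<rbrakk> \<Longrightarrow> nrm A (x \<otimes> y) \<le> nrm A x * nrm A y"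
    and complete: "Metric_space.mcomplete (carrier A) (cstar_dist A)"
    and nrm_cstar: "x \<in> carrier A \<Longrightarrow> nrm A (adj A x \<otimes> x) = (nrm A x)\<^sup>2"

definition type_cstar :: "'b::unital_cstar cstar" where
  "type_cstar = \<lparr>carrier = UNIV, mult = (*), one = 1, zero = 0, add = (+),
     scal = scaleC, adj = star, nrm = norm\<rparr>"

lemma type_cstar_simps [simp]:
  "carrier type_cstar = UNIV" "mult type_cstar = (*)" "one type_cstar = 1"
  "zero type_cstar = 0" "add type_cstar = (+)"
  "scal type_cstar = scaleC" "adj type_cstar = star" "nrm type_cstar = norm"
  by (simp_all add: type_cstar_def)

lemma ring_type_cstar: "ring (type_cstar :: 'b::unital_cstar cstar)"
proof (rule ringI)
  show "abelian_group (type_cstar :: 'b cstar)"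
  proof (rule abelian_groupI)
    fix x :: 'b
    show "\<exists>y\<in>carrier type_cstar. y \<oplus>\<^bsub>type_cstar\<^esub> x = \<zero>\<^bsub>type_cstar\<^esub>"
      by (auto intro: exI [of _ "- x"])
  qed (simp_all add: ac_simps)
  show "monoid (type_cstar :: 'b cstar)"
    by (rule monoidI) (simp_all add: mult.assoc)
qed (simp_all add: distrib_left distrib_right)

lemma cstar_dist_type_cstar: "cstar_dist (type_cstar :: 'b::unital_cstar cstar) = dist"
proof (intro ext)
  fix x y :: 'b
  interpret ring "type_cstar :: 'b cstar" by (rule ring_type_cstar)
  have "\<ominus>\<^bsub>type_cstar\<^esub> y = - y"
    by (rule minus_equality) simp_all
  then show "cstar_dist type_cstar x y = dist x y"
    by (simp add: cstar_dist_def a_minus_def dist_norm)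
qed

lemma unital_cstar_algebra_type_cstar:
  "unital_cstar_algebra (type_cstar :: 'b::unital_cstar cstar)"
proof -
  interpret ring "type_cstar :: 'b cstar" by (rule ring_type_cstar)
  have one: "scaleC 1 x = x" for x :: 'b
    using scaleC_of_real [of 1 x] by simp
  show ?thesis
    by unfold_locales
      (simp_all add: one complete_UNIV cstar_dist_type_cstar scaleC_add_right scaleC_add_left
        scaleC_scaleC scaleC_mult_left scaleC_mult_right star_star star_add star_scaleC star_mult
        norm_triangle_ineq norm_scaleC norm_mult_ineq cstar_identity)
qed

section \<open>Compact quantum metric spaces\<close>

definition state_space :: "('a, 'm) cstar_scheme \<Rightarrow> ('a \<Rightarrow> complex) set" where
  "state_space A = {\<phi> \<in> extensional (carrier A).
     (\<forall>x\<in>carrier A. \<forall>y\<in>carrier A. \<phi> (x \<oplus>\<^bsub>A\<^esub> y) = \<phi> x + \<phi> y) \<and>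
     (\<forall>c. \<forall>x\<in>carrier A. \<phi> (scal A c x) = c * \<phi> x) \<and>
     (\<forall>x\<in>carrier A. \<phi> (adj A x \<otimes>\<^bsub>A\<^esub> x) \<in> \<real>\<^sub>\<ge>\<^sub>0) \<and>
     \<phi> \<one>\<^bsub>A\<^esub> = 1}"

definition weak_star_topology :: "('a, 'm) cstar_scheme \<Rightarrow> ('a \<Rightarrow> complex) topology" where
  "weak_star_topology A =
     subtopology (product_topology (\<lambda>_. euclidean) (carrier A)) (state_space A)"

definition state_dist ::
    "'a set \<Rightarrow> ('a \<Rightarrow> real) \<Rightarrow> ('a \<Rightarrow> complex) \<Rightarrow> ('a \<Rightarrow> complex) \<Rightarrow> ennreal" where
  "state_dist V L \<mu> \<nu> = (SUP \<xi>\<in>{\<xi> \<in> V. L \<xi> \<le> 1}. ennreal (cmod (\<mu> \<xi> - \<nu> \<xi>)))"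

text \<open>Finiteness of \<open>state_dist\<close> is required separately, because \<open>enn2real\<close> maps \<open>\<infinity>\<close> to \<open>0\<close>.\<close>

locale compact_quantum_metric_space = unital_cstar_algebra A
  for A (structure) and V :: "'a set" and L :: "'a \<Rightarrow> real" +
  assumes V_subset: "V \<subseteq> carrier A"
    and V_add: "\<lbrakk>\<xi> \<in> V; \<eta> \<in> V\<rbrakk> \<Longrightarrow> \<xi> \<oplus> \<eta> \<in> V"
    and V_scal: "\<xi> \<in> V \<Longrightarrow> scal A c \<xi> \<in> V"
    and V_one: "\<one> \<in> V"
    and V_adj: "\<xi> \<in> V \<Longrightarrow> adj A \<xi> \<in> V"
    and V_dense: "norm_topology A closure_of V = carrier A"
    and L_nonneg: "\<xi> \<in> V \<Longrightarrow> 0 \<le> L \<xi>"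
    and L_triangle: "\<lbrakk>\<xi> \<in> V; \<eta> \<in> V\<rbrakk> \<Longrightarrow> L (\<xi> \<oplus> \<eta>) \<le> L \<xi> + L \<eta>"
    and L_scal: "\<xi> \<in> V \<Longrightarrow> L (scal A c \<xi>) = cmod c * L \<xi>"
    and L_one: "L \<one> = 0"
    and L_adj: "\<xi> \<in> V \<Longrightarrow> L (adj A \<xi>) = L \<xi>"
    and state_dist_finite:
      "\<lbrakk>\<mu> \<in> state_space A; \<nu> \<in> state_space A\<rbrakk> \<Longrightarrow> state_dist V L \<mu> \<nu> < \<infinity>"
    and state_dist_metric:
      "Metric_space (state_space A) (\<lambda>\<mu> \<nu>. enn2real (state_dist V L \<mu> \<nu>))"
    and state_dist_topology:
      "Metric_space.mtopology (state_space A) (\<lambda>\<mu> \<nu>. enn2real (state_dist V L \<mu> \<nu>))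
         = weak_star_topology A"

definition lower_semicontinuous_on :: "'a::topological_space set \<Rightarrow> ('a \<Rightarrow> real) \<Rightarrow> bool" where
  "lower_semicontinuous_on V L \<longleftrightarrow> (\<forall>c. openin (top_of_set V) {\<xi> \<in> V. c < L \<xi>})"

section \<open>Adjointable operators on \<open>\<ell>\<^sup>2(\<int>) \<otimes> B\<close>\<close>

text \<open>
  The Hilbert \<open>C\<^sup>*\<close>-module \<open>\<ell>\<^sup>2(\<int>) \<otimes> B\<close> is realised as the space of all \<open>f :: int \<Rightarrow> B\<close> for which
  \<open>\<Sum>n. f(n)\<^sup>* f(n)\<close> converges in norm; \<open>e\<^sub>m \<otimes> c\<close> is the function with value \<open>c\<close> at \<open>m\<close>
  and \<open>0\<close> elsewhere.  The summands are positive, so convergence of the symmetric partial sums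
  and unordered convergence are the same.
\<close>

definition l2Z :: "(int \<Rightarrow> 'b::unital_cstar) set" where
  "l2Z = {f. (\<lambda>n. star (f n) * f n) summable_on UNIV}"

definition l2_inner :: "(int \<Rightarrow> 'b::unital_cstar) \<Rightarrow> (int \<Rightarrow> 'b) \<Rightarrow> 'b" where
  "l2_inner f g = (\<Sum>\<^sub>\<infinity>n. star (f n) * g n)"

definition l2_norm :: "(int \<Rightarrow> 'b::unital_cstar) \<Rightarrow> real" where
  "l2_norm f = sqrt (norm (l2_inner f f))"

type_synonym 'b l2_op = "(int \<Rightarrow> 'b) \<Rightarrow> (int \<Rightarrow> 'b)"

definition is_adjoint :: "'b::unital_cstar l2_op \<Rightarrow> 'b l2_op \<Rightarrow> bool" where
  "is_adjoint T S \<longleftrightarrow> S \<in> l2Z \<rightarrow>\<^sub>E l2Z \<and>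
     (\<forall>f\<in>l2Z. \<forall>g\<in>l2Z. l2_inner (T f) g = l2_inner f (S g))"

text \<open>Operators are extensional on \<open>l2Z\<close>.  Adjointability implies linearity and boundedness.\<close>

definition adjointable_cstar :: "'b::unital_cstar l2_op cstar" where
  "adjointable_cstar =
    \<lparr>carrier = {T \<in> l2Z \<rightarrow>\<^sub>E l2Z. \<exists>S. is_adjoint T S},
     mult = compose l2Z,
     one = (\<lambda>f\<in>l2Z. f),
     zero = (\<lambda>f\<in>l2Z. (\<lambda>n. 0)),
     add = (\<lambda>S T. \<lambda>f\<in>l2Z. (\<lambda>n. S f n + T f n)),
     scal = (\<lambda>c T. \<lambda>f\<in>l2Z. (\<lambda>n. scaleC c (T f n))),
     adj = (\<lambda>T. THE S. is_adjoint T S),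
     nrm = (\<lambda>T. SUP f\<in>{f \<in> l2Z. l2_norm f \<le> 1}. l2_norm (T f))\<rparr>"

section \<open>The reduced crossed product by an automorphism\<close>

definition star_automorphism :: "('b::unital_cstar \<Rightarrow> 'b) \<Rightarrow> bool" where
  "star_automorphism \<beta> \<longleftrightarrow> bij \<beta> \<and>
     (\<forall>x y. \<beta> (x + y) = \<beta> x + \<beta> y) \<and>
     (\<forall>c x. \<beta> (scaleC c x) = scaleC c (\<beta> x)) \<and>
     (\<forall>x y. \<beta> (x * y) = \<beta> x * \<beta> y) \<and>
     (\<forall>x. \<beta> (star x) = star (\<beta> x))"

definition int_iterate :: "('b \<Rightarrow> 'b) \<Rightarrow> int \<Rightarrow> 'b \<Rightarrow> 'b" where
  "int_iterate \<beta> n = (if 0 \<le> n then \<beta> ^^ nat n else inv_into UNIV \<beta> ^^ nat (- n))"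

definition coeff_op :: "('b::unital_cstar \<Rightarrow> 'b) \<Rightarrow> 'b \<Rightarrow> 'b l2_op" where
  "coeff_op \<beta> b = (\<lambda>f\<in>l2Z. (\<lambda>m. int_iterate \<beta> (- m) b * f m))"

definition shift_op :: "'b::unital_cstar l2_op" where
  "shift_op = (\<lambda>f\<in>l2Z. (\<lambda>m. f (m - 1)))"

definition finsupp :: "'c::zero set \<Rightarrow> (int \<Rightarrow> 'c) set" where
  "finsupp V = {x. range x \<subseteq> V \<and> finite {n. x n \<noteq> 0}}"

text \<open>The identification of a finitely supported \<open>x\<close> with \<open>\<Sum>n. x(n) U\<^sup>n\<close>, and its inverse.\<close>

definition cc_elem :: "('b::unital_cstar \<Rightarrow> 'b) \<Rightarrow> (int \<Rightarrow> 'b) \<Rightarrow> 'b l2_op" where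
  "cc_elem \<beta> x = (\<Oplus>\<^bsub>adjointable_cstar\<^esub> n\<in>{n. x n \<noteq> 0}.
     coeff_op \<beta> (x n) \<otimes>\<^bsub>adjointable_cstar\<^esub> (shift_op [^]\<^bsub>adjointable_cstar\<^esub> n))"

definition cc_coeff :: "('b::unital_cstar \<Rightarrow> 'b) \<Rightarrow> 'b l2_op \<Rightarrow> int \<Rightarrow> 'b" where
  "cc_coeff \<beta> = the_inv_into (finsupp UNIV) (cc_elem \<beta>)"

definition reduced_crossed_product :: "('b::unital_cstar \<Rightarrow> 'b) \<Rightarrow> 'b l2_op cstar" where
  "reduced_crossed_product \<beta> = adjointable_cstar
     \<lparr>carrier := norm_topology adjointable_cstar closure_of (cc_elem \<beta> ` finsupp UNIV)\<rparr>"

definition order_preserving_norm :: "((int \<Rightarrow> complex) \<Rightarrow> real) \<Rightarrow> bool" where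
  "order_preserving_norm N \<longleftrightarrow>
     (\<forall>h\<in>finsupp UNIV. 0 \<le> N h \<and> (N h = 0 \<longleftrightarrow> h = (\<lambda>n. 0))) \<and>
     (\<forall>h\<in>finsupp UNIV. \<forall>k\<in>finsupp UNIV. N (\<lambda>n. h n + k n) \<le> N h + N k) \<and>
     (\<forall>c. \<forall>h\<in>finsupp UNIV. N (\<lambda>n. c * h n) = cmod c * N h) \<and>
     (\<forall>h\<in>finsupp UNIV. \<forall>k\<in>finsupp UNIV. (\<forall>n. 0 \<le> h n \<and> h n \<le> k n) \<longrightarrow>
        N (\<lambda>n. complex_of_real (h n)) \<le> N (\<lambda>n. complex_of_real (k n)))"

definition crossed_seminorm :: "('b::unital_cstar \<Rightarrow> 'b) \<Rightarrow> ('b \<Rightarrow> real) \<Rightarrow>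
    ((int \<Rightarrow> complex) \<Rightarrow> real) \<Rightarrow> 'b l2_op \<Rightarrow> real" where
  "crossed_seminorm \<beta> L N x = Max
     {nrm (reduced_crossed_product \<beta>) (cc_elem \<beta> (\<lambda>n. scaleC (of_int n) (cc_coeff \<beta> x n))),
      N (\<lambda>n. complex_of_real (L (cc_coeff \<beta> x n))),
      N (\<lambda>n. complex_of_real (L (cc_coeff \<beta> (adj (reduced_crossed_product \<beta>) x) n)))}"

end

theory Submission
  imports Defs
begin

text \<open>
  By Rieffel's criterion, a seminorm metrizes the weak \<open>*\<close>-topology once its unit ball is totally
  bounded modulo constants; for the coefficient algebra the converse holds by compactness of the
  state space and because states determine the norm up to a factor \<open>2\<close>.
  So let \<open>x = \<Sum>n. x(n) U\<^sup>n\<close> with \<open>L(x) \<le> 1\<close>, and put \<open>y = \<Sum>n. n x(n) U\<^sup>n\<close>, hence \<open>\<parallel>y\<parallel> \<le> 1\<close>.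
  The row inequality \<open>\<parallel>\<Sum>n. y(n) y(n)\<^sup>*\<parallel> \<le> \<parallel>y\<parallel>\<^sup>2\<close> and the Cauchy-Schwarz inequality give, for a finite
  set \<open>F\<close> of nonzero integers, the estimate
  \<open>\<parallel>\<Sum>n\<in>F. x(n) U\<^sup>n\<parallel> \<le> (\<Sum>n\<in>F. 1 / n\<^sup>2)\<^sup>1\<^sup>/\<^sup>2\<close>,
  so the tails are uniformly small.  The finitely many remaining coefficients lie in totally bounded
  sets: order preservation bounds \<open>L\<^sub>B(x(n))\<close>, we have \<open>\<parallel>x(n)\<parallel> \<le> 1\<close> for \<open>n \<noteq> 0\<close>, and \<open>x(0)\<close> is
  bounded modulo constants.
\<close>

section \<open>Positivity in unital \<open>C\<^sup>*\<close>-algebras\<close>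

text \<open>The map from x to y kills exactly the coefficient x(0). Hence 0 is kept out of F, and
  x(0) is caught only modulo constants, by the Lipschitz ball of the coefficient algebra. The row
  inequality is read off at a single vector: the adjoint of y, applied to e_0 \<otimes> 1, has the
  elements \<open>star (y n)\<close> as coordinates, with no trace of the automorphism. In the
  Cauchy-Schwarz step x(n) U^n is factored as y(n) times U^n / n, and unitarity of U leaves the
  scalar sum of 1/n^2. The algebra-valued Cauchy-Schwarz inequality is needed in B for the Hilbert
  module and again among its operators; for this reason the adjointable operators are built as a
  second type of the class, and results are transported to the records afterwards. The proof of that
  inequality rests on positivity of \<open>star x * x\<close> in an abstract algebra, which is
  developed from norm inequalities and the binomial series of the square root. The same order
  estimates, with Hahn-Banach, produce enough states; splitting into real and imaginary parts costs
  the factor 2.\<close>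

lemma scaleC_one [simp]: "scaleC 1 x = x"
  using scaleC_of_real [of 1 x] by simp

lemma scaleC_0_left [simp]: "scaleC 0 x = 0"
  using scaleC_of_real [of 0 x] by simp

lemma scaleC_0_right [simp]: "scaleC c 0 = 0"
  using scaleC_add_right [of c 0 0] by simp

lemma scaleC_minus_left: "scaleC (- c) x = - scaleC c x"
  using scaleC_add_left [of "- c" c x] by (simp add: eq_neg_iff_add_eq_0)

lemma scaleC_minus_right: "scaleC c (- x) = - scaleC c x"
  using scaleC_add_right [of c "- x" x] by (simp add: eq_neg_iff_add_eq_0)

lemma scaleC_minus_one [simp]: "scaleC (- 1) x = - x"
  by (simp add: scaleC_minus_left)

lemma scaleC_diff_right: "scaleC c (x - y) = scaleC c x - scaleC c y"
  using scaleC_add_right [of c x "- y"] by (simp add: scaleC_minus_right)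

lemma scaleC_sum_right: "scaleC c (sum f A) = (\<Sum>i\<in>A. scaleC c (f i))"
  by (induction A rule: infinite_finite_induct) (simp_all add: scaleC_add_right)

lemma scaleC_scaleR: "scaleC c (r *\<^sub>R x) = r *\<^sub>R scaleC c x"
  by (metis scaleC_of_real scaleC_scaleC mult.commute)

lemma star_0 [simp]: "star 0 = 0"
  using star_add [of 0 0] by simp

lemma star_minus: "star (- x) = - star x"
  using star_add [of "- x" x] by (simp add: eq_neg_iff_add_eq_0)

lemma star_diff: "star (x - y) = star x - star y"
  using star_add [of x "- y"] by (simp add: star_minus)

lemma star_one [simp]: "star 1 = 1"
  by (metis star_mult star_star mult_1_right)

lemma star_scaleR: "star (r *\<^sub>R x) = r *\<^sub>R star x"
  by (metis scaleC_of_real star_scaleC complex_cnj_complex_of_real)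

lemma star_sum: "star (sum f A) = (\<Sum>i\<in>A. star (f i))"
  by (induction A rule: infinite_finite_induct) (simp_all add: star_add)

lemma star_power: "star (x ^ n) = star x ^ n"
proof (induction n)
  case (Suc n)
  have "star (x ^ Suc n) = star x ^ n * star x"
    by (simp add: star_mult Suc)
  then show ?case
    by (simp only: power_commutes power_Suc)
qed simp

lemma norm_star [simp]: "norm (star x) = norm x" for x :: "'a::unital_cstar"
proof -
  have le: "norm y \<le> norm (star y)" for y :: 'a
  proof (cases "y = 0")
    case False
    have "norm y * norm y \<le> norm (star y) * norm y"
      using norm_mult_ineq [of "star y" y] by (simp add: cstar_identity power2_eq_square)
    with False show ?thesis
      by simp
  qed simp
  from le [of x] le [of "star x"] show ?thesis
    by (simp add: star_star)
qed

text \<open>Equality fails only in the zero algebra, which the class admits; the inequality covers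
  both cases.\<close>

lemma norm_one_le: "norm (1 :: 'a::unital_cstar) \<le> 1"
  using cstar_identity [of "1::'a"] by (cases "(1::'a) = 0") (auto simp: power2_eq_square)

lemma bounded_linear_star: "bounded_linear star"
  by (rule bounded_linear_intro [of _ 1]) (simp_all add: star_add star_scaleR)

lemma bounded_linear_scaleC: "bounded_linear (scaleC c)"
  by (rule bounded_linear_intro [of _ "cmod c"])
    (simp_all add: scaleC_add_right scaleC_scaleR norm_scaleC mult.commute)

section \<open>Self-adjoint elements and positivity in terms of the norm\<close>

definition selfadj :: "'a::unital_cstar \<Rightarrow> bool"
  where "selfadj x \<longleftrightarrow> star x = x"

lemma selfadj_simps [simp]:
  "selfadj 0" "selfadj 1" "selfadj (star x * x)" "selfadj (x * star x)" "selfadj (x + star x)"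
  by (simp_all add: selfadj_def star_mult star_star star_add add.commute)

lemma selfadj_add: "selfadj x \<Longrightarrow> selfadj y \<Longrightarrow> selfadj (x + y)"
  by (simp add: selfadj_def star_add)

lemma selfadj_diff: "selfadj x \<Longrightarrow> selfadj y \<Longrightarrow> selfadj (x - y)"
  by (simp add: selfadj_def star_diff)

lemma selfadj_minus: "selfadj x \<Longrightarrow> selfadj (- x)"
  by (simp add: selfadj_def star_minus)

lemma selfadj_scaleR: "selfadj x \<Longrightarrow> selfadj (r *\<^sub>R x)"
  by (simp add: selfadj_def star_scaleR)

lemma selfadj_sum: "(\<And>i. i \<in> A \<Longrightarrow> selfadj (f i)) \<Longrightarrow> selfadj (sum f A)"
  by (simp add: selfadj_def star_sum)

lemma selfadj_mult: "selfadj x \<Longrightarrow> selfadj y \<Longrightarrow> x * y = y * x \<Longrightarrow> selfadj (x * y)"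
  by (simp add: selfadj_def star_mult)

lemma selfadj_imaginary: "selfadj (scaleC \<i> (x - star x))"
  by (simp add: selfadj_def star_scaleC star_diff star_star scaleC_minus_left scaleC_diff_right)

lemma norm_selfadj_square: "selfadj h \<Longrightarrow> norm (h * h) = (norm h)\<^sup>2"
  using cstar_identity [of h] by (simp add: selfadj_def)

text \<open>Iterating the C*-identity reaches exactly the exponents 2^m. These suffice to recover
  \<open>norm h\<close> from the growth of its powers, in place of the spectral radius
  formula.\<close>

lemma norm_selfadj_power:
  assumes "selfadj h"
  shows "norm (h ^ 2 ^ m) = norm h ^ 2 ^ m"
proof (induction m)
  case (Suc m)
  have "selfadj (h ^ 2 ^ m)"
    using assms by (simp add: selfadj_def star_power)
  then have "norm (h ^ 2 ^ m * h ^ 2 ^ m) = (norm h ^ 2 ^ m)\<^sup>2"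
    by (simp add: norm_selfadj_square Suc)
  then show ?case
    by (simp add: mult_2 power_add power2_eq_square)
qed simp

text \<open>Positivity is expressed by a norm inequality, so that sums of positive elements are
  positive without any spectral theory.\<close>

definition pos :: "'a::unital_cstar \<Rightarrow> bool"
  where "pos a \<longleftrightarrow> selfadj a \<and> (\<exists>t\<ge>0. norm (t *\<^sub>R 1 - a) \<le> t)"

lemma pos_selfadj: "pos a \<Longrightarrow> selfadj a"
  by (simp add: pos_def)

lemma pos_add:
  assumes "pos a" "pos b"
  shows "pos (a + b)"
proof -
  obtain s t where s: "s \<ge> 0" "norm (s *\<^sub>R 1 - a) \<le> s" and t: "t \<ge> 0" "norm (t *\<^sub>R 1 - b) \<le> t"
    using assms by (auto simp: pos_def)
  have "norm ((s + t) *\<^sub>R 1 - (a + b)) \<le> s + t"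
    using norm_triangle_ineq [of "s *\<^sub>R 1 - a" "t *\<^sub>R 1 - b"] s t
    by (simp add: algebra_simps)
  then show ?thesis
    using assms s t unfolding pos_def by (intro conjI exI [of _ "s + t"]) (auto simp: selfadj_add)
qed

lemma pos_0 [simp]: "pos 0"
  by (auto simp: pos_def intro: exI [of _ 0])

lemma pos_sum: "(\<And>i. i \<in> A \<Longrightarrow> pos (f i)) \<Longrightarrow> pos (sum f A)"
  by (induction A rule: infinite_finite_induct) (simp_all add: pos_add)

lemma pos_scaleR:
  assumes "pos a" "r \<ge> 0"
  shows "pos (r *\<^sub>R a)"
proof -
  obtain t where t: "t \<ge> 0" "norm (t *\<^sub>R 1 - a) \<le> t"
    using assms by (auto simp: pos_def)
  have "norm ((r * t) *\<^sub>R 1 - r *\<^sub>R a) = r * norm (t *\<^sub>R 1 - a)"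
    using assms by (simp flip: scaleR_scaleR scaleR_diff_right)
  also have "\<dots> \<le> r * t"
    using assms t by (intro mult_left_mono)
  finally show ?thesis
    using assms t unfolding pos_def by (intro conjI exI [of _ "r * t"]) (auto simp: selfadj_scaleR)
qed

lemma pos_norm_diff: "selfadj b \<Longrightarrow> norm b \<le> r \<Longrightarrow> pos (r *\<^sub>R 1 - b)"
  unfolding pos_def using norm_ge_zero [of b]
  by (intro conjI exI [of _ r]) (auto simp: selfadj_diff selfadj_scaleR simp del: norm_ge_zero)

text \<open>The element z = h + i k is normal with \<open>star z * z\<close> equal to h^2 + k^2, and
  h is its real part, so norm h \<le> norm z. For commuting elements this gives monotonicity of the
  norm before squares are known to be positive.\<close>

lemma norm_square_le:
  assumes "selfadj h" "selfadj k" "h * k = k * h"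
  shows "norm (h * h) \<le> norm (h * h + k * k)"
proof -
  define z where "z = h + scaleC \<i> k"
  have star_z: "star z = h - scaleC \<i> k"
    using assms by (simp add: z_def selfadj_def star_add star_scaleC scaleC_minus_left)
  have "star z * z = h * h + k * k"
    unfolding star_z using assms
    by (simp add: z_def algebra_simps scaleC_mult_left scaleC_mult_right scaleC_scaleC scaleC_diff_right)
  then have z2: "(norm z)\<^sup>2 = norm (h * h + k * k)"
    by (metis cstar_identity)
  have "2 *\<^sub>R h = z + star z"
    by (simp add: star_z) (simp add: z_def scaleR_2)
  then have "2 * norm h \<le> norm z + norm (star z)"
    by (metis norm_triangle_ineq norm_scaleR abs_numeral)
  then have "norm h \<le> norm z"
    by simp
  then have "(norm h)\<^sup>2 \<le> (norm z)\<^sup>2"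
    by (simp add: power_mono)
  then show ?thesis
    using assms z2 by (simp add: norm_selfadj_square)
qed

subsection \<open>Square roots\<close>

text \<open>Taylor coefficients of (1 - t)^(1/2) at t = 0.\<close>

definition sqrt_coeff :: "nat \<Rightarrow> real"
  where "sqrt_coeff k = (1/2 gchoose k) * (- 1) ^ k"

text \<open>Taylor coefficients of (1 - t)^(-1/2). This function is (1 - t)^(1/2) divided by 1 - t,
  so they are the partial sums of \<open>sqrt_coeff\<close> in closed form, from which sign and
  monotonicity can be read off.\<close>

definition sqrt_partial :: "nat \<Rightarrow> real"
  where "sqrt_partial n = (- 1) ^ n * (- 1/2 gchoose n)"

lemma sqrt_partial_eq: "sqrt_partial n = (\<Sum>k\<le>n. sqrt_coeff k)"
  using gbinomial_sum_lower_neg [of "1/2::real" n] by (simp add: sqrt_partial_def sqrt_coeff_def)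

lemma sqrt_partial_Suc: "sqrt_partial (Suc n) = sqrt_partial n * ((n + 1/2) / (n + 1))"
proof -
  have *: "(- 1/2 gchoose Suc n) = (- 1/2 gchoose n) * (- 1/2 - real n) / (real n + 1)"
    using gbinomial_mult_1 [of "- 1/2::real" n] by (simp add: field_simps)
  then show ?thesis
    unfolding sqrt_partial_def * by (simp add: divide_simps) (simp add: algebra_simps)
qed

lemma sqrt_partial_nonneg: "sqrt_partial n \<ge> 0"
proof (induction n)
  case 0
  show ?case by (simp add: sqrt_partial_def)
qed (simp add: sqrt_partial_Suc)

lemma sqrt_coeff_Suc: "sqrt_coeff (Suc n) = sqrt_partial (Suc n) - sqrt_partial n"
  by (simp add: sqrt_partial_eq)

lemma sqrt_partial_decseq: "decseq sqrt_partial"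
proof (rule decseq_SucI)
  fix n
  show "sqrt_partial (Suc n) \<le> sqrt_partial n"
    unfolding sqrt_partial_Suc using sqrt_partial_nonneg [of n] by (intro mult_right_le_one_le) auto
qed

text \<open>The partial sums decrease from 1 and stay nonnegative, so all coefficients of positive
  index are \<le> 0 and their absolute values telescope to 1 minus the limit. Hence the series
  converges in norm on the whole closed unit ball, and its terms of positive index contribute at
  most 1.\<close>

lemma sqrt_coeff_abs:
  obtains s where "(\<lambda>n. \<bar>sqrt_coeff (Suc n)\<bar>) sums s" "s \<le> 1"
proof -
  obtain l where l: "sqrt_partial \<longlonglongrightarrow> l"
    using decseq_convergent [OF sqrt_partial_decseq] sqrt_partial_nonneg by blast
  have "l \<ge> 0"
    using l sqrt_partial_nonneg by (intro LIMSEQ_le_const) auto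
  have "(\<lambda>n. sqrt_partial n - sqrt_partial (Suc n)) sums (sqrt_partial 0 - l)"
    using l by (rule telescope_sums')
  moreover have "\<bar>sqrt_coeff (Suc n)\<bar> = sqrt_partial n - sqrt_partial (Suc n)" for n
    using decseqD [OF sqrt_partial_decseq, of n "Suc n"] by (simp add: sqrt_coeff_Suc)
  ultimately show ?thesis
    using \<open>l \<ge> 0\<close> by (intro that [of "sqrt_partial 0 - l"]) (auto simp: sqrt_partial_def)
qed

text \<open>Squaring the series of (1 - t)^(1/2) must give 1 - t; on coefficients this is
  Vandermonde's identity for 1/2 + 1/2.\<close>

lemma sqrt_coeff_convolution:
  "(\<Sum>i\<le>k. sqrt_coeff i * sqrt_coeff (k - i)) = (if k = 0 then 1 else if k = 1 then - 1 else 0)"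
proof -
  have "(\<Sum>i\<le>k. sqrt_coeff i * sqrt_coeff (k - i))
      = (\<Sum>i\<le>k. (1/2 gchoose i) * (1/2 gchoose (k - i)) * (- 1) ^ k)"
    by (intro sum.cong refl) (auto simp: sqrt_coeff_def simp flip: power_add)
  also have "\<dots> = (1 gchoose k) * (- 1) ^ k"
    using gbinomial_Vandermonde [of "1/2::real" "1/2" k]
    by (simp flip: sum_distrib_right add: atMost_atLeast0)
  also have "(1 gchoose k) = real (1 choose k)"
    by (metis binomial_gbinomial of_nat_1)
  finally show ?thesis
    by (cases k) (auto simp: binomial_eq_0 split: nat.splits)
qed

text \<open>The root is the binomial series at h, which converges even if norm h = 1. The bound on 1
  - y is positivity of y with the constant 1, once y is self-adjoint. The last conclusion says that
  y is a limit of polynomials in h: it transfers commutation with h to y and keeps y in every closed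
  unital subalgebra that contains h.\<close>

lemma sqrt_one_minus:
  fixes h :: "'a::unital_cstar"
  assumes h: "norm h \<le> 1"
  obtains y where "y * y = 1 - h" "norm (1 - y) \<le> 1"
    "star h = h \<Longrightarrow> star y = y"
    "y \<in> closure (span (range (\<lambda>n. h ^ n)))"
proof -
  define a where "a k = sqrt_coeff k *\<^sub>R h ^ k" for k
  have nh: "norm (h ^ k) \<le> 1" for k
  proof (induction k)
    case (Suc k)
    have "norm (h ^ Suc k) \<le> norm h * norm (h ^ k)"
      by (simp add: norm_mult_ineq)
    also have "\<dots> \<le> 1 * 1"
      using h Suc by (intro mult_mono) auto
    finally show ?case by simp
  qed (simp add: norm_one_le)
  obtain s where s: "(\<lambda>n. \<bar>sqrt_coeff (Suc n)\<bar>) sums s" "s \<le> 1"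
    by (rule sqrt_coeff_abs)
  have na: "norm (a k) \<le> \<bar>sqrt_coeff k\<bar>" for k
    using nh [of k] by (simp add: a_def mult_left_le)
  have "summable (\<lambda>k. \<bar>sqrt_coeff k\<bar>)"
    using s summable_Suc_iff [of "\<lambda>k. \<bar>sqrt_coeff k\<bar>"] by (simp add: sums_iff)
  then have sn: "summable (\<lambda>k. norm (a k))"
    using na by (intro summable_comparison_test [of "\<lambda>k. norm (a k)"]) auto
  then have sa: "summable a"
    by (rule summable_norm_cancel)
  define y where "y = suminf a"
  have a_sums: "a sums y"
    using sa by (simp add: y_def summable_sums)
  have prod: "(\<Sum>i\<le>k. a i * a (k - i)) = (\<Sum>i\<le>k. sqrt_coeff i * sqrt_coeff (k - i)) *\<^sub>R h ^ k" for k
  proof -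
    have "(\<Sum>i\<le>k. a i * a (k - i)) = (\<Sum>i\<le>k. (sqrt_coeff i * sqrt_coeff (k - i)) *\<^sub>R h ^ k)"
      by (intro sum.cong refl) (auto simp: a_def simp flip: power_add)
    then show ?thesis
      by (simp add: scaleR_sum_left)
  qed
  show ?thesis
  proof (rule that [of y])
    have "(\<lambda>k. \<Sum>i\<le>k. a i * a (k - i)) sums (y * y)"
      unfolding y_def by (intro Cauchy_product_sums sn)
    moreover have "(\<lambda>k. \<Sum>i\<le>k. a i * a (k - i)) sums (\<Sum>k\<in>{0,1}. \<Sum>i\<le>k. a i * a (k - i))"
      by (rule sums_finite) (auto simp: prod sqrt_coeff_convolution)
    ultimately have "y * y = (\<Sum>k\<in>{0,1}. \<Sum>i\<le>k. a i * a (k - i))"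
      by (rule sums_unique2)
    then show "y * y = 1 - h"
      unfolding prod sqrt_coeff_convolution by simp
  next
    have "(\<lambda>n. a (Suc n)) sums (y - a 0)"
      using a_sums by (simp add: sums_Suc_iff)
    moreover have "a 0 = 1"
      by (simp add: a_def sqrt_coeff_def)
    ultimately have y1: "(\<lambda>n. a (Suc n)) sums (y - 1)"
      by simp
    have "norm (y - 1) \<le> (\<Sum>n. norm (a (Suc n)))"
      using y1 sn summable_Suc_iff [of "\<lambda>n. norm (a n)"] summable_norm [of "\<lambda>n. a (Suc n)"]
      by (simp add: sums_iff)
    also have "\<dots> \<le> (\<Sum>n. \<bar>sqrt_coeff (Suc n)\<bar>)"
      using sn s na summable_Suc_iff [of "\<lambda>n. norm (a n)"] by (intro suminf_le) (auto simp: sums_iff)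
    finally have "norm (y - 1) \<le> (\<Sum>n. \<bar>sqrt_coeff (Suc n)\<bar>)" .
    then show "norm (1 - y) \<le> 1"
      using s by (simp add: norm_minus_commute sums_iff)
  next
    assume "star h = h"
    then have "star (a k) = a k" for k
      by (simp add: a_def star_scaleR star_power)
    then show "star y = y"
      using bounded_linear.sums [OF bounded_linear_star a_sums] a_sums by (metis (no_types, lifting) sums_cong sums_unique2)
  next
    have "(\<Sum>k<n. a k) \<in> span (range (\<lambda>n. h ^ n))" for n
      unfolding a_def by (intro span_sum span_scale span_base) auto
    then show "y \<in> closure (span (range (\<lambda>n. h ^ n)))"
      using a_sums unfolding sums_def closure_sequential
      by (intro exI [of _ "\<lambda>n. \<Sum>k<n. a k"]) auto
  qed
qed

lemma sqrt_one_minus_commute: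
  fixes h :: "'a::unital_cstar"
  assumes "y \<in> closure (span (range (\<lambda>n. h ^ n)))" "z * h = h * z"
  shows "z * y = y * z"
proof -
  have pow: "z * h ^ n = h ^ n * z" for n
  proof (induction n)
    case (Suc n)
    then have "z * (h * h ^ n) = h * h ^ n * z"
      using assms(2) by (metis mult.assoc)
    then show ?case by simp
  qed simp
  have "span (range (\<lambda>n. h ^ n)) \<subseteq> {y. z * y = y * z}"
    by (rule span_minimal) (auto simp: pow subspace_def algebra_simps)
  then have "closure (span (range (\<lambda>n. h ^ n))) \<subseteq> {y. z * y = y * z}"
    by (rule closure_minimal) (intro closed_Collect_eq continuous_intros)
  then show ?thesis
    using assms(1) by blast
qed

lemma pos_sqrt:
  fixes a :: "'a::unital_cstar"
  assumes "pos a"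
  obtains y where "pos y" "y * y = a" "\<And>z. z * a = a * z \<Longrightarrow> z * y = y * z"
proof -
  obtain t where t: "t \<ge> 0" "norm (t *\<^sub>R 1 - a) \<le> t" and sa: "star a = a"
    using assms by (auto simp: pos_def selfadj_def)
  show ?thesis
  proof (cases "t = 0")
    case True
    with t have "a = 0" by simp
    then show ?thesis by (intro that [of 0]) auto
  next
    case False
    with t have t0: "t > 0" by simp
    \<comment> \<open>The constant t from \<open>pos\<close> is the scale at which a = t (1 - h)
      with norm h \<le> 1, so the root of a is sqrt t times the root of 1 - h.\<close>
    define h where "h = 1 - (1 / t) *\<^sub>R a"
    have "t *\<^sub>R h = t *\<^sub>R 1 - a"
      using t0 by (simp add: h_def algebra_simps)
    then have "t * norm h \<le> t"
      using t t0 by (metis abs_of_pos norm_scaleR)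
    then have nh: "norm h \<le> 1"
      using t0 by simp
    obtain y where y: "y * y = 1 - h" "norm (1 - y) \<le> 1" "star h = h \<Longrightarrow> star y = y"
      and S: "y \<in> closure (span (range (\<lambda>n. h ^ n)))"
      using sqrt_one_minus [OF nh] by metis
    have sy: "star y = y"
      using sa by (intro y) (simp add: h_def star_diff star_scaleR)
    show ?thesis
    proof (rule that [of "sqrt t *\<^sub>R y"])
      show "sqrt t *\<^sub>R y * sqrt t *\<^sub>R y = a"
        using t0 by (simp add: y h_def)
      have "pos y"
        using y(2) sy by (auto simp: pos_def selfadj_def intro!: exI [of _ 1])
      then show "pos (sqrt t *\<^sub>R y)"
        using t0 by (intro pos_scaleR) auto
      fix z assume "z * a = a * z"
      then have "z * h = h * z"
        by (simp add: h_def algebra_simps)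
      then have "z * y = y * z"
        by (rule sqrt_one_minus_commute [OF S])
      then show "z * sqrt t *\<^sub>R y = sqrt t *\<^sub>R y * z"
        by simp
    qed
  qed
qed

text \<open>For k = h / norm h, the root y of 1 - k^2 commutes with k, and y^2 + k^2 = 1 bounds the
  norm of y^2 by 1. This makes squares of self-adjoint elements positive, with the explicit constant
  (norm h)^2.\<close>

lemma norm_square_defect:
  fixes h :: "'a::unital_cstar"
  assumes "selfadj h"
  shows "norm ((norm h)\<^sup>2 *\<^sub>R 1 - h * h) \<le> (norm h)\<^sup>2"
proof (cases "h = 0")
  case False
  define k where "k = (1 / norm h) *\<^sub>R h"
  have sk: "selfadj k"
    using assms by (simp add: k_def selfadj_scaleR)
  have nk: "norm (k * k) \<le> 1"
    using False sk by (simp add: norm_selfadj_square) (simp add: k_def)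
  obtain y where y: "y * y = 1 - k * k" "star (k * k) = k * k \<Longrightarrow> star y = y"
    and S: "y \<in> closure (span (range (\<lambda>n. (k * k) ^ n)))"
    using sqrt_one_minus [OF nk] by metis
  have "selfadj y"
    using y(2) sk by (simp add: selfadj_def star_mult)
  moreover have "y * k = k * y"
    using sqrt_one_minus_commute [OF S, of k] by (simp add: mult.assoc)
  ultimately have "norm (y * y) \<le> norm (y * y + k * k)"
    using sk by (intro norm_square_le) auto
  also have "\<dots> \<le> 1"
    using norm_one_le by (simp add: y)
  finally have *: "norm (1 - k * k) \<le> 1"
    by (simp add: y)
  have "(norm h)\<^sup>2 *\<^sub>R 1 - h * h = (norm h)\<^sup>2 *\<^sub>R (1 - k * k)"
    using False by (simp add: k_def algebra_simps power2_eq_square)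
  then have "norm ((norm h)\<^sup>2 *\<^sub>R 1 - h * h) = (norm h)\<^sup>2 * norm (1 - k * k)"
    by simp
  also have "\<dots> \<le> (norm h)\<^sup>2"
    using * by (simp add: mult_left_le)
  finally show ?thesis .
qed simp

lemma pos_square: "selfadj (h::'a::unital_cstar) \<Longrightarrow> pos (h * h)"
  unfolding pos_def using norm_square_defect [of h]
  by (intro conjI exI [of _ "(norm h)\<^sup>2"]) (auto intro: selfadj_mult)

text \<open>The free constant in \<open>pos\<close> can be taken to be norm a: a positive element is
  the square of a self-adjoint one, and \<open>norm_square_defect\<close> supplies this constant.
  The sharp value matters in \<open>pos_swap\<close>, where powers are compared with powers of the
  same number.\<close>

lemma pos_iff_norm: "pos (a::'a::unital_cstar) \<longleftrightarrow> selfadj a \<and> norm (norm a *\<^sub>R 1 - a) \<le> norm a"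
proof
  assume a: "pos a"
  then obtain y where y: "pos y" "y * y = a"
    using pos_sqrt by metis
  then have "norm a = (norm y)\<^sup>2"
    using norm_selfadj_square [of y] by (auto simp: pos_selfadj)
  then show "selfadj a \<and> norm (norm a *\<^sub>R 1 - a) \<le> norm a"
    using norm_square_defect [of y] y a by (auto simp: pos_selfadj)
next
  assume "selfadj a \<and> norm (norm a *\<^sub>R 1 - a) \<le> norm a"
  then show "pos a"
    unfolding pos_def by (intro conjI exI [of _ "norm a"]) auto
qed

text \<open>In the order, -r \<le> h \<le> r. The roots y of r - h and z of r + h commute with each
  other and with h, and (y z)^2 = r^2 - h^2; so h^2 is dominated by h^2 + (y z)^2 = r^2.\<close>

lemma norm_le_of_pos:
  fixes h :: "'a::unital_cstar"
  assumes h: "selfadj h" and r: "r \<ge> 0" and "pos (r *\<^sub>R 1 - h)" "pos (r *\<^sub>R 1 + h)"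
  shows "norm h \<le> r"
proof -
  obtain y where y: "pos y" "y * y = r *\<^sub>R 1 - h"
    and yc: "\<And>z. z * (r *\<^sub>R 1 - h) = (r *\<^sub>R 1 - h) * z \<Longrightarrow> z * y = y * z"
    using pos_sqrt [OF assms(3)] by metis
  obtain z where z: "pos z" "z * z = r *\<^sub>R 1 + h"
    and zc: "\<And>y. y * (r *\<^sub>R 1 + h) = (r *\<^sub>R 1 + h) * y \<Longrightarrow> y * z = z * y"
    using pos_sqrt [OF assms(4)] by metis
  have hz: "h * z = z * h"
    by (rule zc) (simp add: algebra_simps)
  have hy: "h * y = y * h"
    by (rule yc) (simp add: algebra_simps)
  have zy: "z * y = y * z"
    by (rule yc) (simp add: algebra_simps hz)
  have sw: "selfadj (y * z)"
    using y z zy by (intro selfadj_mult) (auto simp: pos_selfadj)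
  have "(y * z) * (y * z) = y * y * (z * z)"
    by (metis zy mult.assoc)
  also have "\<dots> = r\<^sup>2 *\<^sub>R 1 - h * h"
    by (simp add: y z algebra_simps power2_eq_square)
  finally have eq: "h * h + (y * z) * (y * z) = r\<^sup>2 *\<^sub>R 1"
    by simp
  have "h * (y * z) = (y * z) * h"
    by (metis hz hy mult.assoc)
  then have "norm (h * h) \<le> norm (h * h + (y * z) * (y * z))"
    using h sw by (intro norm_square_le) auto
  also have "\<dots> \<le> r\<^sup>2"
    unfolding eq using mult_left_le [OF norm_one_le [where 'a = 'a], of "r\<^sup>2"] by simp
  finally show ?thesis
    using h r by (simp add: norm_selfadj_square power2_le_iff_abs_le)
qed

text \<open>The spectral statement \<open>\<sigma>(x\<^sup>* x) \<union> {0} = \<sigma>(x x\<^sup>*) \<union> {0}\<close> enters only through a growth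
  estimate for the powers of \<open>\<parallel>x\<parallel>\<^sup>2 - x\<^sup>* x\<close>.\<close>

lemma linear_growth_bound:
  fixes q :: real
  assumes "\<And>m. q ^ 2 ^ m \<le> 1 + 2 ^ m"
  shows "q \<le> 1"
proof (rule ccontr)
  assume "\<not> q \<le> 1"
  define e where "e = q - 1"
  have e: "e > 0"
    using \<open>\<not> q \<le> 1\<close> by (simp add: e_def)
  \<comment> \<open>Bernoulli's bound 1 + n e is only linear in n and is therefore squared: its term
    n^2 e^2 exceeds 2 n once n e^2 > 2, which the choice n = 2^m secures. The square of q^n has the
    next admissible exponent, for which the hypothesis gives 1 + 2 n.\<close>
  obtain m where m: "2 / e\<^sup>2 < 2 ^ m"
    using real_arch_pow [of 2 "2 / e\<^sup>2"] by auto
  define n :: nat where "n = 2 ^ m"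
  have n: "2 < n * e\<^sup>2" "n > 0"
    using m e by (auto simp: n_def field_simps)
  have "1 + n * e \<le> q ^ n"
    using Bernoulli_inequality [of e n] e by (simp add: e_def)
  then have "(1 + n * e)\<^sup>2 \<le> (q ^ n)\<^sup>2"
    using e by (intro power_mono) auto
  also have "(q ^ n)\<^sup>2 = q ^ 2 ^ Suc m"
    by (simp add: n_def power_mult mult.commute flip: power_mult)
  also have "\<dots> \<le> 1 + 2 ^ Suc m"
    by (rule assms)
  also have "\<dots> = 1 + 2 * real n"
    by (simp add: n_def)
  finally have "(1 + n * e)\<^sup>2 \<le> 1 + 2 * real n" .
  moreover have "(1 + n * e)\<^sup>2 = 1 + 2 * (n * e) + n * (n * e\<^sup>2)"
    by (simp add: power2_eq_square algebra_simps)
  moreover have "real n * (n * e\<^sup>2) > real n * 2"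
    using n by (intro mult_strict_left_mono) auto
  moreover have "n * e > 0"
    using n e by simp
  ultimately show False
    by linarith
qed

text \<open>With s = (norm x)^2, the elements d = s - x* x and e = s - x x* are intertwined by x d =
  e x. Positivity of x x* bounds the powers of e by those of s, and the recursion d^(n+1) = s d^n -
  x* e^n x then costs only the factor 1 + n. As d is self-adjoint, the exponents 2^m absorb this
  factor, and norm d \<le> s.\<close>

lemma pos_swap:
  fixes x :: "'a::unital_cstar"
  assumes "pos (x * star x)"
  shows "pos (star x * x)"
proof -
  define s where "s = (norm x)\<^sup>2"
  define d where "d = s *\<^sub>R 1 - star x * x"
  define e where "e = s *\<^sub>R 1 - x * star x"
  have s0: "s \<ge> 0"
    by (simp add: s_def)
  have nx: "norm (x * star x) = s"
    using cstar_identity [of "star x"] by (simp add: s_def star_star)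
  have ne: "norm e \<le> s"
    using assms by (simp add: pos_iff_norm e_def nx)
  have nepow: "norm (e ^ n) \<le> s ^ n" for n
  proof (induction n)
    case (Suc n)
    have "norm (e ^ Suc n) \<le> norm e * norm (e ^ n)"
      by (simp add: norm_mult_ineq)
    also have "\<dots> \<le> s * s ^ n"
      using ne Suc by (intro mult_mono) (auto simp: s_def)
    finally show ?case by simp
  qed (simp add: norm_one_le)
  have xd: "x * d = e * x"
    by (simp add: d_def e_def algebra_simps)
  have xdn: "x * d ^ n = e ^ n * x" for n
  proof (induction n)
    case (Suc n)
    have "x * d ^ Suc n = e * (x * d ^ n)"
      by (simp add: xd flip: mult.assoc)
    then show ?case
      by (simp add: Suc mult.assoc)
  qed simp
  have ndpow: "norm (d ^ n) \<le> s ^ n * (1 + n)" for n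
  proof (induction n)
    case (Suc n)
    have "d ^ Suc n = s *\<^sub>R d ^ n - star x * (e ^ n * x)"
      by (simp add: d_def left_diff_distrib mult.assoc flip: xdn)
    then have "norm (d ^ Suc n) \<le> s * norm (d ^ n) + norm (star x * (e ^ n * x))"
      using norm_triangle_ineq4 [of "s *\<^sub>R d ^ n" "star x * (e ^ n * x)"] s0 by simp
    also have "norm (star x * (e ^ n * x)) \<le> norm (star x) * norm (e ^ n * x)"
      by (rule norm_mult_ineq)
    also have "norm (e ^ n * x) \<le> norm (e ^ n) * norm x"
      by (rule norm_mult_ineq)
    also have "norm (e ^ n) \<le> s ^ n"
      by (rule nepow)
    finally have "norm (d ^ Suc n) \<le> s * norm (d ^ n) + norm x * (s ^ n * norm x)"
      by (simp add: mult_left_mono mult_right_mono)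
    also have "norm x * (s ^ n * norm x) = s * s ^ n"
      by (simp add: s_def power2_eq_square)
    also have "s * norm (d ^ n) \<le> s * (s ^ n * (1 + n))"
      using Suc s0 by (intro mult_left_mono)
    finally show ?case
      by (simp add: algebra_simps)
  qed (simp add: norm_one_le)
  have sd: "selfadj d"
    by (simp add: d_def selfadj_diff selfadj_scaleR)
  have "norm d \<le> s"
  proof (cases "s = 0")
    case True
    then show ?thesis
      using ndpow [of 1] by simp
  next
    case False
    with s0 have s1: "s > 0" by simp
    have "(norm d / s) ^ 2 ^ m \<le> 1 + 2 ^ m" for m
      using ndpow [of "2 ^ m"] norm_selfadj_power [OF sd, of m] s1
      by (simp add: power_divide field_simps)
    then have "norm d / s \<le> 1"
      by (rule linear_growth_bound)
    then show ?thesis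
      using s1 by simp
  qed
  then show ?thesis
    unfolding pos_def d_def using s0 by auto
qed

text \<open>Kaplansky's argument. For a = x* x and y the root of a^2, m = y - a is twice the
  negative part of a. The element z = x m satisfies z* z = -w with w = m^3 / 2 positive, whereas z
  z* + z* z is half a sum of two squares of self-adjoint elements; so z z* is positive. By
  \<open>pos_swap\<close>, -w is positive as well, hence w = 0, m = 0 and a = y.\<close>

lemma pos_star_mult: "pos (star x * x)" for x :: "'a::unital_cstar"
proof -
  define a where "a = star x * x"
  have sa: "selfadj a"
    by (simp add: a_def)
  obtain y where y: "pos y" "y * y = a * a" and yc: "\<And>z. z * (a * a) = a * a * z \<Longrightarrow> z * y = y * z"
    using pos_sqrt [OF pos_square [OF sa]] by metis
  have ay: "a * y = y * a"
    by (rule yc) (simp add: mult.assoc)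
  define m where "m = y - a"
  have sm: "selfadj m"
    using y sa by (simp add: m_def selfadj_diff pos_selfadj)
  have 0: "(y + a) * m = 0" "m * (y + a) = 0"
    by (simp_all add: m_def algebra_simps y ay)
  \<comment> \<open>m commutes with y and hence with its root s, so m y m is the square of the
    self-adjoint element s m. This exhibits m^3 = 2 m y m as positive.\<close>
  obtain s where s: "pos s" "s * s = y" and sc: "\<And>z. z * y = y * z \<Longrightarrow> z * s = s * z"
    using pos_sqrt [OF y(1)] by metis
  have ms: "m * s = s * m"
    by (rule sc) (simp add: m_def algebra_simps ay)
  define w where "w = (s * m) * (s * m)"
  have w: "pos w"
    unfolding w_def using s sm ms by (intro pos_square selfadj_mult) (auto simp: pos_selfadj)
  have "m * m = 2 *\<^sub>R (m * y) - m * (y + a)"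
    by (simp add: m_def algebra_simps scaleR_2)
  then have mm: "m * m = 2 *\<^sub>R (m * y)"
    by (simp add: 0)
  have "m * m * m = 2 *\<^sub>R (m * (s * s) * m)"
    unfolding mm by (simp add: s)
  also have "m * (s * s) * m = w"
    unfolding w_def by (metis ms mult.assoc)
  finally have mmm: "m * m * m = 2 *\<^sub>R w" .
  define z where "z = x * m"
  have zz: "star z * z = m * a * m"
    using sm by (simp add: z_def a_def star_mult selfadj_def mult.assoc)
  have "2 *\<^sub>R (m * a * m) = m * ((y + a) * m) - m * m * m"
    by (simp add: m_def algebra_simps scaleR_2)
  then have "2 *\<^sub>R (m * a * m) = - 2 *\<^sub>R w"
    by (simp add: 0 mmm)
  then have zw: "star z * z = - w"
    unfolding zz by (metis scaleR_minus_left scaleR_minus_right scaleR_cancel_left zero_neq_numeral)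
  define p where "p = z + star z"
  define q where "q = scaleC \<i> (z - star z)"
  have pq: "p * p + q * q = 2 *\<^sub>R (z * star z) + 2 *\<^sub>R (star z * z)"
    by (simp add: p_def q_def scaleC_mult_left scaleC_mult_right scaleC_scaleC scaleC_diff_right
        algebra_simps scaleR_2)
  have "z * star z = (1/2) *\<^sub>R (p * p + q * q + 2 *\<^sub>R w)"
    unfolding pq zw by (simp add: algebra_simps)
  moreover have "pos ((1/2) *\<^sub>R (p * p + q * q + 2 *\<^sub>R w))"
    using w selfadj_imaginary [of z] by (intro pos_add pos_square pos_scaleR) (auto simp: p_def q_def)
  ultimately have "pos (- w)"
    using pos_swap [of z] by (simp add: zw)
  then have "norm w \<le> 0"
    using w by (intro norm_le_of_pos) (auto simp: pos_selfadj)
  then have "m * m * m = 0"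
    by (simp add: mmm)
  then have "(m * m) * (m * m) = 0"
    by (simp flip: mult.assoc)
  then have "norm ((m * m) * (m * m)) = 0"
    by simp
  then have "m = 0"
    using sm by (simp add: norm_selfadj_square selfadj_mult)
  then show ?thesis
    using y by (simp add: m_def a_def)
qed

lemma pos_conj:
  fixes a :: "'a::unital_cstar"
  assumes "pos a"
  shows "pos (star x * a * x)"
proof -
  obtain y where y: "pos y" "y * y = a"
    using pos_sqrt [OF assms] by metis
  then have "star y = y"
    by (metis pos_selfadj selfadj_def)
  then have "star x * a * x = star (y * x) * (y * x)"
    unfolding y(2) [symmetric] by (simp add: star_mult mult.assoc)
  then show ?thesis
    by (simp add: pos_star_mult)
qed

lemma pos_norm_mono:
  fixes a b :: "'a::unital_cstar"
  assumes "pos a" "pos (b - a)"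
  shows "norm a \<le> norm b"
proof (rule norm_le_of_pos)
  have "selfadj b"
    using selfadj_add [OF pos_selfadj [OF assms(1)] pos_selfadj [OF assms(2)]] by simp
  then have "pos (norm b *\<^sub>R 1 - b)"
    by (simp add: pos_norm_diff)
  from pos_add [OF this assms(2)] show "pos (norm b *\<^sub>R 1 - a)"
    by simp
  have "pos (norm b *\<^sub>R 1)"
    using pos_norm_diff [of 0 "norm b"] by simp
  then show "pos (norm b *\<^sub>R 1 + a)"
    using assms by (intro pos_add)
qed (use assms in \<open>auto simp: pos_selfadj\<close>)

text \<open>Here a, b, c stand for the inner products of f with f, g with g and f with g, and the
  hypothesis is positivity of the square of g - f u. With u = c / A for A > norm a, adding u* (A -
  a) u removes a and leaves b - c* c / A positive. The strict inequality avoids division by norm a =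
  0; letting A decrease to norm a gives the claim.\<close>

lemma pos_cauchy_schwarz:
  fixes a b c :: "'a::unital_cstar"
  assumes a: "selfadj a" and *: "\<And>u. pos (b - star c * u - star u * c + star u * a * u)"
  shows "(norm c)\<^sup>2 \<le> norm a * norm b"
proof -
  have le: "(norm c)\<^sup>2 \<le> A * norm b" if "A > norm a" for A
  proof -
    have A: "A > 0"
      using that norm_ge_zero [of a] by linarith
    define r where "r = 1 / A"
    have r: "A * r = 1" "r > 0"
      using A by (simp_all add: r_def)
    define u where "u = r *\<^sub>R c"
    have 1: "pos (b - star c * u - star u * c + star u * a * u)"
      by (rule *)
    have 2: "pos (star u * (A *\<^sub>R 1 - a) * u)"
      using a that by (intro pos_conj pos_norm_diff) auto
    have eq1: "star u * a * u = (r * r) *\<^sub>R (star c * a * c)"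
      by (simp add: u_def star_scaleR)
    have eq2: "star u * (A *\<^sub>R 1 - a) * u = r *\<^sub>R (star c * c) - (r * r) *\<^sub>R (star c * a * c)"
    proof -
      have "r *\<^sub>R star c * (A *\<^sub>R 1 - a) * r *\<^sub>R c
          = ((A * r) * r) *\<^sub>R (star c * c) - (r * r) *\<^sub>R (star c * a * c)"
        by (simp add: right_diff_distrib left_diff_distrib scaleR_diff_right)
      then show ?thesis
        unfolding r by (simp add: u_def star_scaleR)
    qed
    have eq: "(b - star c * u - star u * c + star u * a * u) + star u * (A *\<^sub>R 1 - a) * u
        = b - r *\<^sub>R (star c * c)"
      unfolding eq1 eq2 by (simp add: u_def star_scaleR)
    have "pos (b - r *\<^sub>R (star c * c))"
      using pos_add [OF 1 2] unfolding eq .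
    moreover have "pos (r *\<^sub>R (star c * c))"
      using r by (intro pos_scaleR pos_star_mult) auto
    ultimately have "norm (r *\<^sub>R (star c * c)) \<le> norm b"
      by (intro pos_norm_mono)
    then have "r * (norm c)\<^sup>2 \<le> norm b"
      using r by (simp add: cstar_identity)
    then show ?thesis
      using A by (simp add: r_def field_simps)
  qed
  show ?thesis
  proof (cases "norm b = 0")
    case True
    then show ?thesis
      using le [of "norm a + 1"] by simp
  next
    case False
    then have "norm b > 0" by simp
    have "(norm c)\<^sup>2 / norm b \<le> norm a"
    proof (rule dense_ge)
      fix A assume "norm a < A"
      then show "(norm c)\<^sup>2 / norm b \<le> A"
        using le [of A] \<open>norm b > 0\<close> by (simp add: field_simps)
    qed
    then show ?thesis
      using \<open>norm b > 0\<close> by (simp add: field_simps)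
  qed
qed

text \<open>Applied in two algebras: in B for the inner product of the module, and in the algebra of
  adjointable operators for the tail estimate.\<close>

lemma sum_cauchy_schwarz:
  fixes f g :: "'i \<Rightarrow> 'a::unital_cstar"
  shows "(norm (\<Sum>i\<in>I. star (f i) * g i))\<^sup>2
    \<le> norm (\<Sum>i\<in>I. star (f i) * f i) * norm (\<Sum>i\<in>I. star (g i) * g i)"
proof (rule pos_cauchy_schwarz)
  fix u :: 'a
  let ?c = "\<Sum>i\<in>I. star (f i) * g i"
  have c: "star ?c = (\<Sum>i\<in>I. star (g i) * f i)"
    by (simp add: star_sum star_mult star_star)
  have "(\<Sum>i\<in>I. star (g i - f i * u) * (g i - f i * u))
    = (\<Sum>i\<in>I. star (g i) * g i - star (g i) * f i * u - star u * (star (f i) * g i)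
        + star u * (star (f i) * f i) * u)"
    by (intro sum.cong refl) (simp add: star_diff star_mult algebra_simps)
  also have "\<dots> = (\<Sum>i\<in>I. star (g i) * g i) - star ?c * u - star u * ?c + star u * (\<Sum>i\<in>I. star (f i) * f i) * u"
    unfolding c by (simp only: sum.distrib sum_subtractf sum_distrib_left sum_distrib_right)
  finally have "\<dots> = (\<Sum>i\<in>I. star (g i - f i * u) * (g i - f i * u))" ..
  then show "pos ((\<Sum>i\<in>I. star (g i) * g i) - star ?c * u - star u * ?c + star u * (\<Sum>i\<in>I. star (f i) * f i) * u)"
    by (simp add: pos_sum pos_star_mult)
qed (simp add: selfadj_sum)

section \<open>The Hilbert module \<open>\<ell>\<^sup>2(\<int>) \<otimes> B\<close>\<close>

text \<open>The Cauchy criterion for unordered sums, with an arbitrary set function in place of the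
  norm of the partial sum. It thus covers norms of partial sums and their square roots
  alike.\<close>

definition tail_small :: "('i set \<Rightarrow> real) \<Rightarrow> bool"
  where "tail_small q \<longleftrightarrow>
    (\<forall>e>0. \<exists>F. finite F \<and> (\<forall>G. finite G \<longrightarrow> G \<inter> F = {} \<longrightarrow> q G < e))"

lemma tail_smallE:
  assumes "tail_small q" "e > 0"
  obtains F where "finite F" "\<And>G. finite G \<Longrightarrow> G \<inter> F = {} \<Longrightarrow> q G < e"
  using assms unfolding tail_small_def by meson

text \<open>There are two controlling functions because sums and inner products involve two
  sequences; for a single sequence both are the same.\<close>

lemma tail_small_transfer:
  assumes p: "tail_small p" and q: "tail_small q"
    and r: "\<And>e. e > 0 \<Longrightarrow> \<exists>d>0. \<forall>G. p G < d \<longrightarrow> q G < d \<longrightarrow> r G < e"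
  shows "tail_small r"
  unfolding tail_small_def
proof (intro allI impI)
  fix e :: real assume "e > 0"
  then obtain d where d: "d > 0" "\<And>G. p G < d \<Longrightarrow> q G < d \<Longrightarrow> r G < e"
    using r by meson
  obtain F F' where "finite F" "\<And>G. finite G \<Longrightarrow> G \<inter> F = {} \<Longrightarrow> p G < d"
    "finite F'" "\<And>G. finite G \<Longrightarrow> G \<inter> F' = {} \<Longrightarrow> q G < d"
    using tail_smallE [OF p d(1)] tail_smallE [OF q d(1)] by metis
  then show "\<exists>F. finite F \<and> (\<forall>G. finite G \<longrightarrow> G \<inter> F = {} \<longrightarrow> r G < e)"
    using d(2) by (intro exI [of _ "F \<union> F'"]) (auto simp: Int_Un_distrib)
qed

lemma summable_on_UNIV_iff_Cauchy:
  fixes f :: "'i \<Rightarrow> 'a::banach"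
  shows "f summable_on UNIV \<longleftrightarrow> tail_small (\<lambda>G. norm (sum f G))"
  unfolding tail_small_def
proof (intro iffI allI impI)
  fix e :: real
  assume "f summable_on UNIV" "e > 0"
  then obtain s where "(sum f \<longlongrightarrow> s) (finite_subsets_at_top UNIV)"
    by (auto simp: summable_on_def has_sum_def)
  then have "eventually (\<lambda>F. dist (sum f F) s < e / 2) (finite_subsets_at_top UNIV)"
    by (rule tendstoD) (use \<open>e > 0\<close> in simp)
  then obtain F where F: "finite F" "\<And>H. finite H \<Longrightarrow> F \<subseteq> H \<Longrightarrow> dist (sum f H) s < e / 2"
    by (auto simp: eventually_finite_subsets_at_top)
  have "norm (sum f G) < e" if "finite G" "G \<inter> F = {}" for G
  proof -
    have "sum f G = sum f (F \<union> G) - sum f F"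
      using that F by (subst sum.union_disjoint) auto
    moreover have "dist (sum f (F \<union> G)) (sum f F) < e"
      using F(2) [of "F \<union> G"] F(2) [of F] F(1) that dist_triangle_half_l [of "sum f (F \<union> G)" s e "sum f F"]
      by simp
    ultimately show ?thesis
      by (simp add: dist_norm)
  qed
  with F show "\<exists>F. finite F \<and> (\<forall>G. finite G \<longrightarrow> G \<inter> F = {} \<longrightarrow> norm (sum f G) < e)"
    by blast
next
  assume *: "\<forall>e>0. \<exists>F. finite F \<and> (\<forall>G. finite G \<longrightarrow> G \<inter> F = {} \<longrightarrow> norm (sum f G) < e)"
  then have "\<exists>F. finite F \<and> (\<forall>G. finite G \<longrightarrow> G \<inter> F = {} \<longrightarrow> norm (sum f G) < 1 / Suc k)" for k
    by simp
  then obtain F where F: "\<And>k. finite (F k)"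
    "\<And>k G. finite G \<Longrightarrow> G \<inter> F k = {} \<Longrightarrow> norm (sum f G) < 1 / Suc k"
    by metis
  \<comment> \<open>The sets F k need not be nested; their unions are, so the sums along H form an
    ordinary Cauchy sequence, whose limit is the unordered sum.\<close>
  define H where "H k = (\<Union>j\<le>k. F j)" for k
  have H: "finite (H k)" for k
    using F by (simp add: H_def)
  have FH: "F j \<subseteq> H k" if "j \<le> k" for j k
    using that by (auto simp: H_def)
  have diff: "dist (sum f G) (sum f (H k)) < 1 / Suc k" if "finite G" "H k \<subseteq> G" for k G
  proof -
    have "sum f G - sum f (H k) = sum f (G - H k)"
      using that by (simp add: sum_diff)
    moreover have "norm (sum f (G - H k)) < 1 / Suc k"
      using that FH [of k k] by (intro F(2)) auto
    ultimately show ?thesis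
      by (simp add: dist_norm)
  qed
  have "Cauchy (\<lambda>k. sum f (H k))"
  proof (rule metric_CauchyI)
    fix e :: real assume "e > 0"
    then obtain k where k: "1 / Suc k < e / 2"
      using nat_approx_posE [of "e / 2"] by auto
    have "dist (sum f (H l)) (sum f (H k)) < e / 2" if "l \<ge> k" for l
    proof -
      have "H k \<subseteq> H l"
        using that unfolding H_def by (intro UN_mono) auto
      then show ?thesis
        using diff [OF H [of l], of k] k by linarith
    qed
    then show "\<exists>M. \<forall>m\<ge>M. \<forall>n\<ge>M. dist (sum f (H m)) (sum f (H n)) < e"
      by (metis dist_triangle_half_l)
  qed
  then obtain s where s: "(\<lambda>k. sum f (H k)) \<longlonglongrightarrow> s"
    by (auto simp: Cauchy_convergent_iff convergent_def)
  have "(f has_sum s) UNIV"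
    unfolding has_sum_def tendsto_iff
  proof (intro allI impI)
    fix e :: real assume e: "e > 0"
    then obtain k0 where k0: "1 / Suc k0 < e / 2"
      using nat_approx_posE [of "e / 2"] by auto
    have "eventually (\<lambda>k. dist (sum f (H k)) s < e / 2) sequentially"
      by (rule tendstoD [OF s]) (use e in simp)
    then obtain k1 where k1: "\<And>k. k \<ge> k1 \<Longrightarrow> dist (sum f (H k)) s < e / 2"
      by (auto simp: eventually_sequentially)
    define k where "k = max k0 k1"
    have k: "k \<ge> k0" "dist (sum f (H k)) s < e / 2"
      using k1 by (simp_all add: k_def)
    have "1 / Suc k \<le> 1 / Suc k0"
      using k by (simp add: frac_le)
    then have "dist (sum f G) s < e" if "finite G" "H k \<subseteq> G" for G
      using diff [OF that] k k0 dist_triangle [of "sum f G" s "sum f (H k)"] by linarith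
    then show "\<forall>\<^sub>F G in finite_subsets_at_top UNIV. dist (sum f G) s < e"
      using H by (auto simp: eventually_finite_subsets_at_top)
  qed
  then show "f summable_on UNIV"
    by (auto simp: summable_on_def)
qed

section \<open>Norms of finite truncations and the module norm\<close>

lemma tendsto_star [tendsto_intros]: "(f \<longlongrightarrow> a) F \<Longrightarrow> ((\<lambda>x. star (f x)) \<longlongrightarrow> star a) F"
  by (rule bounded_linear.tendsto [OF bounded_linear_star])

text \<open>The module norm of f cut off to G. It is defined for every function, so estimates can be
  proved on finite sets before membership in \<open>l2Z\<close> is known and then passed to the
  limit.\<close>

definition part_norm :: "int set \<Rightarrow> (int \<Rightarrow> 'b::unital_cstar) \<Rightarrow> real"
  where "part_norm G f = sqrt (norm (\<Sum>n\<in>G. star (f n) * f n))"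

lemma part_norm_nonneg [simp]: "part_norm G f \<ge> 0"
  by (simp add: part_norm_def)

lemma part_norm_power2: "(part_norm G f)\<^sup>2 = norm (\<Sum>n\<in>G. star (f n) * f n)"
  by (simp add: part_norm_def)

lemma part_norm_singleton [simp]: "part_norm {n} f = norm (f n)"
  by (simp add: part_norm_def cstar_identity)

lemma norm_sum_le_part_norm: "norm (\<Sum>n\<in>G. star (f n) * g n) \<le> part_norm G f * part_norm G g"
proof (rule power2_le_imp_le)
  show "(norm (\<Sum>n\<in>G. star (f n) * g n))\<^sup>2 \<le> (part_norm G f * part_norm G g)\<^sup>2"
    using sum_cauchy_schwarz [of f g G] by (simp add: power_mult_distrib part_norm_power2)
qed simp

lemma part_norm_add: "part_norm G (\<lambda>n. f n + g n) \<le> part_norm G f + part_norm G g"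
proof -
  let ?S = "\<lambda>f g. \<Sum>n\<in>G. star (f n) * g n"
  have "?S (\<lambda>n. f n + g n) (\<lambda>n. f n + g n) = ?S f f + ?S f g + ?S g f + ?S g g"
    by (simp add: star_add algebra_simps sum.distrib)
  then have "(part_norm G (\<lambda>n. f n + g n))\<^sup>2 \<le> norm (?S f f) + norm (?S f g) + norm (?S g f) + norm (?S g g)"
    unfolding part_norm_power2 by (metis (no_types, lifting) norm_triangle_le add_right_mono norm_triangle_ineq)
  also have "\<dots> \<le> (part_norm G f)\<^sup>2 + part_norm G f * part_norm G g + part_norm G g * part_norm G f + (part_norm G g)\<^sup>2"
    using norm_sum_le_part_norm [of f g G] norm_sum_le_part_norm [of g f G] unfolding part_norm_power2 by linarith
  also have "\<dots> = (part_norm G f + part_norm G g)\<^sup>2"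
    by (simp add: power2_eq_square algebra_simps)
  finally show ?thesis
    by (rule power2_le_imp_le) simp
qed

text \<open>C^2 - c(n)* c(n) is positive; conjugating by f(n) and summing compares the two sums in
  the order of the algebra, where the norm is monotone.\<close>

lemma part_norm_mult_le:
  assumes "\<And>n. norm (c n) \<le> C"
  shows "part_norm G (\<lambda>n. c n * f n) \<le> C * part_norm G f"
proof -
  have C: "C \<ge> 0"
    using assms [of 0] norm_ge_zero order.trans by blast
  have "pos (\<Sum>n\<in>G. star (f n) * (C\<^sup>2 *\<^sub>R 1 - star (c n) * c n) * f n)"
    using assms by (intro pos_sum pos_conj pos_norm_diff) (auto simp: cstar_identity power_mono)
  moreover have "(\<Sum>n\<in>G. star (f n) * (C\<^sup>2 *\<^sub>R 1 - star (c n) * c n) * f n)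
      = C\<^sup>2 *\<^sub>R (\<Sum>n\<in>G. star (f n) * f n) - (\<Sum>n\<in>G. star (c n * f n) * (c n * f n))"
    by (simp add: algebra_simps sum_subtractf scaleR_sum_right star_mult)
  ultimately have "norm (\<Sum>n\<in>G. star (c n * f n) * (c n * f n)) \<le> norm (C\<^sup>2 *\<^sub>R (\<Sum>n\<in>G. star (f n) * f n))"
    by (intro pos_norm_mono pos_sum pos_star_mult) simp_all
  then have "(part_norm G (\<lambda>n. c n * f n))\<^sup>2 \<le> (C * part_norm G f)\<^sup>2"
    by (simp add: part_norm_power2 power_mult_distrib)
  then show ?thesis
    by (rule power2_le_imp_le) (simp add: C)
qed

lemma l2Z_iff: "f \<in> l2Z \<longleftrightarrow> tail_small (\<lambda>G. part_norm G f)"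
proof -
  have 1: "part_norm G f < e \<longleftrightarrow> norm (\<Sum>n\<in>G. star (f n) * f n) < e\<^sup>2" if "e > 0" for G e
    using that by (metis part_norm_def real_sqrt_less_iff real_sqrt_abs abs_of_pos)
  have "tail_small (\<lambda>G. norm (\<Sum>n\<in>G. star (f n) * f n)) \<longleftrightarrow> tail_small (\<lambda>G. part_norm G f)"
  proof
    assume t: "tail_small (\<lambda>G. norm (\<Sum>n\<in>G. star (f n) * f n))"
    show "tail_small (\<lambda>G. part_norm G f)"
    proof (rule tail_small_transfer [OF t t])
      show "\<exists>d>0. \<forall>G. norm (\<Sum>n\<in>G. star (f n) * f n) < d \<longrightarrow> norm (\<Sum>n\<in>G. star (f n) * f n) < d \<longrightarrow>
          part_norm G f < e" if "e > 0" for e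
        using that by (intro exI [of _ "e\<^sup>2"]) (simp add: 1)
    qed
  next
    assume t: "tail_small (\<lambda>G. part_norm G f)"
    show "tail_small (\<lambda>G. norm (\<Sum>n\<in>G. star (f n) * f n))"
    proof (rule tail_small_transfer [OF t t])
      show "\<exists>d>0. \<forall>G. part_norm G f < d \<longrightarrow> part_norm G f < d \<longrightarrow>
          norm (\<Sum>n\<in>G. star (f n) * f n) < e" if "e > 0" for e
        using that by (intro exI [of _ "sqrt e"]) (simp add: 1)
    qed
  qed
  then show ?thesis
    by (simp add: l2Z_def summable_on_UNIV_iff_Cauchy)
qed

lemma l2Z_add:
  assumes "f \<in> l2Z" "g \<in> l2Z"
  shows "(\<lambda>n. f n + g n) \<in> l2Z"
  unfolding l2Z_iff
proof (rule tail_small_transfer [OF assms [unfolded l2Z_iff]])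
  have "part_norm G (\<lambda>n. f n + g n) < e" if "part_norm G f < e / 2" "part_norm G g < e / 2" for G e
    using part_norm_add [of G f g] that by linarith
  then show "\<exists>d>0. \<forall>G. part_norm G f < d \<longrightarrow> part_norm G g < d \<longrightarrow> part_norm G (\<lambda>n. f n + g n) < e"
    if "e > 0" for e
    using that by (intro exI [of _ "e / 2"]) simp
qed

lemma l2Z_mult:
  assumes f: "f \<in> l2Z" and c: "\<And>n. norm (c n) \<le> C"
  shows "(\<lambda>n. c n * f n) \<in> l2Z"
  unfolding l2Z_iff
proof (rule tail_small_transfer [OF f [unfolded l2Z_iff] f [unfolded l2Z_iff]])
  fix e :: real assume e: "e > 0"
  have C: "C \<ge> 0"
    using c [of 0] norm_ge_zero order.trans by blast
  have "part_norm G (\<lambda>n. c n * f n) < e" if "part_norm G f < e / (C + 1)" for G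
  proof -
    have "part_norm G (\<lambda>n. c n * f n) \<le> C * part_norm G f"
      by (rule part_norm_mult_le [OF c])
    also have "\<dots> \<le> (C + 1) * part_norm G f"
      by (simp add: mult_right_mono)
    also have "\<dots> < e"
      using that C by (simp add: field_simps)
    finally show ?thesis .
  qed
  then show "\<exists>d>0. \<forall>G. part_norm G f < d \<longrightarrow> part_norm G f < d \<longrightarrow> part_norm G (\<lambda>n. c n * f n) < e"
    using e C by (intro exI [of _ "e / (C + 1)"]) simp
qed

lemma l2Z_scaleC: "f \<in> l2Z \<Longrightarrow> (\<lambda>n. scaleC c (f n)) \<in> l2Z"
  using l2Z_mult [of f "\<lambda>n. scaleC c 1" "cmod c * norm (1::'a)"]
  by (simp add: norm_scaleC scaleC_mult_left)

lemma l2Z_scaleR: "f \<in> l2Z \<Longrightarrow> (\<lambda>n. r *\<^sub>R f n) \<in> l2Z"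
  using l2Z_scaleC [of f "complex_of_real r"] by (simp add: scaleC_of_real)

lemma l2Z_minus: "f \<in> l2Z \<Longrightarrow> (\<lambda>n. - f n) \<in> l2Z"
  using l2Z_scaleC [of f "- 1"] by simp

lemma l2Z_diff: "f \<in> l2Z \<Longrightarrow> g \<in> l2Z \<Longrightarrow> (\<lambda>n. f n - g n) \<in> l2Z"
  using l2Z_add [of f "\<lambda>n. - g n"] l2Z_minus by fastforce

lemma l2Z_0 [simp]: "(\<lambda>n. 0) \<in> l2Z"
  by (simp add: l2Z_def)

lemma l2Z_shift: "f \<in> l2Z \<Longrightarrow> (\<lambda>n. f (n - k)) \<in> l2Z"
  using summable_on_reindex_bij_betw [of "\<lambda>n::int. n - k" UNIV UNIV "\<lambda>n. star (f n) * f n"]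
  by (simp add: l2Z_def bij_betw_def inj_def surj_def)

lemma l2_inner_summable:
  assumes "f \<in> l2Z" "g \<in> l2Z"
  shows "(\<lambda>n. star (f n) * g n) summable_on UNIV"
  unfolding summable_on_UNIV_iff_Cauchy
proof (rule tail_small_transfer [OF assms [unfolded l2Z_iff]])
  have "norm (\<Sum>n\<in>G. star (f n) * g n) < e" if "e > 0" "part_norm G f < sqrt e" "part_norm G g < sqrt e" for G e
  proof -
    have "norm (\<Sum>n\<in>G. star (f n) * g n) \<le> part_norm G f * part_norm G g"
      by (rule norm_sum_le_part_norm)
    also have "\<dots> < sqrt e * sqrt e"
      using that by (intro mult_strict_mono') auto
    finally show ?thesis
      using that by simp
  qed
  then show "\<exists>d>0. \<forall>G. part_norm G f < d \<longrightarrow> part_norm G g < d \<longrightarrow> norm (\<Sum>n\<in>G. star (f n) * g n) < e"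
    if "e > 0" for e
    using that by (intro exI [of _ "sqrt e"]) simp
qed

lemma l2_inner_tendsto:
  assumes "f \<in> l2Z" "g \<in> l2Z"
  shows "((\<lambda>G. \<Sum>n\<in>G. star (f n) * g n) \<longlongrightarrow> l2_inner f g) (finite_subsets_at_top UNIV)"
  using has_sum_infsum [OF l2_inner_summable [OF assms]] unfolding has_sum_def l2_inner_def .

lemma part_norm_tendsto:
  assumes "f \<in> l2Z"
  shows "((\<lambda>G. part_norm G f) \<longlongrightarrow> l2_norm f) (finite_subsets_at_top UNIV)"
  unfolding part_norm_def l2_norm_def by (intro tendsto_intros l2_inner_tendsto assms)

lemma part_norm_mono:
  assumes "finite H" "G \<subseteq> H"
  shows "part_norm G f \<le> part_norm H f"
proof -
  have "(\<Sum>n\<in>H. star (f n) * f n) - (\<Sum>n\<in>G. star (f n) * f n) = (\<Sum>n\<in>H - G. star (f n) * f n)"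
    using assms by (simp add: sum_diff)
  then have "norm (\<Sum>n\<in>G. star (f n) * f n) \<le> norm (\<Sum>n\<in>H. star (f n) * f n)"
    by (intro pos_norm_mono) (auto intro: pos_sum pos_star_mult)
  then show ?thesis
    by (simp add: part_norm_def)
qed

lemma part_norm_le_l2_norm:
  assumes "f \<in> l2Z" "finite G"
  shows "part_norm G f \<le> l2_norm f"
proof (rule tendsto_lowerbound [OF part_norm_tendsto [OF assms(1)]])
  show "\<forall>\<^sub>F H in finite_subsets_at_top UNIV. part_norm G f \<le> part_norm H f"
    using assms(2) by (auto simp: eventually_finite_subsets_at_top intro!: exI [of _ G] part_norm_mono)
qed simp

lemma l2_norm_le:
  assumes "f \<in> l2Z" "\<And>G. finite G \<Longrightarrow> part_norm G f \<le> C"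
  shows "l2_norm f \<le> C"
  by (rule tendsto_upperbound [OF part_norm_tendsto [OF assms(1)]])
    (auto simp: eventually_finite_subsets_at_top intro!: exI [of _ "{}"] assms)

lemma l2_norm_coord: "f \<in> l2Z \<Longrightarrow> norm (f n) \<le> l2_norm f"
  using part_norm_le_l2_norm [of f "{n}"] by simp

lemma l2_norm_triangle:
  assumes "f \<in> l2Z" "g \<in> l2Z"
  shows "l2_norm (\<lambda>n. f n + g n) \<le> l2_norm f + l2_norm g"
proof (rule l2_norm_le)
  show "part_norm G (\<lambda>n. f n + g n) \<le> l2_norm f + l2_norm g" if "finite G" for G
    using part_norm_add [of G f g] part_norm_le_l2_norm [OF assms(1) that]
      part_norm_le_l2_norm [OF assms(2) that] by linarith
qed (use assms in \<open>simp add: l2Z_add\<close>)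

lemma l2_norm_mult_le:
  assumes "f \<in> l2Z" "\<And>n. norm (c n) \<le> C"
  shows "l2_norm (\<lambda>n. c n * f n) \<le> C * l2_norm f"
proof (rule l2_norm_le)
  have C: "C \<ge> 0"
    using assms(2) [of 0] norm_ge_zero order.trans by blast
  show "part_norm G (\<lambda>n. c n * f n) \<le> C * l2_norm f" if "finite G" for G
    using part_norm_mult_le [OF assms(2), where G = G and f = f] part_norm_le_l2_norm [OF assms(1) that] C
    by (meson mult_left_mono order.trans)
qed (rule l2Z_mult [OF assms])

lemma l2_inner_cauchy_schwarz:
  assumes "f \<in> l2Z" "g \<in> l2Z"
  shows "norm (l2_inner f g) \<le> l2_norm f * l2_norm g"
proof (rule tendsto_le)
  show "((\<lambda>G. part_norm G f * part_norm G g) \<longlongrightarrow> l2_norm f * l2_norm g) (finite_subsets_at_top UNIV)"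
    by (intro tendsto_intros part_norm_tendsto assms)
  show "((\<lambda>G. norm (\<Sum>n\<in>G. star (f n) * g n)) \<longlongrightarrow> norm (l2_inner f g)) (finite_subsets_at_top UNIV)"
    by (intro tendsto_intros l2_inner_tendsto assms)
  show "\<forall>\<^sub>F G in finite_subsets_at_top UNIV. norm (\<Sum>n\<in>G. star (f n) * g n) \<le> part_norm G f * part_norm G g"
    by (simp add: norm_sum_le_part_norm)
qed simp

lemma l2_inner_add_right:
  "\<lbrakk>f \<in> l2Z; g \<in> l2Z; h \<in> l2Z\<rbrakk> \<Longrightarrow> l2_inner f (\<lambda>n. g n + h n) = l2_inner f g + l2_inner f h"
  unfolding l2_inner_def by (simp add: distrib_left infsum_add l2_inner_summable)

lemma l2_inner_scaleC_right:
  "\<lbrakk>f \<in> l2Z; g \<in> l2Z\<rbrakk> \<Longrightarrow> l2_inner f (\<lambda>n. scaleC c (g n)) = scaleC c (l2_inner f g)"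
  unfolding l2_inner_def
  using has_sum_bounded_linear [OF bounded_linear_scaleC [of c] has_sum_infsum [OF l2_inner_summable]]
  by (intro infsumI) (simp add: scaleC_mult_right)

lemma star_l2_inner: "\<lbrakk>f \<in> l2Z; g \<in> l2Z\<rbrakk> \<Longrightarrow> star (l2_inner f g) = l2_inner g f"
  unfolding l2_inner_def
  using has_sum_bounded_linear [OF bounded_linear_star has_sum_infsum [OF l2_inner_summable]]
  by (intro infsumI [symmetric]) (simp add: star_mult star_star)

text \<open>As a type, the module can be made a Banach space, so that bounded operators and the
  Baire argument apply to it directly.\<close>

typedef (overloaded) ('b::unital_cstar) l2 = "l2Z :: (int \<Rightarrow> 'b) set"
  morphisms coord Abs_l2
  by (rule exI [of _ "\<lambda>n. 0"]) simp

setup_lifting type_definition_l2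

lemma coord_in [simp]: "coord f \<in> l2Z"
  by (rule coord)

lemma l2_eqI: "(\<And>n. coord f n = coord g n) \<Longrightarrow> f = g"
  by (metis coord_inject ext)

section \<open>The module as a Banach space\<close>

instantiation l2 :: (unital_cstar) real_normed_vector
begin

lift_definition zero_l2 :: "'a l2" is "\<lambda>n. 0" by simp
lift_definition plus_l2 :: "'a l2 \<Rightarrow> 'a l2 \<Rightarrow> 'a l2" is "\<lambda>f g n. f n + g n" by (rule l2Z_add)
lift_definition minus_l2 :: "'a l2 \<Rightarrow> 'a l2 \<Rightarrow> 'a l2" is "\<lambda>f g n. f n - g n" by (rule l2Z_diff)
lift_definition uminus_l2 :: "'a l2 \<Rightarrow> 'a l2" is "\<lambda>f n. - f n" by (rule l2Z_minus)
lift_definition scaleR_l2 :: "real \<Rightarrow> 'a l2 \<Rightarrow> 'a l2" is "\<lambda>r f n. r *\<^sub>R f n" by (rule l2Z_scaleR)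
lift_definition norm_l2 :: "'a l2 \<Rightarrow> real" is l2_norm .

definition dist_l2 :: "'a l2 \<Rightarrow> 'a l2 \<Rightarrow> real" where "dist_l2 f g = norm (f - g)"
definition sgn_l2 :: "'a l2 \<Rightarrow> 'a l2" where "sgn_l2 f = scaleR (inverse (norm f)) f"
definition uniformity_l2 :: "('a l2 \<times> 'a l2) filter"
  where "uniformity_l2 = (INF e\<in>{0 <..}. principal {(x, y). dist x y < e})"
definition open_l2 :: "'a l2 set \<Rightarrow> bool"
  where "open_l2 S = (\<forall>x\<in>S. \<forall>\<^sub>F (x', y) in uniformity. x' = x \<longrightarrow> y \<in> S)"

instance
proof
  fix f g :: "'a l2" and r :: real
  have le: "norm (s *\<^sub>R h) \<le> \<bar>s\<bar> * norm h" for s :: real and h :: "'a l2"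
  proof transfer
    fix s and h :: "int \<Rightarrow> 'a" assume h: "h \<in> l2Z"
    have "l2_norm (\<lambda>n. (s *\<^sub>R 1) * h n) \<le> \<bar>s\<bar> * l2_norm h"
      using h norm_one_le [where 'a = 'a] by (intro l2_norm_mult_le) (simp_all add: mult_left_le)
    then show "l2_norm (\<lambda>n. s *\<^sub>R h n) \<le> \<bar>s\<bar> * l2_norm h"
      by simp
  qed
  show "norm (r *\<^sub>R f) = \<bar>r\<bar> * norm f"
  proof (cases "r = 0")
    case True
    then show ?thesis
      using le [of 0 f] by transfer (simp add: l2_norm_def l2_inner_def)
  next
    case False
    have "(1 / r) *\<^sub>R r *\<^sub>R f = f"
      using False by transfer simp
    then have "\<bar>r\<bar> * norm f \<le> norm (r *\<^sub>R f)"
      using le [of "1 / r" "r *\<^sub>R f"] False by (simp add: field_simps)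
    with le [of r f] show ?thesis
      by simp
  qed
  show "norm f = 0 \<longleftrightarrow> f = 0"
  proof
    assume "norm f = 0"
    then show "f = 0"
    proof transfer
      fix f :: "int \<Rightarrow> 'a" assume f: "f \<in> l2Z" "l2_norm f = 0"
      show "f = (\<lambda>n. 0)"
        using l2_norm_coord [OF f(1)] f(2) by (auto simp: fun_eq_iff)
    qed
  qed (transfer, simp add: l2_norm_def l2_inner_def)
  show "norm (f + g) \<le> norm f + norm g"
    by transfer (rule l2_norm_triangle)
qed (simp_all add: dist_l2_def sgn_l2_def uniformity_l2_def open_l2_def,
     (transfer, simp add: algebra_simps)+)

end

lemma coord_simps [simp]:
  "coord 0 n = 0" "coord (f + g) n = coord f n + coord g n" "coord (f - g) n = coord f n - coord g n"
  "coord (- f) n = - coord f n" "coord (r *\<^sub>R f) n = r *\<^sub>R coord f n"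
  by (transfer; simp)+

lemma coord_sum: "coord (sum f A) n = (\<Sum>i\<in>A. coord (f i) n)"
  by (induction A rule: infinite_finite_induct) auto

lemma norm_coord_le: "norm (coord f n) \<le> norm f"
  by transfer (rule l2_norm_coord)

lemma part_norm_le_norm: "finite G \<Longrightarrow> part_norm G (coord f) \<le> norm f"
  by transfer (rule part_norm_le_l2_norm)

lemma norm_l2_le: "(\<And>G. finite G \<Longrightarrow> part_norm G (coord f) \<le> C) \<Longrightarrow> norm f \<le> C"
  by transfer (rule l2_norm_le)

text \<open>Coordinates converge, and on a finite set G the Cauchy estimate passes to the limit with
  a bound independent of G. This uniformity yields both membership of the limit in
  \<open>l2Z\<close> and convergence in norm.\<close>

instance l2 :: (unital_cstar) banach
proof
  fix X :: "nat \<Rightarrow> 'a l2"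
  assume X: "Cauchy X"
  have "Cauchy (\<lambda>k. coord (X k) n)" for n
  proof (rule metric_CauchyI)
    fix e :: real assume "e > 0"
    then obtain M where M: "\<And>k l. k \<ge> M \<Longrightarrow> l \<ge> M \<Longrightarrow> norm (X k - X l) < e"
      using X by (metis Cauchy_iff)
    have "dist (coord (X k) n) (coord (X l) n) < e" if "k \<ge> M" "l \<ge> M" for k l
      using norm_coord_le [of "X k - X l" n] M [OF that] by (simp add: dist_norm)
    then show "\<exists>M. \<forall>k\<ge>M. \<forall>l\<ge>M. dist (coord (X k) n) (coord (X l) n) < e"
      by blast
  qed
  then have "\<exists>a. (\<lambda>k. coord (X k) n) \<longlonglongrightarrow> a" for n
    by (simp add: Cauchy_convergent_iff convergent_def)
  then obtain f where f: "\<And>n. (\<lambda>k. coord (X k) n) \<longlonglongrightarrow> f n"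
    by metis
  have bound: "\<exists>M. \<forall>k\<ge>M. \<forall>G. finite G \<longrightarrow> part_norm G (\<lambda>n. f n - coord (X k) n) \<le> e" if "e > 0" for e
  proof -
    from that obtain M where M: "\<And>k l. k \<ge> M \<Longrightarrow> l \<ge> M \<Longrightarrow> norm (X k - X l) < e"
      using X by (metis Cauchy_iff)
    have "part_norm G (\<lambda>n. f n - coord (X k) n) \<le> e" if "k \<ge> M" "finite G" for k G
    proof (rule tendsto_upperbound)
      show "(\<lambda>l. part_norm G (coord (X l - X k))) \<longlonglongrightarrow> part_norm G (\<lambda>n. f n - coord (X k) n)"
        unfolding part_norm_def by (auto intro!: tendsto_intros f)
      have "part_norm G (coord (X l - X k)) \<le> e" if "l \<ge> M" for l
        using part_norm_le_norm [of G "X l - X k"] M [OF that \<open>k \<ge> M\<close>] \<open>finite G\<close> by linarith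
      then show "\<forall>\<^sub>F l in sequentially. part_norm G (coord (X l - X k)) \<le> e"
        by (auto simp: eventually_sequentially)
    qed simp
    then show ?thesis by blast
  qed
  have "f \<in> l2Z"
    unfolding l2Z_iff tail_small_def
  proof (intro allI impI)
    fix e :: real assume "e > 0"
    then have "e / 2 > 0" by simp
    then obtain k where k: "\<And>G. finite G \<Longrightarrow> part_norm G (\<lambda>n. f n - coord (X k) n) \<le> e / 2"
      using bound by blast
    obtain F where F: "finite F" "\<And>G. finite G \<Longrightarrow> G \<inter> F = {} \<Longrightarrow> part_norm G (coord (X k)) < e / 2"
      using tail_smallE [OF coord_in [of "X k", unfolded l2Z_iff] \<open>e / 2 > 0\<close>] by blast
    have "part_norm G f < e" if "finite G" "G \<inter> F = {}" for G
      using part_norm_add [of G "\<lambda>n. f n - coord (X k) n" "coord (X k)"] k [OF that(1)] F(2) [OF that]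
      by simp
    with F show "\<exists>F. finite F \<and> (\<forall>G. finite G \<longrightarrow> G \<inter> F = {} \<longrightarrow> part_norm G f < e)"
      by blast
  qed
  then have cf: "coord (Abs_l2 f) = f"
    by (rule Abs_l2_inverse)
  have "X \<longlonglongrightarrow> Abs_l2 f"
  proof (rule metric_LIMSEQ_I)
    fix e :: real assume "e > 0"
    then have "e / 2 > 0" by simp
    then obtain M where M: "\<And>k G. k \<ge> M \<Longrightarrow> finite G \<Longrightarrow> part_norm G (\<lambda>n. f n - coord (X k) n) \<le> e / 2"
      using bound by blast
    have "norm (Abs_l2 f - X k) \<le> e / 2" if "k \<ge> M" for k
    proof (rule norm_l2_le)
      fix G :: "int set" assume "finite G"
      moreover have "coord (Abs_l2 f - X k) = (\<lambda>n. f n - coord (X k) n)"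
        by (simp add: fun_eq_iff cf)
      ultimately show "part_norm G (coord (Abs_l2 f - X k)) \<le> e / 2"
        using M that by simp
    qed
    then have "dist (X k) (Abs_l2 f) < e" if "k \<ge> M" for k
      using that \<open>e > 0\<close> by (force simp: dist_norm norm_minus_commute)
    then show "\<exists>M. \<forall>k\<ge>M. dist (X k) (Abs_l2 f) < e"
      by blast
  qed
  then show "convergent X"
    by (auto simp: convergent_def)
qed

section \<open>The inner product with values in the coefficient algebra\<close>

lift_definition ip :: "'b::unital_cstar l2 \<Rightarrow> 'b l2 \<Rightarrow> 'b" is l2_inner .

lift_definition cscale :: "complex \<Rightarrow> 'b::unital_cstar l2 \<Rightarrow> 'b l2" is "\<lambda>c f n. scaleC c (f n)"
  by (rule l2Z_scaleC)

lemma coord_cscale [simp]: "coord (cscale c f) n = scaleC c (coord f n)"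
  by transfer simp

lemma star_ip: "star (ip f g) = ip g f"
  by transfer (rule star_l2_inner)

lemma ip_add_right: "ip f (g + h) = ip f g + ip f h"
  by transfer (rule l2_inner_add_right)

lemma ip_cscale_right: "ip f (cscale c g) = scaleC c (ip f g)"
  by transfer (rule l2_inner_scaleC_right)

lemma ip_add_left: "ip (f + g) h = ip f h + ip g h"
  by (metis ip_add_right star_add star_ip)

lemma ip_cscale_left: "ip (cscale c f) g = scaleC (cnj c) (ip f g)"
  by (metis ip_cscale_right star_ip star_scaleC)

lemma cscale_of_real: "cscale (complex_of_real r) f = r *\<^sub>R f"
  by (rule l2_eqI) (simp add: scaleC_of_real)

lemma ip_scaleR_right: "ip f (r *\<^sub>R g) = r *\<^sub>R ip f g"
  using ip_cscale_right [of f "complex_of_real r" g] by (simp add: cscale_of_real scaleC_of_real)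

lemma ip_scaleR_left: "ip (r *\<^sub>R f) g = r *\<^sub>R ip f g"
  by (metis ip_scaleR_right star_ip star_scaleR)

lemma ip_minus_right: "ip f (- g) = - ip f g"
  using ip_scaleR_right [of f "- 1" g] by simp

lemma ip_diff_right: "ip f (g - h) = ip f g - ip f h"
  using ip_add_right [of f g "- h"] by (simp add: ip_minus_right)

lemma norm_ip_self: "norm (ip f f) = (norm f)\<^sup>2"
  by transfer (simp add: l2_norm_def)

lemma norm_ip_le: "norm (ip f g) \<le> norm f * norm g"
  by transfer (rule l2_inner_cauchy_schwarz)

lemma ip_extensional: "(\<And>h. ip h f = ip h g) \<Longrightarrow> f = g"
  using norm_ip_self [of "f - g"] by (simp add: ip_diff_right)

lemma bounded_linear_ip_right: "bounded_linear (ip f)"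
  by (rule bounded_linear_intro [of _ "norm f"])
    (simp_all add: ip_add_right ip_scaleR_right, metis norm_ip_le mult.commute)

section \<open>The \<open>C\<^sup>*\<close>-algebra of adjointable operators\<close>

text \<open>Banach-Steinhaus by the Baire category theorem. Some closed set E n contains a ball of
  radius e about a point y; a vector z of norm e is the difference of y + z and y, both in E n,
  which is the origin of the constant 2 n / e.\<close>

lemma uniform_boundedness:
  fixes A :: "'i \<Rightarrow> 'a::banach \<Rightarrow> 'b::real_normed_vector"
  assumes lin: "\<And>i. bounded_linear (A i)" and bdd: "\<And>x. \<exists>C. \<forall>i. norm (A i x) \<le> C"
  obtains C where "\<And>i x. norm (A i x) \<le> C * norm x"
proof -
  define E where "E n = {x. \<forall>i. norm (A i x) \<le> real n}" for n :: nat
  have cl: "closed (E n)" for n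
    unfolding E_def
    by (intro closed_Collect_all closed_Collect_le continuous_intros bounded_linear.continuous_on [OF lin])
  have UN: "(\<Union>n. E n) = UNIV"
  proof -
    have "\<exists>n. x \<in> E n" for x
    proof -
      obtain C where C: "\<And>i. norm (A i x) \<le> C"
        using bdd by blast
      obtain n :: nat where "C \<le> n"
        using real_arch_simple by blast
      then show ?thesis
        using C unfolding E_def by (auto intro: order.trans)
    qed
    then show ?thesis by blast
  qed
  have "\<exists>n. interior (E n) \<noteq> {}"
  proof (rule ccontr)
    assume "\<not> (\<exists>n. interior (E n) \<noteq> {})"
    then have "Met_TC.mtopology interior_of (\<Union> (range E)) = ({} :: 'a set)"
      using cl by (intro Met_TC.metric_Baire_category_alt) (auto simp: complete_UNIV)
    then show False
      by (simp add: UN)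
  qed
  then obtain n y where "y \<in> interior (E n)"
    by blast
  then obtain e where e: "e > 0" "cball y e \<subseteq> E n"
    by (meson mem_interior_cball)
  have "norm (A i x) \<le> (2 * n / e) * norm x" for i x
  proof (cases "x = 0")
    case True
    then show ?thesis
      by (simp add: linear_0 [OF bounded_linear.linear [OF lin]])
  next
    case False
    define z where "z = (e / norm x) *\<^sub>R x"
    interpret bounded_linear "A i" by (rule lin)
    have "y + z \<in> E n" "y \<in> E n"
      using e False by (auto simp: z_def dist_norm intro!: subsetD [OF e(2)])
    then have "norm (A i (y + z)) \<le> n" "norm (A i y) \<le> n"
      by (auto simp: E_def)
    moreover have "A i z = A i (y + z) - A i y"
      by (simp add: add)
    ultimately have "norm (A i z) \<le> 2 * n"
      using norm_triangle_ineq4 [of "A i (y + z)" "A i y"] by simp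
    then show ?thesis
      using e False by (simp add: z_def scaleR field_simps)
  qed
  then show ?thesis
    by (rule that)
qed

text \<open>Linearity holds because the inner product separates vectors. For boundedness, the maps
  sending g to \<open>ip (T f) g\<close> with norm f \<le> 1 are bounded at each g by
  \<open>norm (S g)\<close>; the resulting uniform bound, evaluated at g = T f, bounds T on the unit
  ball.\<close>

lemma adjointable_bounded_linear:
  fixes T S :: "'b::unital_cstar l2 \<Rightarrow> 'b l2"
  assumes adj: "\<And>f g. ip (T f) g = ip f (S g)"
  shows "bounded_linear T"
proof -
  have adj': "ip h (T f) = ip (S h) f" for h f
    by (metis adj star_ip)
  have lin: "T (f + g) = T f + T g" "T (r *\<^sub>R f) = r *\<^sub>R T f" for f g r
    by (rule ip_extensional; simp add: adj' ip_add_right ip_scaleR_right)+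
  have "\<exists>C. \<forall>f\<in>{f. norm f \<le> 1}. norm (ip (T f) g) \<le> C" for g
  proof (intro exI ballI)
    fix f :: "'b l2" assume "f \<in> {f. norm f \<le> 1}"
    have "norm (ip (T f) g) \<le> norm f * norm (S g)"
      by (simp add: adj norm_ip_le)
    also have "\<dots> \<le> 1 * norm (S g)"
      using \<open>f \<in> {f. norm f \<le> 1}\<close> by (intro mult_right_mono) auto
    finally show "norm (ip (T f) g) \<le> norm (S g)" by simp
  qed
  \<comment> \<open>\<open>uniform_boundedness\<close> ranges over all elements of the index type,
    so vectors outside the unit ball are replaced by 0.\<close>
  then have bdd: "\<exists>C. \<forall>f. norm (ip (T (if norm f \<le> 1 then f else 0)) g) \<le> C" for g
    by (metis (mono_tags, lifting) mem_Collect_eq norm_zero zero_le_one)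
  obtain C where C: "\<And>f g. norm (ip (T (if norm f \<le> 1 then f else 0)) g) \<le> C * norm g"
    by (rule uniform_boundedness [where A = "\<lambda>f. ip (T (if norm f \<le> 1 then f else 0))",
          OF bounded_linear_ip_right bdd]) (rule that)
  have T0: "T 0 = 0"
    using lin(2) [of 0 0] by simp
  have ball: "norm (T f) \<le> max C 0" if "norm f \<le> 1" for f
  proof (cases "T f = 0")
    case False
    have "norm (T f) * norm (T f) \<le> C * norm (T f)"
      using C [of f "T f"] that by (simp add: norm_ip_self power2_eq_square)
    with False show ?thesis by simp
  qed simp
  show ?thesis
  proof (rule bounded_linear_intro [of _ "max C 0"])
    fix f
    show "norm (T f) \<le> norm f * max C 0"
    proof (cases "f = 0")
      case False
      then have "T f = norm f *\<^sub>R T ((1 / norm f) *\<^sub>R f)"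
        by (simp flip: lin)
      moreover have "norm (T ((1 / norm f) *\<^sub>R f)) \<le> max C 0"
        using False by (intro ball) simp
      ultimately show ?thesis
        by (metis norm_scaleR abs_norm_cancel mult_left_mono norm_ge_zero)
    qed (simp add: T0)
  qed (simp_all add: lin)
qed

lemma norm_cscale: "norm (cscale c f) = cmod c * norm f"
proof -
  have "(norm (cscale c f))\<^sup>2 = norm (ip (cscale c f) (cscale c f))"
    by (simp add: norm_ip_self)
  also have "\<dots> = (cmod c * norm f)\<^sup>2"
    unfolding ip_cscale_left ip_cscale_right norm_scaleC norm_ip_self
    by (simp add: power_mult_distrib power2_eq_square)
  finally show ?thesis
    by (simp add: power2_eq_iff_nonneg)
qed

lemma bounded_linear_cscale: "bounded_linear (cscale c)"
proof (rule bounded_linear_intro [of _ "cmod c"])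
  show "cscale c (f + g) = cscale c f + cscale c g" for f g
    by (rule l2_eqI) (simp add: scaleC_add_right)
  show "cscale c (r *\<^sub>R f) = r *\<^sub>R cscale c f" for r f
    by (rule l2_eqI) (simp add: scaleC_scaleR)
qed (simp add: norm_cscale mult.commute)

section \<open>The type of adjointable operators\<close>

definition adj_pair :: "('b::unital_cstar l2 \<Rightarrow>\<^sub>L 'b l2) \<Rightarrow> ('b l2 \<Rightarrow>\<^sub>L 'b l2) \<Rightarrow> bool"
  where "adj_pair T S \<longleftrightarrow> (\<forall>f g. ip (blinfun_apply T f) g = ip f (blinfun_apply S g))"

lemma adj_pair_sym: "adj_pair T S \<Longrightarrow> adj_pair S T"
  unfolding adj_pair_def by (metis star_ip)

text \<open>A type rather than a carrier set, so that it becomes an instance of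
  \<open>unital_cstar\<close> and inherits the theory of positivity. Carving it out of the Banach
  space of bounded operators makes norm and limits available.\<close>

typedef (overloaded) ('b::unital_cstar) adjop = "{T :: 'b l2 \<Rightarrow>\<^sub>L 'b l2. \<exists>S. adj_pair T S}"
  morphisms blinfun_of_adjop Abs_adjop
  by (rule exI [of _ 0]) (auto simp: adj_pair_def ip_def zero_l2.rep_eq l2_inner_def intro!: exI [of _ 0])

setup_lifting type_definition_adjop

lifting_forget l2.lifting

lift_definition app :: "'b::unital_cstar adjop \<Rightarrow> 'b l2 \<Rightarrow> 'b l2" is blinfun_apply .

lemma adjop_eqI: "(\<And>f. app S f = app T f) \<Longrightarrow> S = T"
  by transfer (rule blinfun_eqI)

lemma app_simps_l2 [simp]:
  "app T 0 = 0" "app T (f + g) = app T f + app T g" "app T (f - g) = app T f - app T g"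
  "app T (- f) = - app T f" "app T (r *\<^sub>R f) = r *\<^sub>R app T f"
  by (simp_all add: app.rep_eq blinfun.bilinear_simps)

lemma ip_0 [simp]: "ip f 0 = 0" "ip 0 f = 0"
  using ip_scaleR_right [of f 0 0] ip_scaleR_left [of 0 0 f] by simp_all

lemma ip_diff_left: "ip (f - g) h = ip f h - ip g h"
  by (metis ip_diff_right star_diff star_ip)

lift_definition scale_op :: "complex \<Rightarrow> 'b::unital_cstar adjop \<Rightarrow> 'b adjop" is "\<lambda>c T. Blinfun (cscale c) o\<^sub>L T"
proof -
  fix c and T :: "'b l2 \<Rightarrow>\<^sub>L 'b l2"
  assume "\<exists>T'. adj_pair T T'"
  then obtain T' where "adj_pair T T'" by blast
  then show "\<exists>U. adj_pair (Blinfun (cscale c) o\<^sub>L T) U"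
    by (intro exI [of _ "T' o\<^sub>L Blinfun (cscale (cnj c))"])
      (simp add: adj_pair_def bounded_linear_Blinfun_apply bounded_linear_cscale ip_cscale_left, metis ip_cscale_right)
qed

lift_definition adj_op :: "'b::unital_cstar adjop \<Rightarrow> 'b adjop" is "\<lambda>T. SOME S. adj_pair T S"
  by (metis (mono_tags) adj_pair_sym someI_ex)

instantiation adjop :: (unital_cstar) "{real_normed_algebra, monoid_mult}"
begin

lift_definition zero_adjop :: "'a adjop" is 0
  by (rule exI [of _ 0]) (simp add: adj_pair_def)

lift_definition one_adjop :: "'a adjop" is id_blinfun
  by (rule exI [of _ id_blinfun]) (simp add: adj_pair_def)

lift_definition plus_adjop :: "'a adjop \<Rightarrow> 'a adjop \<Rightarrow> 'a adjop" is "(+)"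
proof -
  fix S T :: "'a l2 \<Rightarrow>\<^sub>L 'a l2"
  assume "\<exists>S'. adj_pair S S'" "\<exists>T'. adj_pair T T'"
  then obtain S' T' where "adj_pair S S'" "adj_pair T T'" by blast
  then show "\<exists>U. adj_pair (S + T) U"
    by (intro exI [of _ "S' + T'"]) (simp add: adj_pair_def blinfun.add_left ip_add_left ip_add_right)
qed

lift_definition times_adjop :: "'a adjop \<Rightarrow> 'a adjop \<Rightarrow> 'a adjop" is blinfun_compose
proof -
  fix S T :: "'a l2 \<Rightarrow>\<^sub>L 'a l2"
  assume "\<exists>S'. adj_pair S S'" "\<exists>T'. adj_pair T T'"
  then obtain S' T' where "adj_pair S S'" "adj_pair T T'" by blast
  then show "\<exists>U. adj_pair (S o\<^sub>L T) U"
    by (intro exI [of _ "T' o\<^sub>L S'"]) (simp add: adj_pair_def)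
qed

lift_definition norm_adjop :: "'a adjop \<Rightarrow> real" is norm .

definition uminus_adjop :: "'a adjop \<Rightarrow> 'a adjop" where "uminus_adjop T = scale_op (- 1) T"
definition minus_adjop :: "'a adjop \<Rightarrow> 'a adjop \<Rightarrow> 'a adjop" where "minus_adjop S T = S + - T"
definition scaleR_adjop :: "real \<Rightarrow> 'a adjop \<Rightarrow> 'a adjop" where "scaleR_adjop r T = scale_op (complex_of_real r) T"
definition dist_adjop :: "'a adjop \<Rightarrow> 'a adjop \<Rightarrow> real" where "dist_adjop S T = norm (S - T)"
definition sgn_adjop :: "'a adjop \<Rightarrow> 'a adjop" where "sgn_adjop T = scaleR (inverse (norm T)) T"
definition uniformity_adjop :: "('a adjop \<times> 'a adjop) filter"
  where "uniformity_adjop = (INF e\<in>{0 <..}. principal {(x, y). dist x y < e})"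
definition open_adjop :: "'a adjop set \<Rightarrow> bool"
  where "open_adjop S = (\<forall>x\<in>S. \<forall>\<^sub>F (x', y) in uniformity. x' = x \<longrightarrow> y \<in> S)"

lemma app_0: "app 0 f = 0"
  by transfer simp

lemma app_1: "app 1 f = f"
  by transfer simp

lemma app_add: "app (S + T) f = app S f + app T f"
  by transfer (simp add: blinfun.add_left)

lemma app_mult: "app (S * T) f = app S (app T f)"
  by transfer simp

lemma app_scale_op: "app (scale_op c T) f = cscale c (app T f)"
  by transfer (simp add: bounded_linear_Blinfun_apply bounded_linear_cscale)

lemma app_uminus: "app (- T) f = - app T f"
  unfolding uminus_adjop_def app_scale_op by (rule l2_eqI) simp

lemma app_diff: "app (S - T) f = app S f - app T f"
  unfolding minus_adjop_def app_add app_uminus by simp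

lemma app_scaleR: "app (r *\<^sub>R T) f = r *\<^sub>R app T f"
  unfolding scaleR_adjop_def app_scale_op cscale_of_real ..

lemma ip_app: "ip (app T f) g = ip f (app (adj_op T) g)"
  by transfer (metis (mono_tags) adj_pair_def someI_ex)

lemma adj_op_unique: "(\<And>f g. ip (app T f) g = ip f (app S g)) \<Longrightarrow> adj_op T = S"
  by (rule adjop_eqI) (metis ip_app ip_extensional)

lemma ip_app_star: "ip (app (adj_op T) f) g = ip f (app T g)"
  by (metis ip_app star_ip)

lemma app_cscale: "app T (cscale c f) = cscale c (app T f)"
  by (rule ip_extensional) (metis ip_app_star ip_cscale_right)

lemma norm_app_le: "norm (app T f) \<le> norm T * norm f"
  by transfer (rule norm_blinfun)

lemma norm_adjop_le: "0 \<le> C \<Longrightarrow> (\<And>f. norm (app T f) \<le> C * norm f) \<Longrightarrow> norm T \<le> C"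
  by transfer (rule norm_blinfun_bound)

lemma norm_adjop_nonneg: "0 \<le> norm (T :: 'a adjop)"
  by transfer simp

lemma norm_adj_op_le: "norm (adj_op T) \<le> norm (T :: 'a adjop)"
proof (rule norm_adjop_le [OF norm_adjop_nonneg])
  fix f
  have "norm (app (adj_op T) f) * norm (app (adj_op T) f) = norm (ip (app (adj_op T) f) (app (adj_op T) f))"
    by (simp add: norm_ip_self power2_eq_square)
  also have "\<dots> = norm (ip f (app T (app (adj_op T) f)))"
    by (simp only: ip_app_star)
  also have "\<dots> \<le> norm f * norm (app T (app (adj_op T) f))"
    by (rule norm_ip_le)
  also have "\<dots> \<le> norm f * (norm T * norm (app (adj_op T) f))"
    by (intro mult_left_mono norm_app_le) simp
  finally have "norm (app (adj_op T) f) * norm (app (adj_op T) f) \<le> (norm T * norm f) * norm (app (adj_op T) f)"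
    by (simp add: mult_ac)
  then show "norm (app (adj_op T) f) \<le> norm T * norm f"
    using norm_adjop_nonneg [of T] by (cases "norm (app (adj_op T) f) = 0") auto
qed

lemma norm_scale_op: "norm (scale_op c T) = cmod c * norm T"
proof -
  have le: "norm (scale_op c T) \<le> cmod c * norm T" for c and T :: "'a adjop"
  proof (rule norm_adjop_le)
    show "norm (app (scale_op c T) f) \<le> cmod c * norm T * norm f" for f
      using mult_left_mono [OF norm_app_le [of T f], of "cmod c"] by (simp add: app_scale_op norm_cscale mult_ac)
  qed (simp add: norm_adjop_nonneg)
  show ?thesis
  proof (cases "c = 0")
    case True
    then show ?thesis
      using le [of 0 T] norm_adjop_nonneg [of "scale_op 0 T"] by simp
  next
    case False
    have "T = scale_op (inverse c) (scale_op c T)"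
      using False by (intro adjop_eqI l2_eqI) (simp add: app_scale_op scaleC_scaleC)
    then have "norm T \<le> cmod (inverse c) * norm (scale_op c T)"
      by (metis le)
    then have "cmod c * norm T \<le> norm (scale_op c T)"
      using False by (simp add: norm_divide field_simps)
    with le [of c T] show ?thesis by simp
  qed
qed

instance
proof
  fix S T U :: "'a adjop" and r s :: real
  note app = app_0 app_1 app_add app_mult app_scale_op app_uminus app_diff app_scaleR
  show "S + T + U = S + (T + U)" "S + T = T + S" "0 + T = T" "- T + T = 0" "S - T = S + - T"
    by (rule adjop_eqI; simp add: app)+
  show "r *\<^sub>R (S + T) = r *\<^sub>R S + r *\<^sub>R T" "(r + s) *\<^sub>R T = r *\<^sub>R T + s *\<^sub>R T"
    "r *\<^sub>R s *\<^sub>R T = (r * s) *\<^sub>R T" "1 *\<^sub>R T = T"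
    by (rule adjop_eqI; simp add: app algebra_simps)+
  show "S * T * U = S * (T * U)" "(S + T) * U = S * U + T * U" "S * (T + U) = S * T + S * U"
    "(r *\<^sub>R S) * T = r *\<^sub>R (S * T)" "S * r *\<^sub>R T = r *\<^sub>R (S * T)" "1 * T = T" "T * 1 = T"
    by (rule adjop_eqI; simp add: app)+
  show "dist S T = norm (S - T)" by (rule dist_adjop_def)
  show "sgn T = inverse (norm T) *\<^sub>R T" by (rule sgn_adjop_def)
  show "uniformity = (INF e\<in>{0 <..}. principal {(x, y :: 'a adjop). dist x y < e})"
    by (rule uniformity_adjop_def)
  show "open X = (\<forall>x\<in>X. \<forall>\<^sub>F (x', y) in uniformity. x' = x \<longrightarrow> y \<in> X)" for X :: "'a adjop set"
    by (rule open_adjop_def)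
  show "norm T = 0 \<longleftrightarrow> T = 0"
    by transfer simp
  show "norm (S + T) \<le> norm S + norm T"
    by transfer (rule norm_triangle_ineq)
  show "norm (r *\<^sub>R T) = \<bar>r\<bar> * norm T"
    by (simp add: scaleR_adjop_def norm_scale_op)
  show "norm (S * T) \<le> norm S * norm T"
    by transfer (rule norm_blinfun_compose)
qed

end

text \<open>Adjointable operators are closed among the bounded ones: taking adjoints does not
  increase the norms of differences, so the adjoints converge too, and the adjoint relation survives
  in the limit.\<close>

instance adjop :: (unital_cstar) banach
proof
  fix X :: "nat \<Rightarrow> 'a adjop"
  assume X: "Cauchy X"
  have norm_eq: "norm (blinfun_of_adjop T) = norm T" for T :: "'a adjop"
    by transfer simp
  have diff_eq: "blinfun_of_adjop (S - T) = blinfun_of_adjop S - blinfun_of_adjop T" for S T :: "'a adjop"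
    by (rule blinfun_eqI) (simp add: blinfun.diff_left app_diff flip: app.rep_eq)
  have star_diff: "adj_op S - adj_op T = adj_op (S - T)" for S T :: "'a adjop"
    by (rule adj_op_unique [symmetric])
      (simp add: app_diff ip_diff_right ip_diff_left ip_app)
  have conv: "\<exists>A. (\<lambda>k. blinfun_of_adjop (Y k)) \<longlonglongrightarrow> A"
    if "\<And>k l. norm (Y k - Y l) \<le> norm (X k - X l)" for Y :: "nat \<Rightarrow> 'a adjop"
  proof -
    have "Cauchy (\<lambda>k. blinfun_of_adjop (Y k))"
    proof (rule metric_CauchyI)
      fix e :: real assume "e > 0"
      then obtain M where M: "\<forall>k\<ge>M. \<forall>l\<ge>M. dist (X k) (X l) < e"
        using X unfolding Cauchy_def by blast
      have "dist (blinfun_of_adjop (Y k)) (blinfun_of_adjop (Y l)) < e" if "k \<ge> M" "l \<ge> M" for k l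
      proof -
        have "norm (X k - X l) < e"
          using M that by (simp add: dist_adjop_def)
        then have "norm (Y k - Y l) < e"
          using \<open>norm (Y k - Y l) \<le> norm (X k - X l)\<close> by linarith
        then show ?thesis
          by (simp add: dist_norm norm_eq flip: diff_eq)
      qed
      then show "\<exists>M. \<forall>k\<ge>M. \<forall>l\<ge>M. dist (blinfun_of_adjop (Y k)) (blinfun_of_adjop (Y l)) < e"
        by blast
    qed
    then show ?thesis
      by (simp add: Cauchy_convergent_iff convergent_def)
  qed
  obtain A where A: "(\<lambda>k. blinfun_of_adjop (X k)) \<longlonglongrightarrow> A"
    using conv [of X] by auto
  obtain A' where A': "(\<lambda>k. blinfun_of_adjop (adj_op (X k))) \<longlonglongrightarrow> A'"
    using conv [of "\<lambda>k. adj_op (X k)"] by (auto simp: star_diff norm_adj_op_le)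
  have apply_lim: "(\<lambda>k. ip g (blinfun_apply (Y k) f)) \<longlonglongrightarrow> ip g (blinfun_apply B f)"
    if "Y \<longlonglongrightarrow> B" for Y B and f g :: "'a l2"
    by (intro bounded_linear.tendsto [OF bounded_linear_ip_right]
        bounded_linear.tendsto [OF blinfun.bounded_linear_left] that)
  have "adj_pair A A'"
    unfolding adj_pair_def
  proof (intro allI)
    fix f g
    have "(\<lambda>k. star (ip g (blinfun_apply (blinfun_of_adjop (X k)) f))) \<longlonglongrightarrow> star (ip g (blinfun_apply A f))"
      by (intro tendsto_star apply_lim A)
    moreover have "star (ip g (blinfun_apply (blinfun_of_adjop (X k)) f))
        = ip f (blinfun_apply (blinfun_of_adjop (adj_op (X k))) g)" for k
      by (metis star_ip ip_app app.rep_eq)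
    ultimately have "(\<lambda>k. ip f (blinfun_apply (blinfun_of_adjop (adj_op (X k))) g)) \<longlonglongrightarrow> ip (blinfun_apply A f) g"
      by (simp add: star_ip)
    then show "ip (blinfun_apply A f) g = ip f (blinfun_apply A' g)"
      using apply_lim [OF A'] LIMSEQ_unique by blast
  qed
  then have A_eq: "blinfun_of_adjop (Abs_adjop A) = A"
    by (intro Abs_adjop_inverse) auto
  have "X \<longlonglongrightarrow> Abs_adjop A"
    unfolding LIMSEQ_def
  proof (intro allI impI)
    fix e :: real assume "e > 0"
    then obtain M where "\<forall>k\<ge>M. dist (blinfun_of_adjop (X k)) A < e"
      using A unfolding LIMSEQ_def by blast
    moreover have "dist (X k) (Abs_adjop A) = dist (blinfun_of_adjop (X k)) A" for k
      by (simp add: dist_adjop_def dist_norm A_eq flip: norm_eq) (simp add: diff_eq A_eq)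
    ultimately show "\<exists>M. \<forall>k\<ge>M. dist (X k) (Abs_adjop A) < e"
      by auto
  qed
  then show "convergent X"
    by (auto simp: convergent_def)
qed

instantiation adjop :: (unital_cstar) unital_cstar
begin

definition scaleC_adjop :: "complex \<Rightarrow> 'a adjop \<Rightarrow> 'a adjop" where "scaleC_adjop = scale_op"
definition star_adjop :: "'a adjop \<Rightarrow> 'a adjop" where "star_adjop = adj_op"

lemma app_scaleC: "app (scaleC c T) f = cscale c (app T f)"
  by (simp add: scaleC_adjop_def app_scale_op)

lemma ip_app_left: "ip (app T f) g = ip f (app (star T) g)"
  by (simp add: star_adjop_def ip_app)

lemma star_adjop_unique: "(\<And>f g. ip (app T f) g = ip f (app S g)) \<Longrightarrow> star T = S"
  unfolding star_adjop_def by (rule adj_op_unique)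

instance
proof
  fix S T :: "'a adjop" and r :: real and c d :: complex
  note app = app_add app_mult app_scaleC
  show "norm (scaleC c T) = cmod c * norm T"
    by (simp add: scaleC_adjop_def norm_scale_op)
  show "scaleC c (S + T) = scaleC c S + scaleC c T" "scaleC (c + d) T = scaleC c T + scaleC d T"
    "scaleC c (scaleC d T) = scaleC (c * d) T" "scaleC c S * T = scaleC c (S * T)"
    by (rule adjop_eqI, rule l2_eqI, simp add: app scaleC_add_right scaleC_add_left scaleC_scaleC)+
  show "S * scaleC c T = scaleC c (S * T)"
    by (rule adjop_eqI) (simp add: app app_cscale)
  show "scaleC (complex_of_real r) T = r *\<^sub>R T"
    by (simp add: scaleR_adjop_def scaleC_adjop_def)
  show "star (star T) = T"
    by (rule star_adjop_unique) (simp add: star_adjop_def ip_app_star)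
  show "star (S + T) = star S + star T"
    by (rule star_adjop_unique) (simp add: app ip_add_left ip_add_right ip_app_left)
  show "star (scaleC c T) = scaleC (cnj c) (star T)"
    by (rule star_adjop_unique) (simp add: app ip_cscale_left ip_cscale_right ip_app_left)
  show "star (S * T) = star T * star S"
    by (rule star_adjop_unique) (simp add: app ip_app_left)
  show "norm (star T * T) = (norm T)\<^sup>2"
  proof (rule antisym)
    have "norm (star T * T) \<le> norm (star T) * norm T"
      by (rule norm_mult_ineq)
    also have "\<dots> \<le> norm T * norm T"
      by (intro mult_right_mono norm_ge_zero) (simp add: star_adjop_def norm_adj_op_le)
    finally show "norm (star T * T) \<le> (norm T)\<^sup>2"
      by (simp add: power2_eq_square)
    have "norm T \<le> sqrt (norm (star T * T))"
    proof (rule norm_adjop_le)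
      fix f
      have "(norm (app T f))\<^sup>2 = norm (ip f (app (star T * T) f))"
        by (metis norm_ip_self app_mult ip_app_left)
      also have "\<dots> \<le> norm f * norm (app (star T * T) f)"
        by (rule norm_ip_le)
      also have "\<dots> \<le> norm f * (norm (star T * T) * norm f)"
        by (intro mult_left_mono norm_app_le) simp
      also have "\<dots> = (sqrt (norm (star T * T)) * norm f)\<^sup>2"
        using norm_ge_zero [of "star T * T"] by (simp add: power_mult_distrib power2_eq_square mult_ac)
      finally show "norm (app T f) \<le> sqrt (norm (star T * T)) * norm f"
        by (rule power2_le_imp_le) (simp add: norm_ge_zero)
    qed (simp add: norm_ge_zero)
    then have "(norm T)\<^sup>2 \<le> (sqrt (norm (star T * T)))\<^sup>2"
      by (rule power_mono) (rule norm_ge_zero)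
    then show "(norm T)\<^sup>2 \<le> norm (star T * T)"
      by (simp add: norm_ge_zero)
  qed
qed

end

section \<open>\<open>C\<^sup>*\<close>-algebras as records embedded in a type\<close>

text \<open>Transports results from a type to a record: S is a closed unital *-subalgebra of a type
  of the class, and \<phi> identifies it with the carrier of R. It is used with the identity on B,
  and with \<open>op_fun\<close> both on all adjointable operators and on the closure of the
  finitely supported elements.\<close>

locale cstar_embedding =
  fixes \<phi> :: "'a::unital_cstar \<Rightarrow> 'c" and S :: "'a set" and R :: "('c, 'm) cstar_scheme" (structure)
  assumes inj: "inj_on \<phi> S"
    and carrier_eq: "carrier R = \<phi> ` S"
    and one_eq: "\<one> = \<phi> 1" and zero_eq: "\<zero> = \<phi> 0"
    and mult_eq: "\<And>x y. x \<in> S \<Longrightarrow> y \<in> S \<Longrightarrow> \<phi> x \<otimes> \<phi> y = \<phi> (x * y)"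
    and add_eq: "\<And>x y. x \<in> S \<Longrightarrow> y \<in> S \<Longrightarrow> \<phi> x \<oplus> \<phi> y = \<phi> (x + y)"
    and scal_eq: "\<And>c x. x \<in> S \<Longrightarrow> scal R c (\<phi> x) = \<phi> (scaleC c x)"
    and adj_eq: "\<And>x. x \<in> S \<Longrightarrow> adj R (\<phi> x) = \<phi> (star x)"
    and nrm_eq: "\<And>x. x \<in> S \<Longrightarrow> nrm R (\<phi> x) = norm x"
    and closed: "closed S"
    and one_in [simp]: "1 \<in> S"
    and mult_in: "\<And>x y. x \<in> S \<Longrightarrow> y \<in> S \<Longrightarrow> x * y \<in> S"
    and add_in: "\<And>x y. x \<in> S \<Longrightarrow> y \<in> S \<Longrightarrow> x + y \<in> S"
    and scaleC_in: "\<And>c x. x \<in> S \<Longrightarrow> scaleC c x \<in> S"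
    and star_in: "\<And>x. x \<in> S \<Longrightarrow> star x \<in> S"
begin

lemma zero_in [simp]: "0 \<in> S"
  using scaleC_in [of 1 0] by simp

lemma scaleR_in: "x \<in> S \<Longrightarrow> r *\<^sub>R x \<in> S"
  by (metis scaleC_in scaleC_of_real)

lemma minus_in: "x \<in> S \<Longrightarrow> - x \<in> S"
  using scaleC_in [of x "- 1"] by simp

lemma diff_in: "x \<in> S \<Longrightarrow> y \<in> S \<Longrightarrow> x - y \<in> S"
  using add_in [of x "- y"] minus_in by simp

lemma subspace: "subspace S"
  by (simp add: subspace_def add_in scaleR_in)

lemma in_carrier [simp]: "x \<in> S \<Longrightarrow> \<phi> x \<in> carrier R"
  by (simp add: carrier_eq)

lemma ring: "ring R"
proof (rule ringI)
  show "abelian_group R"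
  proof (rule abelian_groupI)
    fix x assume "x \<in> carrier R"
    then obtain u where "u \<in> S" "x = \<phi> u"
      by (auto simp: carrier_eq)
    then show "\<exists>y\<in>carrier R. y \<oplus> x = \<zero>"
      by (intro bexI [of _ "\<phi> (- u)"]) (auto simp: add_eq zero_eq minus_in)
  qed (auto simp: carrier_eq add_eq zero_eq add_in ac_simps)
  show "monoid R"
    by (rule monoidI) (auto simp: carrier_eq mult_eq one_eq mult_in mult.assoc)
qed (auto simp: carrier_eq mult_eq add_eq add_in mult_in distrib_left distrib_right)

lemma minus_eq: "x \<in> S \<Longrightarrow> y \<in> S \<Longrightarrow> \<phi> x \<ominus> \<phi> y = \<phi> (x - y)"
proof -
  assume "x \<in> S" "y \<in> S"
  interpret ring R by (rule ring)
  have "\<ominus> \<phi> y = \<phi> (- y)"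
    using \<open>y \<in> S\<close> by (intro minus_equality) (auto simp: add_eq zero_eq minus_in)
  then show ?thesis
    using \<open>x \<in> S\<close> \<open>y \<in> S\<close> by (simp add: a_minus_def add_eq minus_in)
qed

lemma dist_eq: "x \<in> S \<Longrightarrow> y \<in> S \<Longrightarrow> cstar_dist R (\<phi> x) (\<phi> y) = dist x y"
  by (simp add: cstar_dist_def minus_eq nrm_eq diff_in dist_norm)

lemma Metric_space: "Metric_space (carrier R) (cstar_dist R)"
proof
  fix x y
  show "0 \<le> cstar_dist R x y"
    by (cases "x \<in> carrier R \<and> y \<in> carrier R") (auto simp: carrier_eq dist_eq, auto simp: cstar_dist_def carrier_eq)
  show "cstar_dist R x y = cstar_dist R y x"
    by (cases "x \<in> carrier R \<and> y \<in> carrier R")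
      (auto simp: carrier_eq dist_eq dist_commute, auto simp: cstar_dist_def carrier_eq)
next
  fix x y assume "x \<in> carrier R" "y \<in> carrier R"
  then show "cstar_dist R x y = 0 \<longleftrightarrow> x = y"
    using inj by (auto simp: carrier_eq dist_eq inj_on_def)
next
  fix x y z assume "x \<in> carrier R" "y \<in> carrier R" "z \<in> carrier R"
  then show "cstar_dist R x z \<le> cstar_dist R x y + cstar_dist R y z"
    by (auto simp: carrier_eq dist_eq dist_triangle)
qed

lemma closure_of_eq: "X \<subseteq> S \<Longrightarrow> norm_topology R closure_of (\<phi> ` X) = \<phi> ` closure X"
proof -
  assume X: "X \<subseteq> S"
  interpret Metric_space "carrier R" "cstar_dist R" by (rule Metric_space)
  have "closure X \<subseteq> S"
    using X closed by (rule closure_minimal)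
  have "u \<in> closure X" if u: "u \<in> S" "\<forall>r>0. \<exists>y\<in>\<phi> ` X. y \<in> mball (\<phi> u) r" for u
    unfolding closure_approachable
  proof (intro allI impI)
    fix r :: real assume "r > 0"
    then obtain v where "v \<in> X" "\<phi> v \<in> mball (\<phi> u) r"
      using u(2) by blast
    then show "\<exists>v\<in>X. dist v u < r"
      using u(1) X by (auto simp: dist_eq dist_commute subset_iff)
  qed
  moreover have "\<exists>y\<in>\<phi> ` X. y \<in> mball (\<phi> u) r" if u: "u \<in> closure X" "r > 0" for u r
  proof -
    obtain v where "v \<in> X" "dist v u < r"
      using u unfolding closure_approachable by blast
    then show ?thesis
      using X \<open>closure X \<subseteq> S\<close> u by (auto simp: dist_eq dist_commute subset_iff)
  qed
  ultimately show ?thesis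
    using \<open>closure X \<subseteq> S\<close> unfolding norm_topology_def metric_closure_of by (auto simp: carrier_eq)
qed

lemma mcomplete: "Metric_space.mcomplete (carrier R) (cstar_dist R)"
proof -
  interpret Metric_space "carrier R" "cstar_dist R" by (rule Metric_space)
  show ?thesis
    unfolding mcomplete_def
  proof (intro allI impI)
    fix \<sigma> assume \<sigma>: "MCauchy \<sigma>"
    then have "\<sigma> n \<in> \<phi> ` S" for n
      unfolding MCauchy_def by (auto simp: carrier_eq image_subset_iff)
    then have "\<forall>n. \<exists>u. u \<in> S \<and> \<sigma> n = \<phi> u"
      by blast
    then obtain u where u: "\<And>n. u n \<in> S" "\<And>n. \<sigma> n = \<phi> (u n)"
      by metis
    have "Cauchy u"
      using \<sigma> u unfolding MCauchy_def Cauchy_def by (simp add: dist_eq)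
    then obtain l where l: "u \<longlonglongrightarrow> l"
      by (auto simp: Cauchy_convergent_iff convergent_def)
    then have "l \<in> S"
      using closed_sequentially [OF closed] u by blast
    have "limitin mtopology \<sigma> (\<phi> l) sequentially"
      unfolding limitin_metric
    proof (intro conjI allI impI)
      fix e :: real assume "e > 0"
      then have "\<forall>\<^sub>F n in sequentially. dist (u n) l < e"
        by (rule tendstoD [OF l])
      then show "\<forall>\<^sub>F n in sequentially. \<sigma> n \<in> carrier R \<and> cstar_dist R (\<sigma> n) (\<phi> l) < e"
        by eventually_elim (simp add: u dist_eq \<open>l \<in> S\<close>)
    qed (simp add: \<open>l \<in> S\<close>)
    then show "\<exists>x. limitin mtopology \<sigma> x sequentially" by blast
  qed
qed

lemma unital_cstar_algebra: "unital_cstar_algebra R"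
proof -
  interpret ring R by (rule ring)
  have inj0: "\<phi> x = \<phi> 0 \<longleftrightarrow> x = 0" if "x \<in> S" for x
    by (rule inj_on_eq_iff [OF inj that zero_in])
  show ?thesis
    by (unfold_locales, unfold carrier_eq)
      (rule mcomplete [unfolded carrier_eq] |
       ((elim imageE)?,
        simp add: imageI mult_eq add_eq scal_eq adj_eq nrm_eq zero_eq mult_in add_in scaleC_in star_in inj0
          scaleC_add_right scaleC_add_left scaleC_scaleC scaleC_mult_left scaleC_mult_right star_star star_add
          star_scaleC star_mult norm_triangle_ineq norm_scaleC norm_mult_ineq cstar_identity))+
qed

lemma power_in: "x \<in> S \<Longrightarrow> x ^ n \<in> S"
  by (induction n) (auto intro: mult_in)

text \<open>A state of R is only known to be positive on \<open>star y * y\<close> with y in S. The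
  root must therefore be found inside S, which is possible because it is a limit of polynomials in
  h.\<close>

lemma sqrt_in:
  assumes "selfadj h" "h \<in> S" "norm h \<le> 1"
  obtains y where "y \<in> S" "star y * y = 1 - h"
proof -
  obtain y where y: "y * y = 1 - h" "star h = h \<Longrightarrow> star y = y" "y \<in> closure (span (range (\<lambda>n. h ^ n)))"
    using sqrt_one_minus [OF assms(3)] by metis
  have "span (range (\<lambda>n. h ^ n)) \<subseteq> S"
    using assms(2) by (intro span_minimal subspace) (auto intro: power_in)
  then have "closure (span (range (\<lambda>n. h ^ n))) \<subseteq> S"
    by (rule closure_minimal [OF _ closed])
  then show ?thesis
    using y assms(1) by (intro that [of y]) (auto simp: selfadj_def)
qed

section \<open>States of the embedded algebra\<close>

context
  fixes \<psi> assumes \<psi>: "\<psi> \<in> state_space R"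
begin

lemma state_add: "x \<in> S \<Longrightarrow> y \<in> S \<Longrightarrow> \<psi> (\<phi> (x + y)) = \<psi> (\<phi> x) + \<psi> (\<phi> y)"
  using \<psi> by (simp add: state_space_def flip: add_eq)

lemma state_scaleC: "x \<in> S \<Longrightarrow> \<psi> (\<phi> (scaleC c x)) = c * \<psi> (\<phi> x)"
  using \<psi> by (simp add: state_space_def flip: scal_eq)

lemma state_one: "\<psi> (\<phi> 1) = 1"
  using \<psi> by (simp add: state_space_def flip: one_eq)

lemma state_pos: "x \<in> S \<Longrightarrow> \<psi> (\<phi> (star x * x)) \<in> \<real>\<^sub>\<ge>\<^sub>0"
  using \<psi> by (simp add: state_space_def adj_eq mult_eq star_in flip: adj_eq mult_eq)

lemma state_scaleR: "x \<in> S \<Longrightarrow> \<psi> (\<phi> (r *\<^sub>R x)) = of_real r * \<psi> (\<phi> x)"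
  using state_scaleC [of x "of_real r"] by (simp add: scaleC_of_real)

lemma state_minus: "x \<in> S \<Longrightarrow> \<psi> (\<phi> (- x)) = - \<psi> (\<phi> x)"
  using state_scaleC [of x "- 1"] by simp

lemma state_diff: "x \<in> S \<Longrightarrow> y \<in> S \<Longrightarrow> \<psi> (\<phi> (x - y)) = \<psi> (\<phi> x) - \<psi> (\<phi> y)"
  using state_add [of x "- y"] by (simp add: state_minus minus_in)

text \<open>If norm k \<le> 1, then 1 - k has the form \<open>star y * y\<close>, so the value at k
  is real and at most 1. Scaling and the passage from h to -h give both bounds.\<close>

lemma state_selfadj:
  assumes h: "selfadj h" "h \<in> S"
  shows "\<psi> (\<phi> h) \<in> \<real>" "\<bar>Re (\<psi> (\<phi> h))\<bar> \<le> norm h"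
proof -
  have *: "\<psi> (\<phi> k) \<in> \<real> \<and> Re (\<psi> (\<phi> k)) \<le> 1" if k: "selfadj k" "k \<in> S" "norm k \<le> 1" for k
  proof -
    obtain y where y: "y \<in> S" "star y * y = 1 - k"
      using sqrt_in [OF k] by blast
    have "\<psi> (\<phi> (1 - k)) \<in> \<real>\<^sub>\<ge>\<^sub>0"
      using state_pos [OF y(1)] y(2) by simp
    then have "1 - \<psi> (\<phi> k) \<in> \<real>\<^sub>\<ge>\<^sub>0"
      using k by (simp add: state_diff state_one)
    then show ?thesis
      by (auto simp: complex_nonneg_Reals_iff complex_is_Real_iff)
  qed
  have "\<psi> (\<phi> h) \<in> \<real> \<and> Re (\<psi> (\<phi> h)) \<le> norm h" if "selfadj h" "h \<in> S" for h
  proof (cases "h = 0")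
    case True
    then show ?thesis
      using state_scaleC [of 0 0] by simp
  next
    case False
    have "\<psi> (\<phi> ((1 / norm h) *\<^sub>R h)) \<in> \<real> \<and> Re (\<psi> (\<phi> ((1 / norm h) *\<^sub>R h))) \<le> 1"
      using that by (intro *) (auto intro: selfadj_scaleR scaleR_in)
    then show ?thesis
      using False that by (auto simp: state_scaleR field_simps complex_is_Real_iff)
  qed
  from this [of h] this [of "- h"] h show "\<psi> (\<phi> h) \<in> \<real>" "\<bar>Re (\<psi> (\<phi> h))\<bar> \<le> norm h"
    by (auto simp: selfadj_minus minus_in state_minus)
qed

lemma state_le_norm:
  assumes x: "x \<in> S"
  shows "cmod (\<psi> (\<phi> x)) \<le> norm x"
proof (cases "\<psi> (\<phi> x) = 0")
  case False
  \<comment> \<open>A phase that rotates x so that the value of the state becomes its modulus. This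
    value is real and therefore equals the value at the real part h of u.\<close>
  define c where "c = cnj (sgn (\<psi> (\<phi> x)))"
  have c: "cmod c = 1" "c * \<psi> (\<phi> x) = of_real (cmod (\<psi> (\<phi> x)))"
    using False complex_norm_square [of "\<psi> (\<phi> x)"]
    by (simp_all add: c_def norm_sgn norm_divide sgn_eq mult.commute power2_eq_square nonzero_divide_eq_eq)
  define u where "u = scaleC c x"
  have u: "u \<in> S" "norm u = norm x" "\<psi> (\<phi> u) = of_real (cmod (\<psi> (\<phi> x)))"
    using x c by (simp_all add: u_def scaleC_in norm_scaleC state_scaleC)
  define h where "h = (1/2) *\<^sub>R (u + star u)"
  \<comment> \<open>The negative of the usual imaginary part, hence the minus sign in u = h - i
    k.\<close>
  define k where "k = (1/2) *\<^sub>R scaleC \<i> (u - star u)"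
  have hk: "selfadj h" "selfadj k" "h \<in> S" "k \<in> S"
    using u by (simp_all add: h_def k_def selfadj_scaleR selfadj_imaginary scaleR_in scaleC_in add_in diff_in star_in)
  have "h - scaleC \<i> k = (1/2) *\<^sub>R (u + star u) + (1/2) *\<^sub>R (u - star u)"
    by (simp add: h_def k_def scaleC_scaleR scaleC_scaleC scaleR_diff_right)
  then have "u = h - scaleC \<i> k"
    unfolding scaleR_add_right [symmetric] by simp
  then have "\<psi> (\<phi> u) = \<psi> (\<phi> h) - \<i> * \<psi> (\<phi> k)"
    using hk by (simp add: state_diff state_scaleC scaleC_in)
  then have "Re (\<psi> (\<phi> u)) = Re (\<psi> (\<phi> h))"
    using state_selfadj(1) [of k] hk by (simp add: complex_is_Real_iff)
  then have "cmod (\<psi> (\<phi> x)) \<le> norm h"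
    using state_selfadj(2) [of h] hk u by simp
  also have "norm h \<le> norm x"
    using norm_triangle_ineq [of u "star u"] u by (simp add: h_def)
  finally show ?thesis .
qed simp

end

end

section \<open>Adjointable operators as functions\<close>

definition to_adjop :: "('b::unital_cstar l2 \<Rightarrow> 'b l2) \<Rightarrow> 'b adjop"
  where "to_adjop T = Abs_adjop (Blinfun T)"

lemma app_to_adjop:
  assumes "\<And>f g. ip (T f) g = ip f (S g)"
  shows "app (to_adjop T) f = T f"
proof -
  have T: "bounded_linear T"
    using assms by (rule adjointable_bounded_linear)
  have S: "bounded_linear S"
    by (rule adjointable_bounded_linear [of S T]) (metis assms star_ip)
  have "adj_pair (Blinfun T) (Blinfun S)"
    unfolding adj_pair_def by (simp add: bounded_linear_Blinfun_apply T S assms)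
  then have "blinfun_of_adjop (to_adjop T) = Blinfun T"
    unfolding to_adjop_def by (intro Abs_adjop_inverse) auto
  then show ?thesis
    by (simp add: app.rep_eq bounded_linear_Blinfun_apply T)
qed

definition op_fun :: "'b::unital_cstar adjop \<Rightarrow> 'b l2_op"
  where "op_fun A = (\<lambda>f\<in>l2Z. coord (app A (Abs_l2 f)))"

lemma op_fun_coord [simp]: "op_fun A (coord f) = coord (app A f)"
  by (simp add: op_fun_def coord_inverse)

lemma l2Z_cases: assumes "f \<in> l2Z" obtains g where "f = coord g"
  using assms by (metis Abs_l2_inverse)

lemma op_fun_eqI: "T \<in> extensional l2Z \<Longrightarrow> (\<And>f. T (coord f) = coord (app A f)) \<Longrightarrow> T = op_fun A"
  by (rule extensionalityI [of _ l2Z]) (auto simp: op_fun_def elim!: l2Z_cases simp: coord_inverse)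

lemma op_fun_in: "op_fun A \<in> l2Z \<rightarrow>\<^sub>E l2Z"
  by (auto simp: op_fun_def)

lemma inj_op_fun: "inj op_fun"
proof (rule injI)
  fix A B :: "'b::unital_cstar adjop" assume *: "op_fun A = op_fun B"
  show "A = B"
  proof (rule adjop_eqI)
    fix f show "app A f = app B f"
      using fun_cong [OF *, of "coord f"] by (simp add: coord_inject)
  qed
qed

lemma l2_inner_coord: "l2_inner (coord f) (coord g) = ip f g"
  by (simp add: ip.rep_eq)

text \<open>Uniqueness of the adjoint as an extensional function, which gives the definite
  description in \<open>adjointable_cstar\<close> its value.\<close>

lemma is_adjoint_op_fun: "is_adjoint (op_fun A) S \<longleftrightarrow> S = op_fun (star A)"
proof
  assume S: "is_adjoint (op_fun A) S"
  show "S = op_fun (star A)"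
  proof (rule op_fun_eqI)
    fix f
    have "S (coord f) \<in> l2Z"
      using S by (auto simp: is_adjoint_def)
    then obtain g where g: "S (coord f) = coord g"
      by (rule l2Z_cases)
    have "ip h g = ip h (app (star A) f)" for h
    proof -
      have "l2_inner (op_fun A (coord h)) (coord f) = l2_inner (coord h) (S (coord f))"
        using S coord_in unfolding is_adjoint_def by blast
      then show ?thesis
        by (simp add: g l2_inner_coord ip_app_left)
    qed
    then show "S (coord f) = coord (app (star A) f)"
      unfolding g by (metis ip_extensional)
  qed (use S in \<open>auto simp: is_adjoint_def PiE_def\<close>)
next
  assume "S = op_fun (star A)"
  moreover have "l2_inner (op_fun A f) g = l2_inner f (op_fun (star A) g)" if "f \<in> l2Z" "g \<in> l2Z" for f g
    using that by (elim l2Z_cases) (simp add: l2_inner_coord ip_app_left)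
  ultimately show "is_adjoint (op_fun A) S"
    by (simp add: is_adjoint_def op_fun_in)
qed

text \<open>The carrier asks only for an adjoint, not for linearity or boundedness. That every such
  function comes from a bounded operator rests on \<open>adjointable_bounded_linear\<close>.\<close>

lemma carrier_adjointable_cstar: "carrier (adjointable_cstar :: 'b::unital_cstar l2_op cstar) = range op_fun"
proof (intro equalityI subsetI)
  fix T :: "'b l2_op"
  assume "T \<in> carrier adjointable_cstar"
  then obtain S where T: "T \<in> l2Z \<rightarrow>\<^sub>E l2Z" and S: "is_adjoint T S"
    by (auto simp: adjointable_cstar_def)
  define T' where "T' f = Abs_l2 (T (coord f))" for f
  define S' where "S' f = Abs_l2 (S (coord f))" for f
  have c: "coord (T' f) = T (coord f)" "coord (S' f) = S (coord f)" for f
    using T S by (auto simp: T'_def S'_def is_adjoint_def intro!: Abs_l2_inverse)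
  have "ip (T' f) g = ip f (S' g)" for f g
    using S by (simp add: is_adjoint_def c flip: l2_inner_coord)
  then have "app (to_adjop T') f = T' f" for f
    by (rule app_to_adjop)
  then have "T = op_fun (to_adjop T')"
    using T by (intro op_fun_eqI) (auto simp: c PiE_def)
  then show "T \<in> range op_fun" by blast
next
  fix T :: "'b l2_op"
  assume "T \<in> range op_fun"
  then show "T \<in> carrier adjointable_cstar"
    using op_fun_in is_adjoint_op_fun by (force simp: adjointable_cstar_def)
qed

lemma nrm_op_fun: "nrm adjointable_cstar (op_fun A) = norm A"
proof -
  have eq: "(\<lambda>f. l2_norm (op_fun A f)) ` {f \<in> l2Z. l2_norm f \<le> 1} = (\<lambda>f. norm (app A f)) ` {f. norm f \<le> 1}"
  proof -
    have *: "{f \<in> l2Z. l2_norm f \<le> 1} = coord ` {f :: 'a l2. norm f \<le> 1}"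
      by (auto simp: norm_l2.rep_eq elim!: l2Z_cases)
    show ?thesis
      unfolding * image_image by (simp add: norm_l2.rep_eq)
  qed
  have "(SUP f\<in>{f. norm f \<le> 1}. norm (app A f)) = norm A"
  proof (rule antisym)
    have le: "norm (app A f) \<le> norm A" if "norm f \<le> 1" for f
      using norm_app_le [of A f] mult_left_mono [OF that norm_ge_zero [of A]] by simp
    show "(SUP f\<in>{f. norm f \<le> 1}. norm (app A f)) \<le> norm A"
      using le by (intro cSUP_least) (auto intro: exI [of _ 0])
    have bdd: "bdd_above ((\<lambda>f. norm (app A f)) ` {f. norm f \<le> 1})"
      by (rule bdd_aboveI2 [of _ _ "norm A"]) (use le in auto)
    have upper: "norm (app A f) \<le> (SUP f\<in>{f. norm f \<le> 1}. norm (app A f))" if "norm f \<le> 1" for f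
      using that by (intro cSUP_upper bdd) auto
    show "norm A \<le> (SUP f\<in>{f. norm f \<le> 1}. norm (app A f))"
    proof (rule norm_adjop_le)
      fix f
      show "norm (app A f) \<le> (SUP f\<in>{f. norm f \<le> 1}. norm (app A f)) * norm f"
      proof (cases "f = 0")
        case False
        then show ?thesis
          using upper [of "(1 / norm f) *\<^sub>R f"] by (simp add: field_simps)
      qed simp
    qed (use upper [of 0] in simp)
  qed
  then show ?thesis
    by (simp add: adjointable_cstar_def eq)
qed

lemma cstar_embedding_adjointable:
  "cstar_embedding (op_fun :: 'b::unital_cstar adjop \<Rightarrow> _) UNIV adjointable_cstar"
proof
  fix A B :: "'b adjop" and c
  show "\<one>\<^bsub>adjointable_cstar\<^esub> = (op_fun 1 :: 'b l2_op)"
    by (rule op_fun_eqI) (auto simp: adjointable_cstar_def app_1)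
  show "\<zero>\<^bsub>adjointable_cstar\<^esub> = (op_fun 0 :: 'b l2_op)"
    by (rule op_fun_eqI) (auto simp: adjointable_cstar_def app_0)
  show "op_fun A \<otimes>\<^bsub>adjointable_cstar\<^esub> op_fun B = op_fun (A * B)"
    by (rule op_fun_eqI) (auto simp: adjointable_cstar_def app_mult compose_eq)
  show "op_fun A \<oplus>\<^bsub>adjointable_cstar\<^esub> op_fun B = op_fun (A + B)"
    by (rule op_fun_eqI) (auto simp: adjointable_cstar_def app_add)
  show "scal adjointable_cstar c (op_fun A) = op_fun (scaleC c A)"
    by (rule op_fun_eqI) (auto simp: adjointable_cstar_def app_scaleC)
  show "adj adjointable_cstar (op_fun A) = op_fun (star A)"
    unfolding adjointable_cstar_def by simp (rule the_equality, simp_all add: is_adjoint_op_fun)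
  show "nrm adjointable_cstar (op_fun A) = norm A"
    by (rule nrm_op_fun)
qed (simp_all add: inj_op_fun carrier_adjointable_cstar)

interpretation adjointable: cstar_embedding op_fun UNIV adjointable_cstar
  by (rule cstar_embedding_adjointable)

interpretation adjointable_ring: ring "adjointable_cstar :: 'b::unital_cstar l2_op cstar"
  by (rule adjointable.ring)

section \<open>Automorphisms\<close>

lemma star_automorphism_id: "star_automorphism (\<lambda>x. x)"
  by (simp add: star_automorphism_def bij_id [unfolded id_def])

lemma star_automorphism_comp:
  "star_automorphism \<alpha> \<Longrightarrow> star_automorphism \<beta> \<Longrightarrow> star_automorphism (\<lambda>x. \<alpha> (\<beta> x))"
  unfolding star_automorphism_def using bij_comp [of \<beta> \<alpha>] by (simp add: o_def)

lemma star_automorphism_inv: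
  assumes "star_automorphism \<beta>"
  shows "star_automorphism (inv_into UNIV \<beta>)"
proof -
  have bij: "bij \<beta>" and inj: "inj \<beta>" and s: "\<beta> (inv_into UNIV \<beta> x) = x" for x
    using assms by (auto simp: star_automorphism_def bij_is_inj bij_is_surj surj_f_inv_f)
  have eqI: "inv_into UNIV \<beta> x = y" if "\<beta> y = x" for x y
    using inv_f_f [OF inj, of y] that by simp
  show ?thesis
    using assms bij_imp_bij_inv [OF bij] unfolding star_automorphism_def
    by (auto intro!: eqI simp: s)
qed

text \<open>Positivity in the form (norm x)^2 - x* x = y* y is algebraic, so \<beta> preserves it
  and bounds \<open>star (\<beta> x) * \<beta> x\<close> by (norm x)^2.\<close>

lemma star_automorphism_norm_le:
  assumes "star_automorphism (\<beta> :: 'b::unital_cstar \<Rightarrow> 'b)"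
  shows "norm (\<beta> x) \<le> norm x"
proof -
  have \<beta>: "\<beta> (x + y) = \<beta> x + \<beta> y" "\<beta> (scaleC c x) = scaleC c (\<beta> x)" "\<beta> (x * y) = \<beta> x * \<beta> y"
    "\<beta> (star x) = star (\<beta> x)" for x y c
    using assms by (auto simp: star_automorphism_def)
  \<comment> \<open>Unitality is not part of \<open>star_automorphism\<close>; it follows from
    surjectivity and multiplicativity.\<close>
  obtain e where "\<beta> e = 1"
    using assms by (metis star_automorphism_def bij_is_surj surjD)
  then have one: "\<beta> 1 = 1"
    using \<beta>(3) [of 1 e] by simp
  have diff: "\<beta> (x - y) = \<beta> x - \<beta> y" for x y
    using \<beta>(1) [of "x - y" y] by simp
  have sR: "\<beta> (r *\<^sub>R x) = r *\<^sub>R \<beta> x" for r x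
    by (metis \<beta>(2) scaleC_of_real)
  have "pos ((norm x)\<^sup>2 *\<^sub>R 1 - star x * x)"
    by (rule pos_norm_diff) (simp_all add: cstar_identity)
  then obtain y where y: "pos y" "y * y = (norm x)\<^sup>2 *\<^sub>R 1 - star x * x"
    using pos_sqrt by metis
  have sy: "star y = y"
    using y(1) pos_selfadj selfadj_def by metis
  have "\<beta> (y * y) = (norm x)\<^sup>2 *\<^sub>R 1 - star (\<beta> x) * \<beta> x"
    by (simp add: y(2) diff sR one \<beta>(3,4))
  moreover have "\<beta> (y * y) = star (\<beta> y) * \<beta> y"
    by (simp add: \<beta>(3) sy flip: \<beta>(4))
  ultimately have "pos ((norm x)\<^sup>2 *\<^sub>R 1 - star (\<beta> x) * \<beta> x)"
    by (metis pos_star_mult)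
  then have "norm (star (\<beta> x) * \<beta> x) \<le> norm ((norm x)\<^sup>2 *\<^sub>R (1::'b))"
    by (intro pos_norm_mono pos_star_mult)
  also have "\<dots> \<le> (norm x)\<^sup>2"
    using mult_left_le [OF norm_one_le [where 'a = 'b], of "(norm x)\<^sup>2"] by simp
  finally have "(norm (\<beta> x))\<^sup>2 \<le> (norm x)\<^sup>2"
    by (simp add: cstar_identity)
  then show ?thesis
    by (rule power2_le_imp_le) simp
qed

locale cstar_automorphism =
  fixes \<beta> :: "'b::unital_cstar \<Rightarrow> 'b"
  assumes automorphism: "star_automorphism \<beta>"
begin

abbreviation it :: "int \<Rightarrow> 'b \<Rightarrow> 'b"
  where "it \<equiv> int_iterate \<beta>"

lemma star_automorphism_it: "star_automorphism (it n)"
proof -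
  have *: "star_automorphism (\<alpha> ^^ k)" if "star_automorphism \<alpha>" for \<alpha> :: "'b \<Rightarrow> 'b" and k
  proof (induction k)
    case 0
    show ?case by (simp add: star_automorphism_id id_def)
  next
    case (Suc k)
    then show ?case
      using star_automorphism_comp [OF that Suc] by (simp add: o_def)
  qed
  show ?thesis
    by (simp add: int_iterate_def * automorphism star_automorphism_inv)
qed

lemma it_simps:
  "it n (x + y) = it n x + it n y" "it n (scaleC c x) = scaleC c (it n x)"
  "it n (x * y) = it n x * it n y" "it n (star x) = star (it n x)"
  using star_automorphism_it [of n] by (simp_all add: star_automorphism_def)

lemma it_0_right [simp]: "it n 0 = 0"
  using it_simps(1) [of n 0 0] by simp

lemma norm_it_le: "norm (it n x) \<le> norm x"
  by (rule star_automorphism_norm_le [OF star_automorphism_it])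

lemma it_0 [simp]: "it 0 x = x"
  by (simp add: int_iterate_def)

lemma it_Suc: "it (n + 1) x = \<beta> (it n x)"
proof (cases "n \<ge> 0")
  case True
  then have "nat (n + 1) = Suc (nat n)" by simp
  then show ?thesis
    using True by (simp add: int_iterate_def)
next
  case False
  then have "nat (- n) = Suc (nat (- (n + 1)))" by simp
  moreover have "\<beta> (inv_into UNIV \<beta> y) = y" for y
    using automorphism by (simp add: star_automorphism_def bij_is_surj surj_f_inv_f)
  ultimately show ?thesis
    using False by (auto simp: int_iterate_def)
qed

lemma it_pred: "it (n - 1) x = inv_into UNIV \<beta> (it n x)"
  using it_Suc [of "n - 1" x] automorphism by (simp add: star_automorphism_def bij_is_inj)

lemma it_add: "it (m + n) x = it m (it n x)"
proof (induction m rule: int_induct [of _ 0])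
  case (step1 i)
  have "it (i + 1 + n) x = \<beta> (it (i + n) x)"
    using it_Suc [of "i + n" x] by (simp add: add_ac)
  then show ?case
    using step1 by (simp add: it_Suc)
next
  case (step2 i)
  have "it (i - 1 + n) x = inv_into UNIV \<beta> (it (i + n) x)"
    using it_pred [of "i + n" x] by (simp add: algebra_simps)
  then show ?case
    using step2 by (simp add: it_pred)
qed simp

lemma it_image:
  assumes "\<beta> ` V = V" "x \<in> V"
  shows "it n x \<in> V"
proof (induction n rule: int_induct [of _ 0])
  case (step1 i)
  then show ?case
    using assms by (auto simp: it_Suc)
next
  case (step2 i)
  then obtain y where "y \<in> V" "it i x = \<beta> y"
    using assms by blast
  then show ?case
    using automorphism by (simp add: it_pred star_automorphism_def bij_is_inj)
qed (use assms in simp)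

section \<open>The crossed product\<close>

definition mult_coord :: "'b \<Rightarrow> 'b l2 \<Rightarrow> 'b l2"
  where "mult_coord b f = Abs_l2 (\<lambda>m. it (- m) b * coord f m)"

lemma coord_mult_coord: "coord (mult_coord b f) = (\<lambda>m. it (- m) b * coord f m)"
  unfolding mult_coord_def by (intro Abs_l2_inverse l2Z_mult [OF coord_in, of _ "norm b"] norm_it_le)

definition M :: "'b \<Rightarrow> 'b adjop"
  where "M b = to_adjop (mult_coord b)"

definition shift_coord :: "int \<Rightarrow> 'b l2 \<Rightarrow> 'b l2"
  where "shift_coord n f = Abs_l2 (\<lambda>m. coord f (m - n))"

lemma coord_shift_coord: "coord (shift_coord n f) = (\<lambda>m. coord f (m - n))"
  unfolding shift_coord_def by (intro Abs_l2_inverse l2Z_shift coord_in)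

text \<open>All integer powers of the shift are defined at once, so that
  \<open>U (m + n) = U m * U n\<close> is index arithmetic; \<open>op_fun_U\<close> relates them to
  the powers formed in the record.\<close>

definition U :: "int \<Rightarrow> 'b adjop"
  where "U n = to_adjop (shift_coord n)"

lemma ip_mult_coord: "ip (mult_coord b f) g = ip f (mult_coord (star b) g)"
  by (simp add: ip.rep_eq coord_mult_coord l2_inner_def star_mult it_simps mult.assoc)

lemma ip_shift_coord: "ip (shift_coord n f) g = ip f (shift_coord (- n) g)"
proof -
  have "bij_betw (\<lambda>m::int. m + n) UNIV UNIV"
    by (rule bij_betw_byWitness [of _ "\<lambda>m. m - n"]) auto
  from infsum_reindex_bij_betw [OF this, of "\<lambda>m. star (coord f (m - n)) * coord g m"]
  show ?thesis
    by (simp add: ip.rep_eq coord_shift_coord l2_inner_def)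
qed

lemma app_M: "app (M b) f = mult_coord b f"
  unfolding M_def by (rule app_to_adjop) (rule ip_mult_coord)

lemma app_U: "app (U n) f = shift_coord n f"
  unfolding U_def by (rule app_to_adjop) (rule ip_shift_coord)

lemma coord_M [simp]: "coord (app (M b) f) m = it (- m) b * coord f m"
  by (simp add: app_M coord_mult_coord)

lemma coord_U [simp]: "coord (app (U n) f) m = coord f (m - n)"
  by (simp add: app_U coord_shift_coord)

lemma star_M: "star (M b) = M (star b)"
  by (rule star_adjop_unique) (simp add: app_M ip_mult_coord)

lemma star_U: "star (U n) = U (- n)"
  by (rule star_adjop_unique) (simp add: app_U ip_shift_coord)

lemma adjop_coordI: "(\<And>f m. coord (app S f) m = coord (app T f) m) \<Longrightarrow> S = T"
  by (rule adjop_eqI, rule l2_eqI)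

lemma M_add: "M (a + b) = M a + M b"
  by (rule adjop_coordI) (simp add: app_add it_simps distrib_right)

lemma M_scaleC: "M (scaleC c b) = scaleC c (M b)"
  by (rule adjop_coordI) (simp add: app_scaleC it_simps scaleC_mult_left)

lemma M_mult: "M (a * b) = M a * M b"
  by (rule adjop_coordI) (simp add: app_mult it_simps mult.assoc)

lemma M_0 [simp]: "M 0 = 0"
  by (rule adjop_coordI) (simp add: app_0)

lemma M_sum: "M (sum f A) = (\<Sum>i\<in>A. M (f i))"
  by (induction A rule: infinite_finite_induct) (auto simp: M_add)

lemma it_1 [simp]: "it n 1 = 1"
proof -
  obtain e where "it n e = 1"
    using star_automorphism_it [of n] by (metis star_automorphism_def bij_is_surj surjD)
  then show ?thesis
    using it_simps(3) [of n 1 e] by simp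
qed

lemma M_1 [simp]: "M 1 = 1"
  by (rule adjop_coordI) (simp add: app_1)

lemma U_0 [simp]: "U 0 = 1"
  by (rule adjop_coordI) (simp add: app_1)

lemma U_add: "U (m + n) = U m * U n"
  by (rule adjop_coordI) (simp add: app_mult algebra_simps)

lemma U_M: "U n * M b = M (it n b) * U n"
  by (rule adjop_coordI) (simp add: app_mult algebra_simps flip: it_add)

lemma norm_M_le: "norm (M b) \<le> norm b"
proof (rule norm_adjop_le)
  show "norm (app (M b) f) \<le> norm b * norm f" for f
    unfolding app_M norm_l2.rep_eq coord_mult_coord by (intro l2_norm_mult_le coord_in norm_it_le)
qed simp

lemma norm_U_le: "norm (U n) \<le> 1"
proof -
  have "(norm (U n))\<^sup>2 \<le> 1"
    using norm_one_le [where 'a = "'b adjop"] by (simp add: star_U flip: cstar_identity U_add)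
  then show ?thesis
    using power2_le_imp_le [of "norm (U n)" 1] by simp
qed

definition cc :: "(int \<Rightarrow> 'b) \<Rightarrow> 'b adjop"
  where "cc x = (\<Sum>n | x n \<noteq> 0. M (x n) * U n)"

lemma cc_eq_sum: "finite F \<Longrightarrow> {n. x n \<noteq> 0} \<subseteq> F \<Longrightarrow> cc x = (\<Sum>n\<in>F. M (x n) * U n)"
  unfolding cc_def by (rule sum.mono_neutral_left) auto

lemma op_fun_M: "op_fun (M b) = coeff_op \<beta> b"
  by (rule op_fun_eqI [symmetric]) (auto simp: coeff_op_def fun_eq_iff)

lemma op_fun_U: "op_fun (U n) = shift_op [^]\<^bsub>adjointable_cstar\<^esub> n"
proof -
  have "shift_op = op_fun (U 1)"
    by (rule op_fun_eqI) (auto simp: shift_op_def fun_eq_iff)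
  then have nat: "shift_op [^]\<^bsub>adjointable_cstar\<^esub> k = op_fun (U (int k))" for k :: nat
  proof (induction k)
    case (Suc k)
    have "U (int k) * U 1 = U (int (Suc k))"
      by (simp add: add.commute flip: U_add)
    then show ?case
      using Suc by (simp add: adjointable.mult_eq)
  qed (simp add: adjointable.one_eq)
  \<comment> \<open>Negative powers in the record are formed with the ring inverse, so the shift
    must be shown to be a unit before its inverse is identified.\<close>
  have inv: "inv\<^bsub>adjointable_cstar\<^esub> (op_fun (U k)) = op_fun (U (- k))" for k
  proof (rule adjointable_ring.inv_unique [OF adjointable_ring.Units_l_inv])
    show unit: "op_fun (U k) \<in> Units adjointable_cstar"
      unfolding Units_def
      by (auto simp: adjointable.mult_eq adjointable.one_eq simp flip: U_add intro!: bexI [of _ "op_fun (U (- k))"])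
    show "inv\<^bsub>adjointable_cstar\<^esub> (op_fun (U k)) \<in> carrier adjointable_cstar"
      using unit by (rule adjointable_ring.Units_inv_closed)
  qed (simp_all add: adjointable.mult_eq adjointable.one_eq flip: U_add)
  show ?thesis
    by (cases "n < 0") (simp_all add: int_pow_def2 nat inv)
qed

lemma op_fun_sum: "finite F \<Longrightarrow> (\<Oplus>\<^bsub>adjointable_cstar\<^esub> n\<in>F. op_fun (A n)) = op_fun (sum A F)"
proof (induction F rule: finite_induct)
  case (insert n F)
  then show ?case
    by (subst adjointable_ring.finsum_insert) (auto simp: adjointable.add_eq carrier_adjointable_cstar)
qed (simp add: adjointable.zero_eq)

lemma cc_elem_eq: "x \<in> finsupp V \<Longrightarrow> cc_elem \<beta> x = op_fun (cc x)"
  by (simp add: cc_elem_def cc_def finsupp_def adjointable.mult_eq op_fun_sum flip: op_fun_M op_fun_U)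

end

section \<open>Existence of states\<close>

text \<open>Homogeneity is required only as an inequality for r > 0, a form that passes to infima;
  equality for all r \<ge> 0 is recovered in \<open>sublinear_scaleR\<close> by rescaling
  back.\<close>

definition sublinear :: "('a::real_vector \<Rightarrow> real) \<Rightarrow> bool"
  where "sublinear q \<longleftrightarrow> (\<forall>x y. q (x + y) \<le> q x + q y) \<and> (\<forall>r>0. \<forall>x. q (r *\<^sub>R x) \<le> r * q x)"

lemma sublinear_add: "sublinear q \<Longrightarrow> q (x + y) \<le> q x + q y"
  by (simp add: sublinear_def)

lemma sublinear_scaleR:
  assumes "sublinear q" "r \<ge> 0"
  shows "q (r *\<^sub>R x) = r * q x"
proof (cases "r = 0")
  case True
  have "q (2 *\<^sub>R 0) \<le> 2 * q 0" "q ((1/2) *\<^sub>R 0) \<le> (1/2) * q 0"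
    using assms unfolding sublinear_def by (simp_all only: zero_less_numeral zero_less_divide_1_iff)
  then show ?thesis
    using True by simp
next
  case False
  then have r: "r > 0"
    using assms by simp
  have "q ((1 / r) *\<^sub>R (r *\<^sub>R x)) \<le> (1 / r) * q (r *\<^sub>R x)"
    using assms r unfolding sublinear_def by (metis zero_less_divide_1_iff)
  then have "r * q x \<le> q (r *\<^sub>R x)"
    using r by (simp add: field_simps)
  moreover have "q (r *\<^sub>R x) \<le> r * q x"
    using assms r by (simp add: sublinear_def)
  ultimately show ?thesis by simp
qed

lemma sublinear_minus: "sublinear q \<Longrightarrow> - q (- x) \<le> q x"
  using sublinear_add [of q x "- x"] sublinear_scaleR [of q 0 0] by simp

text \<open>\<open>tilt q v\<close> is again a sublinear minorant of \<open>q\<close>, so a minimal sublinear functional equals all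
  its tilts and is therefore linear.  This gives Hahn-Banach without extending functionals from
  subspaces.\<close>

definition tilt :: "('a::real_vector \<Rightarrow> real) \<Rightarrow> 'a \<Rightarrow> 'a \<Rightarrow> real"
  where "tilt q v x = (INF t\<in>{0..}. q (x + t *\<^sub>R v) - t * q v)"

context
  fixes q :: "'a::real_vector \<Rightarrow> real"
  assumes q: "sublinear q"
begin

lemma tilt_bdd: "bdd_below ((\<lambda>t. q (x + t *\<^sub>R v) - t * q v) ` {0..})"
proof (rule bdd_belowI2)
  fix t :: real assume "t \<in> {0..}"
  then show "- q (- x) \<le> q (x + t *\<^sub>R v) - t * q v"
    using sublinear_add [OF q, of "x + t *\<^sub>R v" "- x"] sublinear_scaleR [OF q, of t v] by simp
qed

lemma tilt_le_at: "t \<ge> 0 \<Longrightarrow> tilt q v x \<le> q (x + t *\<^sub>R v) - t * q v"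
  unfolding tilt_def by (rule cINF_lower [OF tilt_bdd]) simp

lemma tilt_greatest: "(\<And>t. t \<ge> 0 \<Longrightarrow> c \<le> q (x + t *\<^sub>R v) - t * q v) \<Longrightarrow> c \<le> tilt q v x"
  unfolding tilt_def by (rule cINF_greatest) auto

lemma tilt_le: "tilt q v x \<le> q x"
  using tilt_le_at [of 0] by simp

lemma tilt_minus_le: "tilt q v (- v) \<le> - q v"
  using tilt_le_at [of 1 v "- v"] sublinear_scaleR [OF q, of 0 0] by simp

lemma sublinear_tilt: "sublinear (tilt q v)"
  unfolding sublinear_def
proof (intro conjI allI impI)
  fix x y
  have "tilt q v (x + y) - (q (y + t *\<^sub>R v) - t * q v) \<le> q (x + s *\<^sub>R v) - s * q v" if "s \<ge> 0" "t \<ge> 0" for s t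
    using tilt_le_at [of "s + t" v "x + y"] that sublinear_add [OF q, of "x + s *\<^sub>R v" "y + t *\<^sub>R v"]
    by (simp add: algebra_simps)
  then have "tilt q v (x + y) - (q (y + t *\<^sub>R v) - t * q v) \<le> tilt q v x" if "t \<ge> 0" for t
    using that by (intro tilt_greatest)
  then have "tilt q v (x + y) - tilt q v x \<le> q (y + t *\<^sub>R v) - t * q v" if "t \<ge> 0" for t
    using that by (simp add: algebra_simps)
  then have "tilt q v (x + y) - tilt q v x \<le> tilt q v y"
    by (rule tilt_greatest)
  then show "tilt q v (x + y) \<le> tilt q v x + tilt q v y"
    by simp
next
  fix r :: real and x assume r: "r > 0"
  have "tilt q v (r *\<^sub>R x) / r \<le> q (x + t *\<^sub>R v) - t * q v" if "t \<ge> 0" for t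
  proof -
    have "q (r *\<^sub>R (x + t *\<^sub>R v)) = r * q (x + t *\<^sub>R v)"
      using r by (intro sublinear_scaleR q) simp
    then show ?thesis
      using tilt_le_at [of "r * t" v "r *\<^sub>R x"] r that by (simp add: scaleR_add_right field_simps)
  qed
  then have "tilt q v (r *\<^sub>R x) / r \<le> tilt q v x"
    by (rule tilt_greatest)
  then show "tilt q v (r *\<^sub>R x) \<le> r * tilt q v x"
    using r by (simp add: field_simps)
qed

end

lemma hahn_banach:
  fixes p :: "'a::real_vector \<Rightarrow> real"
  assumes p: "sublinear p"
  obtains f where "linear f" "\<And>x. f x \<le> p x"
proof -
  define A where "A = {q. sublinear q \<and> q \<le> p}"
  \<comment> \<open>Zorn's lemma is applied to the reversed order, so that its maximal element is a
    minimal sublinear functional below p.\<close>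
  have "\<exists>m\<in>A. \<forall>a\<in>A. (\<lambda>a b. b \<le> a) m a \<longrightarrow> a = m"
  proof (rule predicate_Zorn)
    show "partial_order_on A (relation_of (\<lambda>a b. b \<le> a) A)"
      by (auto simp: partial_order_on_def preorder_on_def refl_on_def trans_def antisym_def relation_of_def)
  next
    fix C assume C: "C \<in> Chains (relation_of (\<lambda>a b. b \<le> a) A)"
    then have CA: "q \<in> A" if "q \<in> C" for q
      using that by (auto simp: Chains_def relation_of_def)
    have chain: "a \<le> b \<or> b \<le> a" if "a \<in> C" "b \<in> C" for a b
      using C that by (auto simp: Chains_def relation_of_def)
    show "\<exists>u\<in>A. \<forall>a\<in>C. u \<le> a"
    proof (cases "C = {}")
      case True
      then show ?thesis
        using p by (auto simp: A_def)
    next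
      case False
      \<comment> \<open>The pointwise infimum of the chain is finite because each member lies above
        -p(-x). Subadditivity uses the chain property: of two members, the smaller one serves for
        both arguments.\<close>
      define u where "u x = (INF q\<in>C. q x)" for x
      have bdd: "bdd_below ((\<lambda>q. q x) ` C)" for x
      proof (rule bdd_belowI2)
        fix q assume "q \<in> C"
        then have "sublinear q" "q (- x) \<le> p (- x)"
          using CA by (auto simp: A_def le_fun_def)
        then show "- p (- x) \<le> q x"
          using sublinear_minus [of q x] by linarith
      qed
      have le: "u x \<le> q x" if "q \<in> C" for q x
        unfolding u_def by (rule cINF_lower [OF bdd that])
      have greatest: "c \<le> u x" if "\<And>q. q \<in> C \<Longrightarrow> c \<le> q x" for c x
        unfolding u_def using that by (intro cINF_greatest False)
      have "sublinear u"
        unfolding sublinear_def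
      proof (intro conjI allI impI)
        fix x y
        have "u (x + y) - b y \<le> a x" if ab: "a \<in> C" "b \<in> C" for a b
        proof -
          obtain d where d: "d \<in> C" "d \<le> a" "d \<le> b"
            using chain [OF ab] ab by blast
          then have "u (x + y) \<le> d x + d y"
            using le [OF d(1), of "x + y"] sublinear_add [of d x y] CA by (fastforce simp: A_def)
          then show ?thesis
            using d le_funD [of d a x] le_funD [of d b y] by linarith
        qed
        then have "u (x + y) - b y \<le> u x" if "b \<in> C" for b
          using that by (intro greatest)
        then have "u (x + y) - u x \<le> b y" if "b \<in> C" for b
          using that by (simp add: algebra_simps)
        then have "u (x + y) - u x \<le> u y"
          by (rule greatest)
        then show "u (x + y) \<le> u x + u y" by simp
      next
        fix r :: real and x assume r: "r > 0"
        have "u (r *\<^sub>R x) / r \<le> q x" if "q \<in> C" for q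
        proof -
          have "q (r *\<^sub>R x) \<le> r * q x"
            using CA [OF that] r by (simp add: A_def sublinear_def)
          then show ?thesis
            using le [OF that, of "r *\<^sub>R x"] r by (simp add: field_simps)
        qed
        then have "u (r *\<^sub>R x) / r \<le> u x"
          by (rule greatest)
        then show "u (r *\<^sub>R x) \<le> r * u x"
          using r by (simp add: field_simps)
      qed
      moreover have "u \<le> p"
      proof (rule le_funI)
        fix x
        obtain q where "q \<in> C"
          using False by blast
        then show "u x \<le> p x"
          using le [of q x] CA [of q] by (auto simp: A_def le_fun_def intro: order.trans)
      qed
      ultimately show ?thesis
        using le by (auto simp: A_def le_fun_def)
    qed
  qed
  then obtain m where m: "sublinear m" "m \<le> p" and min: "\<And>a. sublinear a \<Longrightarrow> a \<le> m \<Longrightarrow> a = m"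
    unfolding A_def by (metis (mono_tags, lifting) mem_Collect_eq order.trans)
  \<comment> \<open>By minimality. The parameter t = 1 then turns \<open>tilt_le_at\<close> into m x
    + m v \<le> m (x + v), the half of additivity that sublinearity does not give.\<close>
  have "tilt m v = m" for v
    using m by (intro min sublinear_tilt) (auto simp: le_fun_def tilt_le)
  then have "m x \<le> m (x + v) - m v" for x v
    using tilt_le_at [OF m(1), of 1 v x] by simp
  then have add: "m (x + v) = m x + m v" for x v
    using sublinear_add [OF m(1), of x v] by (simp add: algebra_simps antisym)
  have m0: "m 0 = 0"
    using sublinear_scaleR [OF m(1), of 0 0] by simp
  have minus: "m (- x) = - m x" for x
    using add [of x "- x"] m0 by simp
  have "m (r *\<^sub>R x) = r * m x" for r x
  proof (cases "r \<ge> 0")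
    case False
    then have "m (r *\<^sub>R x) = - m ((- r) *\<^sub>R x)"
      by (simp flip: minus)
    then show ?thesis
      using False sublinear_scaleR [OF m(1), of "- r" x] by simp
  qed (simp add: sublinear_scaleR m)
  then have "linear m"
    by (intro linearI) (auto simp: add)
  then show ?thesis
    using m(2) that by (auto simp: le_fun_def)
qed

text \<open>A linear f below the tilt satisfies f (-v) \<le> -p v, hence f v \<ge> p v, and it still
  lies below p.\<close>

lemma hahn_banach_attain:
  assumes p: "sublinear p"
  obtains f where "linear f" "\<And>x. f x \<le> p x" "f v = p v"
proof -
  obtain f where f: "linear f" "\<And>x. f x \<le> tilt p v x"
    using hahn_banach [OF sublinear_tilt [OF p]] by metis
  have le: "f x \<le> p x" for x
    using f(2) tilt_le [OF p] order.trans by blast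
  have "f (- v) \<le> - p v"
    using f(2) [of "- v"] tilt_minus_le [OF p, of v] by linarith
  then have "f v = p v"
    using le [of v] linear_neg [OF f(1), of v] by simp
  then show ?thesis
    using f le that by blast
qed

section \<open>Norming states\<close>

definition re_part :: "'a::unital_cstar \<Rightarrow> 'a" where "re_part x = (1/2) *\<^sub>R (x + star x)"
definition im_part :: "'a::unital_cstar \<Rightarrow> 'a" where "im_part x = (- (1/2)) *\<^sub>R scaleC \<i> (x - star x)"

lemma selfadj_parts [simp]: "selfadj (re_part x)" "selfadj (im_part x)"
  unfolding re_part_def im_part_def by (intro selfadj_scaleR selfadj_imaginary selfadj_simps)+

lemma re_im_decomp: "x = re_part x + scaleC \<i> (im_part x)"
proof -
  have "re_part x + scaleC \<i> (im_part x) = (1/2) *\<^sub>R (x + star x) + (1/2) *\<^sub>R (x - star x)"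
    by (simp add: re_part_def im_part_def scaleC_scaleR scaleC_scaleC scaleC_minus_right scaleR_diff_right)
  then show ?thesis
    unfolding scaleR_add_right [symmetric] by simp
qed

lemma scaleC_decomp: "scaleC c x = Re c *\<^sub>R x + Im c *\<^sub>R scaleC \<i> x"
proof -
  have "c = of_real (Re c) + of_real (Im c) * \<i>"
    by (simp add: complex_eq_iff)
  then have "scaleC c x = scaleC (of_real (Re c)) x + scaleC (of_real (Im c)) (scaleC \<i> x)"
    by (metis scaleC_add_left scaleC_scaleC)
  then show ?thesis
    by (simp add: scaleC_of_real)
qed

text \<open>For self-adjoint k, \<open>tilt norm 1 k\<close> is the infimum of norm (k + t 1) - t
  over t \<ge> 0, which is the largest spectral value of k. If it were below norm h for both h and
  -h, then -r \<le> h \<le> r for some r < norm h. A linear minorant attaining it at h or -h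
  satisfies f \<le> norm and f 1 = 1, which makes f positive.\<close>

lemma state_exists:
  fixes h :: "'b::unital_cstar"
  assumes h: "selfadj h" "h \<noteq> 0"
  obtains \<psi> where "\<psi> \<in> state_space type_cstar" "cmod (\<psi> h) = norm h"
proof -
  have "(1::'b) \<noteq> 0"
    using h(2) mult_1_right [of h] by (metis mult_zero_right)
  then have n1: "norm (1::'b) = 1"
    using cstar_identity [of "1::'b"] by (simp add: power2_eq_square)
  have subn: "sublinear (norm :: 'b \<Rightarrow> real)"
    by (simp add: sublinear_def norm_triangle_ineq)
  define p where "p = tilt norm (1::'b)"
  have p: "sublinear p"
    unfolding p_def by (rule sublinear_tilt [OF subn])
  have "norm h \<le> p h \<or> norm h \<le> p (- h)"
  proof (rule ccontr)
    assume *: "\<not> (norm h \<le> p h \<or> norm h \<le> p (- h))"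
    have "\<exists>s\<ge>0. norm (k + s *\<^sub>R 1) - s < norm h" if "p k < norm h" for k
      using tilt_greatest [OF subn, of "norm h" k 1] that n1 unfolding p_def by force
    then obtain s t where s: "s \<ge> 0" "norm (h + s *\<^sub>R 1) - s < norm h"
      and t: "t \<ge> 0" "norm (- h + t *\<^sub>R 1) - t < norm h"
      using * by (meson not_le)
    define r where "r = max 0 (max (norm (h + s *\<^sub>R 1) - s) (norm (- h + t *\<^sub>R 1) - t))"
    have r: "r \<ge> 0" "r < norm h" "norm (h + s *\<^sub>R 1) \<le> r + s" "norm (- h + t *\<^sub>R 1) \<le> r + t"
      using s t h(2) by (auto simp: r_def)
    have "pos ((r + s) *\<^sub>R 1 - (h + s *\<^sub>R 1))" "pos ((r + t) *\<^sub>R 1 - (- h + t *\<^sub>R 1))"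
      using r h by (auto intro!: pos_norm_diff selfadj_add selfadj_diff selfadj_scaleR)
    then have "norm h \<le> r"
      using h r by (intro norm_le_of_pos) (simp_all add: algebra_simps)
    with r show False by simp
  qed
  then obtain k where k: "k = h \<or> k = - h" "norm h \<le> p k"
    by blast
  obtain f where f: "linear f" "\<And>x. f x \<le> p x" "f k = p k"
    using hahn_banach_attain [OF p] by metis
  have fn: "f x \<le> norm x" for x
    using f(2) [of x] tilt_le [OF subn, of 1 x] by (simp add: p_def)
  have "f (- 1) \<le> - 1"
    using f(2) [of "- 1"] tilt_minus_le [OF subn, of 1] n1 by (simp add: p_def)
  then have f1: "f 1 = 1"
    using fn [of 1] n1 linear_neg [OF f(1), of 1] by simp
  have fpos: "f a \<ge> 0" if a: "pos a" for a
  proof -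
    obtain t where "norm (t *\<^sub>R 1 - a) \<le> t"
      using a by (auto simp: pos_def)
    then show ?thesis
      using fn [of "t *\<^sub>R 1 - a"] f1 by (simp add: linear_diff [OF f(1)] linear_scale [OF f(1)])
  qed
  \<comment> \<open>f is only real linear on the whole algebra; its restriction to self-adjoint
    elements is extended complex linearly, so that values at self-adjoint elements are real.\<close>
  define \<psi> where "\<psi> x = Complex (f (re_part x)) (f (im_part x))" for x
  have lin: "\<psi> (x + y) = \<psi> x + \<psi> y" "\<psi> (r *\<^sub>R x) = of_real r * \<psi> x" for x y r
    by (simp_all add: \<psi>_def re_part_def im_part_def star_add star_scaleR scaleC_add_right scaleC_diff_right
        scaleC_scaleR linear_add [OF f(1)] linear_diff [OF f(1)] linear_scale [OF f(1)] complex_eq_iff algebra_simps)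
  have i: "\<psi> (scaleC \<i> x) = \<i> * \<psi> x" for x
  proof -
    have "re_part (scaleC \<i> x) = - im_part x" "im_part (scaleC \<i> x) = re_part x"
      by (simp_all add: re_part_def im_part_def star_scaleC scaleC_minus_left scaleC_diff_right scaleC_add_right
          scaleC_scaleC scaleR_diff_right scaleR_add_right)
    then show ?thesis
      by (simp add: \<psi>_def complex_eq_iff linear_neg [OF f(1)])
  qed
  have scal: "\<psi> (scaleC c x) = c * \<psi> x" for c x
  proof -
    have "\<psi> (scaleC c x) = (of_real (Re c) + of_real (Im c) * \<i>) * \<psi> x"
      unfolding scaleC_decomp [of c x] lin i by (simp add: algebra_simps)
    also have "of_real (Re c) + of_real (Im c) * \<i> = c"
      by (simp add: complex_eq_iff)
    finally show ?thesis .
  qed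
  have sa: "\<psi> a = of_real (f a)" if "selfadj a" for a
  proof -
    have "star a = a"
      using that by (simp add: selfadj_def)
    then have "re_part a = a" "im_part a = 0"
      by (simp_all add: re_part_def im_part_def)
    then show ?thesis
      by (simp add: \<psi>_def complex_eq_iff linear_0 [OF f(1)])
  qed
  have "\<psi> (star x * x) \<in> \<real>\<^sub>\<ge>\<^sub>0" for x
    using fpos [OF pos_star_mult [of x]] sa [of "star x * x"] by simp
  then have state: "\<psi> \<in> state_space type_cstar"
    using lin scal sa [of 1] f1 by (simp add: state_space_def)
  have "norm h \<le> f k" "f k \<le> norm k"
    using k(2) f(3) fn [of k] by simp_all
  moreover have nk: "norm k = norm h"
    using k(1) by auto
  ultimately have "\<bar>f k\<bar> = norm h"
    using norm_ge_zero [of h] by linarith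
  then have "\<bar>f h\<bar> = norm h"
    using k(1) linear_neg [OF f(1), of h] by auto
  then have "cmod (\<psi> h) = norm h"
    by (simp add: sa h(1))
  with state show ?thesis
    by (rule that)
qed

interpretation type_cstar: cstar_embedding "\<lambda>x. x" UNIV "type_cstar :: 'b::unital_cstar cstar"
  by unfold_locales simp_all

text \<open>States are real on self-adjoint elements, so they map the real and imaginary parts of b
  to those of their value at b. Each part has norm at most C by \<open>state_exists\<close>, and
  adding the two costs the factor 2.\<close>

lemma norm_le_states:
  fixes b :: "'b::unital_cstar"
  assumes C: "C \<ge> 0" "\<And>\<psi>. \<psi> \<in> state_space type_cstar \<Longrightarrow> cmod (\<psi> b) \<le> C"
  shows "norm b \<le> 2 * C"
proof -
  have le: "norm a \<le> C"
    if a: "selfadj a" and le: "\<And>\<psi>. \<psi> \<in> state_space type_cstar \<Longrightarrow> cmod (\<psi> a) \<le> cmod (\<psi> b)" for a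
  proof (cases "a = 0")
    case False
    then obtain \<psi> where "\<psi> \<in> state_space type_cstar" "cmod (\<psi> a) = norm a"
      using state_exists [OF a] by blast
    then show ?thesis
      using le [of \<psi>] C(2) [of \<psi>] by simp
  qed (simp add: C)
  have parts: "Re (\<psi> b) = Re (\<psi> (re_part b))" "Im (\<psi> b) = Re (\<psi> (im_part b))"
    "\<psi> (re_part b) \<in> \<real>" "\<psi> (im_part b) \<in> \<real>" if "\<psi> \<in> state_space type_cstar" for \<psi>
  proof -
    show r: "\<psi> (re_part b) \<in> \<real>" "\<psi> (im_part b) \<in> \<real>"
      using type_cstar.state_selfadj(1) [OF that] by auto
    have "\<psi> b = \<psi> (re_part b) + \<i> * \<psi> (im_part b)"
      using type_cstar.state_add [OF that, of "re_part b" "scaleC \<i> (im_part b)"]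
        type_cstar.state_scaleC [OF that, of "im_part b" \<i>] by (simp flip: re_im_decomp)
    then show "Re (\<psi> b) = Re (\<psi> (re_part b))" "Im (\<psi> b) = Re (\<psi> (im_part b))"
      using r by (simp_all add: complex_is_Real_iff)
  qed
  have "norm (re_part b) \<le> C"
  proof (rule le)
    fix \<psi> :: "'b \<Rightarrow> complex" assume "\<psi> \<in> state_space type_cstar"
    from parts [OF this] show "cmod (\<psi> (re_part b)) \<le> cmod (\<psi> b)"
      using abs_Re_le_cmod [of "\<psi> b"] by (simp add: in_Reals_norm)
  qed simp
  moreover have "norm (im_part b) \<le> C"
  proof (rule le)
    fix \<psi> :: "'b \<Rightarrow> complex" assume "\<psi> \<in> state_space type_cstar"
    from parts [OF this] show "cmod (\<psi> (im_part b)) \<le> cmod (\<psi> b)"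
      using abs_Im_le_cmod [of "\<psi> b"] by (simp add: in_Reals_norm)
  qed simp
  moreover have "norm b \<le> norm (re_part b) + norm (im_part b)"
    using norm_triangle_ineq [of "re_part b" "scaleC \<i> (im_part b)"] by (simp add: norm_scaleC flip: re_im_decomp)
  ultimately show ?thesis by linarith
qed

text \<open>Banach-Alaoglu: states are bounded by the norm, so they form a closed subset of a
  product of closed discs, which is compact by Tychonoff's theorem.\<close>

lemma compact_state_space: "compact_space (weak_star_topology (type_cstar :: 'b::unital_cstar cstar))"
proof -
  let ?S = "state_space (type_cstar :: 'b cstar)"
  let ?P = "PiE UNIV (\<lambda>x. cball 0 (norm x)) :: ('b \<Rightarrow> complex) set"
  have "compactin (product_topology (\<lambda>_. euclidean) UNIV) ?P"
    by (simp add: compactin_PiE)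
  then have "compact ?P"
    by (simp add: euclidean_product_topology)
  moreover have "closed ?S"
    unfolding state_space_def
    by (simp add: complex_nonneg_Reals_iff)
      (intro closed_Collect_conj closed_Collect_all closed_Collect_eq closed_Collect_le continuous_intros
        continuous_on_product_coordinates)
  ultimately have "compact (?P \<inter> ?S)"
    by (rule compact_Int_closed)
  moreover have "?P \<inter> ?S = ?S"
    using type_cstar.state_le_norm by (auto simp: PiE_def)
  ultimately show ?thesis
    by (simp add: weak_star_topology_def euclidean_product_topology compact_space_subtopology)
qed

section \<open>Rieffel's criterion\<close>

text \<open>The data that B and the crossed product share from the outset. Density, invariance under
  the adjoint and finite nets are added in \<open>lip_net\<close>; for B, finiteness of the distance
  and its topology are known instead.\<close>

locale lip_seminorm = cstar_embedding \<phi> S R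
  for \<phi> :: "'a::unital_cstar \<Rightarrow> 'c" and S :: "'a set" and R :: "('c, 'm) cstar_scheme" (structure) +
  fixes W :: "'a set" and L :: "'c \<Rightarrow> real"
  assumes W_sub: "W \<subseteq> S"
    and W_one: "1 \<in> W"
    and W_add: "\<And>x y. x \<in> W \<Longrightarrow> y \<in> W \<Longrightarrow> x + y \<in> W"
    and W_scaleC: "\<And>c x. x \<in> W \<Longrightarrow> scaleC c x \<in> W"
    and L_nonneg: "\<And>x. x \<in> W \<Longrightarrow> 0 \<le> L (\<phi> x)"
    and L_triangle: "\<And>x y. x \<in> W \<Longrightarrow> y \<in> W \<Longrightarrow> L (\<phi> (x + y)) \<le> L (\<phi> x) + L (\<phi> y)"
    and L_scaleC: "\<And>c x. x \<in> W \<Longrightarrow> L (\<phi> (scaleC c x)) = cmod c * L (\<phi> x)"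
    and L_one: "L (\<phi> 1) = 0"
begin

abbreviation d :: "('c \<Rightarrow> complex) \<Rightarrow> ('c \<Rightarrow> complex) \<Rightarrow> real"
  where "d \<mu> \<nu> \<equiv> enn2real (state_dist (\<phi> ` W) L \<mu> \<nu>)"

lemma in_S: "x \<in> W \<Longrightarrow> x \<in> S"
  using W_sub by blast

lemma state_dist_le:
  assumes "\<And>x. x \<in> W \<Longrightarrow> L (\<phi> x) \<le> 1 \<Longrightarrow> cmod (\<mu> (\<phi> x) - \<nu> (\<phi> x)) \<le> b"
  shows "state_dist (\<phi> ` W) L \<mu> \<nu> \<le> ennreal b"
  unfolding state_dist_def using assms by (intro SUP_least) (auto intro!: ennreal_leI)

lemma d_le:
  assumes "b \<ge> 0" "\<And>x. x \<in> W \<Longrightarrow> L (\<phi> x) \<le> 1 \<Longrightarrow> cmod (\<mu> (\<phi> x) - \<nu> (\<phi> x)) \<le> b"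
  shows "d \<mu> \<nu> \<le> b"
proof -
  have "state_dist (\<phi> ` W) L \<mu> \<nu> \<le> ennreal b"
    using assms(2) by (rule state_dist_le)
  from enn2real_mono [OF this] show ?thesis
    using assms(1) by simp
qed

text \<open>The supremum runs over L \<le> 1 only, so x is rescaled by t with t L(x) \<le> 1. If
  L(x) = 0, every t is allowed, and the difference must vanish because the distance is
  finite.\<close>

lemma le_d:
  assumes fin: "state_dist (\<phi> ` W) L \<mu> \<nu> < \<infinity>" and \<mu>: "\<mu> \<in> state_space R" and \<nu>: "\<nu> \<in> state_space R"
    and x: "x \<in> W"
  shows "cmod (\<mu> (\<phi> x) - \<nu> (\<phi> x)) \<le> d \<mu> \<nu> * L (\<phi> x)"
proof -
  have unit: "cmod (\<mu> (\<phi> y) - \<nu> (\<phi> y)) \<le> d \<mu> \<nu>" if "y \<in> W" "L (\<phi> y) \<le> 1" for y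
  proof -
    have "ennreal (cmod (\<mu> (\<phi> y) - \<nu> (\<phi> y))) \<le> state_dist (\<phi> ` W) L \<mu> \<nu>"
      unfolding state_dist_def using that by (intro SUP_upper) auto
    from enn2real_mono [OF this] fin show ?thesis
      by (simp add: top.not_eq_extremum)
  qed
  have scaled: "t * cmod (\<mu> (\<phi> x) - \<nu> (\<phi> x)) \<le> d \<mu> \<nu>" if "t \<ge> 0" "t * L (\<phi> x) \<le> 1" for t
  proof -
    have "\<mu> (\<phi> (scaleC t x)) - \<nu> (\<phi> (scaleC t x)) = t * (\<mu> (\<phi> x) - \<nu> (\<phi> x))"
      by (simp add: state_scaleC \<mu> \<nu> in_S x right_diff_distrib)
    moreover have "cmod (\<mu> (\<phi> (scaleC t x)) - \<nu> (\<phi> (scaleC t x))) \<le> d \<mu> \<nu>"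
      using that x by (intro unit) (simp_all add: W_scaleC L_scaleC)
    ultimately show ?thesis
      using that by (simp add: norm_mult)
  qed
  show ?thesis
  proof (cases "L (\<phi> x) = 0")
    case True
    have "cmod (\<mu> (\<phi> x) - \<nu> (\<phi> x)) \<le> 0"
    proof (rule ccontr)
      assume "\<not> cmod (\<mu> (\<phi> x) - \<nu> (\<phi> x)) \<le> 0"
      then show False
        using scaled [of "(d \<mu> \<nu> + 1) / cmod (\<mu> (\<phi> x) - \<nu> (\<phi> x))"] True by simp
    qed
    then show ?thesis
      by (simp add: True)
  next
    case False
    then have "L (\<phi> x) > 0"
      using L_nonneg [OF x] by simp
    then show ?thesis
      using scaled [of "1 / L (\<phi> x)"] by (simp add: field_simps)
  qed
qed

lemma d_commute: "d \<mu> \<nu> = d \<nu> \<mu>"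
  by (simp add: state_dist_def norm_minus_commute)

end

text \<open>The last assumption is total boundedness of the Lipschitz ball modulo constants. The
  centres may lie anywhere in S, since only the values of states at them are used.\<close>

locale lip_net = lip_seminorm \<phi> S R W L
  for \<phi> :: "'a::unital_cstar \<Rightarrow> 'c" and S :: "'a set" and R :: "('c, 'm) cstar_scheme" (structure)
    and W :: "'a set" and L :: "'c \<Rightarrow> real" +
  assumes W_star: "\<And>x. x \<in> W \<Longrightarrow> star x \<in> W"
    and L_star: "\<And>x. x \<in> W \<Longrightarrow> L (\<phi> (star x)) = L (\<phi> x)"
    and W_dense: "S \<subseteq> closure W"
    and net: "\<And>e. e > 0 \<Longrightarrow> \<exists>K\<subseteq>S. finite K \<and> (\<forall>x\<in>W. L (\<phi> x) \<le> 1 \<longrightarrow> (\<exists>k\<in>K. \<exists>c. norm (x - k - scaleC c 1) \<le> e))"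
begin

abbreviation st :: "('c \<Rightarrow> complex) set" where "st \<equiv> state_space R"

text \<open>Two states agree on constants, so c drops out of the difference; the remainder
  contributes once for each state, hence the 2.\<close>

lemma state_diff_le:
  assumes "\<mu> \<in> st" "\<nu> \<in> st" "x \<in> S" "k \<in> S"
  shows "cmod (\<mu> (\<phi> x) - \<nu> (\<phi> x)) \<le> cmod (\<mu> (\<phi> k) - \<nu> (\<phi> k)) + 2 * norm (x - k - scaleC c 1)"
proof -
  define y where "y = x - k - scaleC c 1"
  have y: "y \<in> S"
    using assms by (simp add: y_def diff_in scaleC_in)
  have "x = k + scaleC c 1 + y"
    by (simp add: y_def)
  then have *: "\<psi> (\<phi> x) = \<psi> (\<phi> k) + c + \<psi> (\<phi> y)" if "\<psi> \<in> st" for \<psi>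
    using that assms y by (simp add: state_add state_scaleC state_one add_in scaleC_in)
  then have "\<mu> (\<phi> x) - \<nu> (\<phi> x) = (\<mu> (\<phi> k) - \<nu> (\<phi> k)) + (\<mu> (\<phi> y) - \<nu> (\<phi> y))"
    by (simp add: * [OF assms(1)] * [OF assms(2)])
  moreover have "cmod (\<mu> (\<phi> y) - \<nu> (\<phi> y)) \<le> 2 * norm y"
    using norm_triangle_ineq4 [of "\<mu> (\<phi> y)" "\<nu> (\<phi> y)"] state_le_norm [OF assms(1) y] state_le_norm [OF assms(2) y]
    by simp
  ultimately show ?thesis
    using norm_triangle_ineq [of "\<mu> (\<phi> k) - \<nu> (\<phi> k)" "\<mu> (\<phi> y) - \<nu> (\<phi> y)"]
    by (simp add: y_def)
qed

lemma state_dist_finite: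
  assumes "\<mu> \<in> st" "\<nu> \<in> st"
  shows "state_dist (\<phi> ` W) L \<mu> \<nu> < \<infinity>"
proof -
  obtain K where K: "K \<subseteq> S" "finite K"
    and net1: "\<And>x. x \<in> W \<Longrightarrow> L (\<phi> x) \<le> 1 \<Longrightarrow> \<exists>k\<in>K. \<exists>c. norm (x - k - scaleC c 1) \<le> 1"
    using net [of 1] by auto
  have "state_dist (\<phi> ` W) L \<mu> \<nu> \<le> ennreal ((\<Sum>k\<in>K. cmod (\<mu> (\<phi> k) - \<nu> (\<phi> k))) + 2)"
  proof (rule state_dist_le)
    fix x assume x: "x \<in> W" "L (\<phi> x) \<le> 1"
    then obtain k c where k: "k \<in> K" "norm (x - k - scaleC c 1) \<le> 1"
      using net1 by blast
    have "cmod (\<mu> (\<phi> k) - \<nu> (\<phi> k)) \<le> (\<Sum>k\<in>K. cmod (\<mu> (\<phi> k) - \<nu> (\<phi> k)))"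
      using k K by (intro member_le_sum) auto
    then show "cmod (\<mu> (\<phi> x) - \<nu> (\<phi> x)) \<le> (\<Sum>k\<in>K. cmod (\<mu> (\<phi> k) - \<nu> (\<phi> k))) + 2"
      using state_diff_le [OF assms in_S [OF x(1)], of k c] k K by auto
  qed
  then show ?thesis
    using ennreal_less_top le_less_trans by (metis infinity_ennreal_def)
qed

lemmas le_dist = le_d [OF state_dist_finite]

lemma dense:
  assumes "x \<in> S" "e > 0"
  obtains w where "w \<in> W" "norm (x - w) < e"
  using assms W_dense unfolding closure_approachable subset_iff by (metis dist_norm norm_minus_commute closure_approachable)

lemma state_eqI:
  assumes "\<mu> \<in> st" "\<nu> \<in> st" "d \<mu> \<nu> = 0"
  shows "\<mu> = \<nu>"
proof (rule extensionalityI [of _ "carrier R"])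
  show "\<mu> \<in> extensional (carrier R)" "\<nu> \<in> extensional (carrier R)"
    using assms by (auto simp: state_space_def)
  fix a assume "a \<in> carrier R"
  then obtain x where x: "x \<in> S" "a = \<phi> x"
    by (auto simp: carrier_eq)
  have "cmod (\<mu> (\<phi> x) - \<nu> (\<phi> x)) \<le> e" if e: "e > 0" for e
  proof -
    obtain w where w: "w \<in> W" "norm (x - w) < e / 2"
      using dense [OF x(1), of "e / 2"] e by auto
    have "cmod (\<mu> (\<phi> w) - \<nu> (\<phi> w)) \<le> 0"
      using le_dist [OF assms(1,2) assms(1,2) w(1)] assms(3) by simp
    then show ?thesis
      using state_diff_le [OF assms(1,2) x(1) in_S [OF w(1)], of 0] w by simp
  qed
  then have "cmod (\<mu> (\<phi> x) - \<nu> (\<phi> x)) \<le> 0"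
    by (rule field_le_epsilon) simp
  then show "\<mu> a = \<nu> a"
    by (simp add: x)
qed

lemma state_metric: "Metric_space st d"
proof
  show "0 \<le> d \<mu> \<nu>" "d \<mu> \<nu> = d \<nu> \<mu>" for \<mu> \<nu>
    by (simp_all add: d_commute)
  show "d \<mu> \<nu> = 0 \<longleftrightarrow> \<mu> = \<nu>" if \<mu>\<nu>: "\<mu> \<in> st" "\<nu> \<in> st" for \<mu> \<nu>
  proof
    assume "\<mu> = \<nu>"
    then have "d \<mu> \<nu> \<le> 0"
      by (intro d_le) auto
    then show "d \<mu> \<nu> = 0"
      using enn2real_nonneg antisym by blast
  qed (rule state_eqI [OF \<mu>\<nu>])
  show "d \<mu> \<nu> \<le> d \<mu> \<kappa> + d \<kappa> \<nu>" if st: "\<mu> \<in> st" "\<kappa> \<in> st" "\<nu> \<in> st" for \<mu> \<kappa> \<nu>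
  proof (rule d_le)
    fix x assume x: "x \<in> W" "L (\<phi> x) \<le> 1"
    have le: "cmod (\<alpha> (\<phi> x) - \<gamma> (\<phi> x)) \<le> d \<alpha> \<gamma>" if "\<alpha> \<in> st" "\<gamma> \<in> st" for \<alpha> \<gamma>
      using le_dist [OF that that x(1)] mult_left_mono [OF x(2), of "d \<alpha> \<gamma>"] by simp
    show "cmod (\<mu> (\<phi> x) - \<nu> (\<phi> x)) \<le> d \<mu> \<kappa> + d \<kappa> \<nu>"
      using norm_triangle_ineq [of "\<mu> (\<phi> x) - \<kappa> (\<phi> x)" "\<kappa> (\<phi> x) - \<nu> (\<phi> x)"] le [OF st(1,2)] le [OF st(2,3)] by simp
  qed simp
qed

interpretation sm: Metric_space st d
  by (rule state_metric)

lemma openin_weak_star: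
  assumes "openin sm.mtopology X"
  shows "openin (weak_star_topology R) X"
proof (subst openin_subopen, intro ballI)
  fix \<mu> assume "\<mu> \<in> X"
  then have \<mu>: "\<mu> \<in> st" and "\<exists>r>0. sm.mball \<mu> r \<subseteq> X"
    using assms unfolding sm.openin_mtopology by blast+
  then obtain r where r: "r > 0" "sm.mball \<mu> r \<subseteq> X"
    by blast
  \<comment> \<open>The error of the net counts twice, so r/6 becomes r/3; with another r/3 allowed
    at the centres, the total 2 r/3 stays strictly inside the ball.\<close>
  obtain K where K: "K \<subseteq> S" "finite K"
    and net1: "\<And>x. x \<in> W \<Longrightarrow> L (\<phi> x) \<le> 1 \<Longrightarrow> \<exists>k\<in>K. \<exists>c. norm (x - k - scaleC c 1) \<le> r / 6"
    using net [of "r / 6"] r by auto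
  define T where "T = PiE (carrier R) (\<lambda>a. if a \<in> \<phi> ` K then ball (\<mu> a) (r / 3) else UNIV)"
  have "openin (product_topology (\<lambda>_. euclidean) (carrier R)) T"
    unfolding T_def
  proof (rule product_topology_basis)
    have "{a. (if a \<in> \<phi> ` K then ball (\<mu> a) (r / 3) else UNIV) \<noteq> topspace euclidean} \<subseteq> \<phi> ` K"
      by auto
    then show "finite {a. (if a \<in> \<phi> ` K then ball (\<mu> a) (r / 3) else UNIV) \<noteq> topspace euclidean}"
      using K by (meson finite_imageI finite_subset)
  qed auto
  then have "openin (weak_star_topology R) (T \<inter> st)"
    unfolding weak_star_topology_def openin_subtopology by blast
  moreover have "\<mu> \<in> T"
    using \<mu> r by (auto simp: T_def state_space_def PiE_def)
  moreover have "T \<inter> st \<subseteq> X"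
  proof
    fix \<nu> assume \<nu>: "\<nu> \<in> T \<inter> st"
    have "d \<mu> \<nu> \<le> 2 * r / 3"
    proof (rule d_le)
      fix x assume x: "x \<in> W" "L (\<phi> x) \<le> 1"
      then obtain k c where k: "k \<in> K" "norm (x - k - scaleC c 1) \<le> r / 6"
        using net1 by blast
      have "\<phi> k \<in> carrier R"
        using k K by auto
      then have "\<nu> (\<phi> k) \<in> ball (\<mu> (\<phi> k)) (r / 3)"
        using \<nu> k unfolding T_def by (auto dest: PiE_mem)
      then have "cmod (\<mu> (\<phi> k) - \<nu> (\<phi> k)) \<le> r / 3"
        by (simp add: dist_norm)
      then show "cmod (\<mu> (\<phi> x) - \<nu> (\<phi> x)) \<le> 2 * r / 3"
        using state_diff_le [OF \<mu> _ in_S [OF x(1)], of \<nu> k c] \<nu> k K by auto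
    qed (use r in simp)
    then show "\<nu> \<in> X"
      using r \<nu> \<mu> by (auto intro!: subsetD [OF r(2)])
  qed
  ultimately show "\<exists>T. openin (weak_star_topology R) T \<and> \<mu> \<in> T \<and> T \<subseteq> X"
    using \<mu> by (intro exI [of _ "T \<inter> st"]) auto
qed

lemma openin_mtopology_weak_star:
  assumes "openin (weak_star_topology R) X"
  shows "openin sm.mtopology X"
  unfolding sm.openin_mtopology
proof (intro conjI allI impI)
  obtain T where T: "openin (product_topology (\<lambda>_. euclidean) (carrier R)) T" "X = T \<inter> st"
    using assms unfolding weak_star_topology_def openin_subtopology by auto
  then show "X \<subseteq> st" by blast
  fix \<mu> assume "\<mu> \<in> X"
  then have \<mu>: "\<mu> \<in> T" "\<mu> \<in> st"
    using T by auto
  obtain Y where Y: "\<mu> \<in> PiE (carrier R) Y" "\<And>a. open (Y a)" "finite {a. Y a \<noteq> UNIV}" "PiE (carrier R) Y \<subseteq> T"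
    using product_topology_open_contains_basis [OF T(1) \<mu>(1)] by auto
  have "\<exists>r>0. \<forall>\<nu>\<in>st. d \<mu> \<nu> < r \<longrightarrow> \<nu> a \<in> Y a" if a: "a \<in> carrier R" for a
  proof -
    obtain x where x: "x \<in> S" "a = \<phi> x"
      using a by (auto simp: carrier_eq)
    have "\<mu> a \<in> Y a"
      using Y(1) a by (auto dest: PiE_mem)
    then obtain e where e: "e > 0" "ball (\<mu> a) e \<subseteq> Y a"
      using Y(2) [of a] open_contains_ball by blast
    obtain w where w: "w \<in> W" "norm (x - w) < e / 4"
      using dense [OF x(1), of "e / 4"] e by auto
    \<comment> \<open>At distance below r the states differ by at most e/2 at w; the added 1 keeps
      the quotient meaningful if L(w) = 0. Passing from x to w costs less than twice e/4.\<close>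
    define r where "r = e / (2 * (L (\<phi> w) + 1))"
    have Lw: "L (\<phi> w) \<ge> 0"
      using w L_nonneg by blast
    then have r: "r > 0"
      using e by (simp add: r_def)
    have "\<nu> a \<in> Y a" if \<nu>: "\<nu> \<in> st" "d \<mu> \<nu> < r" for \<nu>
    proof -
      have "cmod (\<mu> (\<phi> w) - \<nu> (\<phi> w)) \<le> d \<mu> \<nu> * L (\<phi> w)"
        by (rule le_dist) (use \<mu> \<nu> w in auto)
      also have "\<dots> \<le> r * (L (\<phi> w) + 1)"
        using \<nu> Lw r by (intro mult_mono) auto
      also have "\<dots> = e / 2"
        using Lw by (simp add: r_def field_simps)
      finally have "cmod (\<mu> (\<phi> x) - \<nu> (\<phi> x)) < e"
        using state_diff_le [OF \<mu>(2) \<nu>(1) x(1) in_S [OF w(1)], of 0] w by simp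
      then show ?thesis
        using x by (intro subsetD [OF e(2)]) (simp add: dist_norm)
    qed
    with r show ?thesis by blast
  qed
  then obtain r where r: "\<And>a. a \<in> carrier R \<Longrightarrow> r a > 0"
    "\<And>a \<nu>. a \<in> carrier R \<Longrightarrow> \<nu> \<in> st \<Longrightarrow> d \<mu> \<nu> < r a \<Longrightarrow> \<nu> a \<in> Y a"
    by metis
  define J where "J = {a. Y a \<noteq> UNIV} \<inter> carrier R"
  define s where "s = Min (insert 1 (r ` J))"
  have J: "finite J"
    using Y(3) by (simp add: J_def)
  have "s > 0"
    using J r(1) by (auto simp: s_def J_def)
  moreover have "sm.mball \<mu> s \<subseteq> X"
  proof
    fix \<nu> assume "\<nu> \<in> sm.mball \<mu> s"
    then have \<nu>: "\<nu> \<in> st" "d \<mu> \<nu> < s"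
      by auto
    have "\<nu> a \<in> Y a" if a: "a \<in> carrier R" for a
    proof (cases "Y a = UNIV")
      case False
      then have "s \<le> r a"
        using a J by (auto simp: s_def J_def)
      then show ?thesis
        using r(2) [OF a \<nu>(1)] \<nu>(2) by simp
    qed simp
    then have "\<nu> \<in> PiE (carrier R) Y"
      using \<nu> by (auto simp: state_space_def PiE_def)
    then show "\<nu> \<in> X"
      using Y(4) T(2) \<nu> by auto
  qed
  ultimately show "\<exists>r>0. sm.mball \<mu> r \<subseteq> X" by blast
qed

theorem compact_quantum_metric_space: "compact_quantum_metric_space R (\<phi> ` W) L"
proof (intro compact_quantum_metric_space.intro compact_quantum_metric_space_axioms.intro)
  show "unital_cstar_algebra R"
    by (rule unital_cstar_algebra)
  show "norm_topology R closure_of (\<phi> ` W) = carrier R"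
    using closure_of_eq [OF W_sub] W_dense closure_minimal [OF W_sub closed] by (auto simp: carrier_eq)
  show "Metric_space.mtopology st d = weak_star_topology R"
    using openin_weak_star openin_mtopology_weak_star by (auto simp: topology_eq)
qed (use W_sub in \<open>auto simp: one_eq add_eq scal_eq adj_eq in_S W_one W_add W_scaleC W_star L_nonneg L_triangle
      L_scaleC L_one L_star state_metric state_dist_finite [unfolded infinity_ennreal_def]\<close>)

end

section \<open>Lipschitz balls of a compact quantum metric space\<close>

context
  fixes V :: "'b::unital_cstar set" and L :: "'b \<Rightarrow> real"
  assumes cqms: "compact_quantum_metric_space type_cstar V L"
begin

interpretation compact_quantum_metric_space "type_cstar :: 'b cstar" V L
  by (rule cqms)

interpretation V: lip_seminorm "\<lambda>x. x" UNIV "type_cstar :: 'b cstar" V L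
  using V_one V_add V_scal L_nonneg L_triangle L_scal L_one by unfold_locales auto

interpretation st: Metric_space "state_space (type_cstar :: 'b cstar)" V.d
  using state_dist_metric by simp

lemma lip_state_diff:
  "\<lbrakk>\<mu> \<in> state_space type_cstar; \<nu> \<in> state_space type_cstar; x \<in> V\<rbrakk> \<Longrightarrow> cmod (\<mu> x - \<nu> x) \<le> V.d \<mu> \<nu> * L x"
  using V.le_d [of \<mu> \<nu> x] state_dist_finite [of \<mu> \<nu>] by simp

text \<open>The metric induces the weak *-topology, in which the state space is compact, and compact
  metric spaces are totally bounded.\<close>

lemma state_net:
  assumes "e > 0"
  obtains K where "finite K" "K \<subseteq> state_space type_cstar"
    "\<And>\<nu>. \<nu> \<in> state_space type_cstar \<Longrightarrow> \<exists>\<mu>\<in>K. V.d \<mu> \<nu> < e"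
proof -
  have "compactin st.mtopology (state_space type_cstar)"
    using compact_state_space [where 'b = 'b] state_dist_topology
    by (simp add: compact_space_def weak_star_topology_def)
  then have "st.mtotally_bounded (state_space type_cstar)"
    by (rule st.compactin_imp_mtotally_bounded)
  from this [unfolded st.mtotally_bounded_def, rule_format, OF assms]
  obtain K where K: "finite K" "K \<subseteq> state_space type_cstar"
    "state_space type_cstar \<subseteq> (\<Union>x\<in>K. st.mball x e)"
    by (elim exE conjE) (rule that)
  have "\<exists>\<mu>\<in>K. V.d \<mu> \<nu> < e" if "\<nu> \<in> state_space type_cstar" for \<nu>
  proof -
    have "\<nu> \<in> (\<Union>x\<in>K. st.mball x e)"
      using K(3) that by (rule subsetD)
    then obtain \<mu> where "\<mu> \<in> K" "\<nu> \<in> st.mball \<mu> e"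
      by (rule UN_E)
    then show ?thesis
      unfolding st.in_mball by blast
  qed
  with K show ?thesis
    by (intro that [of K])
qed

text \<open>The distances from a fixed state \<mu>0 are bounded by some D. Subtracting the constant
  \<mu>0(x) from x leaves an element on which every state has modulus at most D, and states
  determine the norm up to the factor 2.\<close>

lemma lip_bounded_mod_constants:
  obtains D where "D \<ge> 0" "\<And>x. x \<in> V \<Longrightarrow> L x \<le> 1 \<Longrightarrow> \<exists>c. norm (x - scaleC c 1) \<le> D"
proof -
  obtain K where K: "finite K" "K \<subseteq> state_space type_cstar"
    "\<And>\<nu>. \<nu> \<in> state_space type_cstar \<Longrightarrow> \<exists>\<mu>\<in>K. V.d \<mu> \<nu> < 1"
    using state_net [of 1] by auto
  show ?thesis
  proof (cases "state_space (type_cstar :: 'b cstar) = {}")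
    \<comment> \<open>Without states there is no base point, but then the algebra is zero by
      \<open>norm_le_states\<close>.\<close>
    case True
    then have "norm x \<le> 2 * 0" for x :: 'b
      by (intro norm_le_states) auto
    then show ?thesis
      by (intro that [of 0]) auto
  next
    case False
    then obtain \<mu>\<^sub>0 where \<mu>0: "\<mu>\<^sub>0 \<in> state_space (type_cstar :: 'b cstar)" by blast
    define D where "D = (\<Sum>\<mu>\<in>K. V.d \<mu>\<^sub>0 \<mu>) + 1"
    have D0: "D \<ge> 0"
      unfolding D_def by (intro add_nonneg_nonneg sum_nonneg) auto
    have D: "V.d \<mu>\<^sub>0 \<nu> \<le> D" if "\<nu> \<in> state_space type_cstar" for \<nu>
    proof -
      obtain \<mu> where \<mu>: "\<mu> \<in> K" "V.d \<mu> \<nu> < 1"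
        using K(3) \<open>\<nu> \<in> state_space type_cstar\<close> by blast
      have "V.d \<mu>\<^sub>0 \<mu> \<le> (\<Sum>\<mu>\<in>K. V.d \<mu>\<^sub>0 \<mu>)"
        using \<mu> K by (intro member_le_sum) auto
      moreover have "V.d \<mu>\<^sub>0 \<nu> \<le> V.d \<mu>\<^sub>0 \<mu> + V.d \<mu> \<nu>"
        using \<mu> K \<mu>0 that by (intro st.triangle) auto
      ultimately show ?thesis
        using \<mu> by (simp add: D_def)
    qed
    have "norm (x - scaleC (\<mu>\<^sub>0 x) 1) \<le> 2 * D" if x: "x \<in> V" "L x \<le> 1" for x
    proof (rule norm_le_states [OF D0])
      fix \<psi> :: "'b \<Rightarrow> complex" assume \<psi>: "\<psi> \<in> state_space type_cstar"
      have "\<psi> (x - scaleC (\<mu>\<^sub>0 x) 1) = \<psi> x - \<mu>\<^sub>0 x"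
        using type_cstar.state_diff [OF \<psi>] type_cstar.state_scaleC [OF \<psi>] type_cstar.state_one [OF \<psi>] by simp
      moreover have "cmod (\<mu>\<^sub>0 x - \<psi> x) \<le> D * 1"
        using lip_state_diff [OF \<mu>0 \<psi> x(1)] mult_mono [OF D [OF \<psi>] x(2) D0 L_nonneg [OF x(1)]] by linarith
      ultimately show "cmod (\<psi> (x - scaleC (\<mu>\<^sub>0 x) 1)) \<le> D"
        by (simp add: norm_minus_commute)
    qed
    then show ?thesis
      using D0 by (intro that [of "2 * D"]) auto
  qed
qed

text \<open>Arzela-Ascoli: elements of the ball are viewed as functions on the totally bounded state
  space, with common Lipschitz constant C. Their values on a finite net of states, rounded to
  finitely many complex numbers, determine them up to e.\<close>

lemma lip_totally_bounded:
  assumes e: "e > 0" and C: "C \<ge> 0"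
  obtains K where "finite K" "\<And>x. x \<in> V \<Longrightarrow> L x \<le> C \<Longrightarrow> norm x \<le> r \<Longrightarrow> \<exists>k\<in>K. norm (x - k) \<le> e"
proof -
  \<comment> \<open>Moving from a state to a nearby point of the net changes the values at x and k
    by at most e/8 each, and rounding costs e/16 twice. The total 3 e/8 is below e/2, which
    \<open>norm_le_states\<close> doubles.\<close>
  define \<delta> where "\<delta> = e / (8 * (C + 1))"
  have \<delta>: "\<delta> > 0" "\<delta> * C \<le> e / 8"
    using e C by (simp_all add: \<delta>_def field_simps)
  obtain N where N: "finite N" "N \<subseteq> state_space (type_cstar :: 'b cstar)"
    "\<And>\<nu>. \<nu> \<in> state_space type_cstar \<Longrightarrow> \<exists>\<mu>\<in>N. V.d \<mu> \<nu> < \<delta>"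
    using state_net [OF \<delta>(1)] by metis
  obtain T :: "complex set" where T: "finite T" "cball 0 r \<subseteq> (\<Union>t\<in>T. ball t (e / 16))"
    using compact_cball [of "0::complex" r] e unfolding compact_eq_totally_bounded
    by (metis zero_less_divide_iff zero_less_numeral)
  define X where "X = {x \<in> V. L x \<le> C \<and> norm x \<le> r}"
  define good where "good g x \<longleftrightarrow> x \<in> X \<and> (\<forall>\<mu>\<in>N. cmod (\<mu> x - g \<mu>) < e / 16)" for g x
  \<comment> \<open>One representative for each pattern g of rounded values. A pattern that no
    element realises contributes an arbitrary value, which does no harm to a finite net.\<close>
  define K where "K = (\<lambda>g. SOME x. good g x) ` PiE N (\<lambda>_. T)"
  have "finite K"
    unfolding K_def using N T by (intro finite_imageI finite_PiE)
  moreover have "\<exists>k\<in>K. norm (x - k) \<le> e" if x: "x \<in> V" "L x \<le> C" "norm x \<le> r" for x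
  proof -
    have "\<exists>t\<in>T. cmod (\<mu> x - t) < e / 16" if "\<mu> \<in> N" for \<mu>
    proof -
      have "cmod (\<mu> x) \<le> r"
        using type_cstar.state_le_norm [of \<mu> x] x that N by auto
      then have "\<mu> x \<in> (\<Union>t\<in>T. ball t (e / 16))"
        by (intro subsetD [OF T(2)]) simp
      then show ?thesis
        by (auto simp: dist_norm norm_minus_commute)
    qed
    then obtain g0 where g0: "\<And>\<mu>. \<mu> \<in> N \<Longrightarrow> g0 \<mu> \<in> T \<and> cmod (\<mu> x - g0 \<mu>) < e / 16"
      by metis
    define g where "g = restrict g0 N"
    have g: "g \<in> PiE N (\<lambda>_. T)" "good g x"
      using g0 x by (auto simp: g_def good_def X_def)
    define k where "k = (SOME y. good g y)"
    have k: "good g k"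
      unfolding k_def using g(2) by (rule someI)
    have "k \<in> K"
      using g(1) by (auto simp: K_def k_def)
    moreover have "norm (x - k) \<le> 2 * (e / 2)"
    proof (rule norm_le_states)
      fix \<nu> :: "'b \<Rightarrow> complex" assume \<nu>: "\<nu> \<in> state_space type_cstar"
      obtain \<mu> where \<mu>: "\<mu> \<in> N" "V.d \<mu> \<nu> < \<delta>"
        using N(3) \<nu> by blast
      have near: "cmod (\<mu> y - \<nu> y) \<le> e / 8" if "y \<in> X" for y
      proof -
        have "cmod (\<mu> y - \<nu> y) \<le> V.d \<mu> \<nu> * L y"
          using lip_state_diff \<mu> N \<nu> that by (auto simp: X_def)
        also have "\<dots> \<le> \<delta> * C"
          using \<mu> that L_nonneg \<delta> by (intro mult_mono) (auto simp: X_def)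
        finally show ?thesis
          using \<delta> by simp
      qed
      have kX: "k \<in> X" "x \<in> X" "cmod (\<mu> k - g \<mu>) < e / 16" "cmod (\<mu> x - g \<mu>) < e / 16"
        using k g(2) \<mu> by (auto simp: good_def)
      have "\<nu> (x - k) = - (\<mu> x - \<nu> x) + (\<mu> x - g \<mu>) - (\<mu> k - g \<mu>) + (\<mu> k - \<nu> k)"
        using type_cstar.state_diff [OF \<nu>, of x k] by simp
      also have "cmod \<dots> \<le> cmod (\<mu> x - \<nu> x) + cmod (\<mu> x - g \<mu>) + cmod (\<mu> k - g \<mu>) + cmod (\<mu> k - \<nu> k)"
        by (intro order.trans [OF norm_triangle_ineq] order.trans [OF norm_triangle_ineq4] add_mono order.refl)
          (simp_all add: norm_minus_commute)
      also have "\<dots> \<le> e / 2"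
        using near [OF kX(1)] near [OF kX(2)] kX(3,4) e by simp
      finally show "cmod (\<nu> (x - k)) \<le> e / 2" .
    qed (use e in simp)
    ultimately show ?thesis
      by (intro bexI [of _ k]) auto
  qed
  ultimately show ?thesis
    by (rule that)
qed

end

section \<open>The crossed product as a \<open>C\<^sup>*\<close>-algebra\<close>

lemma app_sum: "app (sum A F) f = (\<Sum>i\<in>F. app (A i) f)"
  by (induction F rule: infinite_finite_induct) (simp_all add: app_0 app_add)

lemma finsuppI: "finite F \<Longrightarrow> (\<And>n. x n \<in> V) \<Longrightarrow> (\<And>n. n \<notin> F \<Longrightarrow> x n = 0) \<Longrightarrow> x \<in> finsupp V"
  unfolding finsupp_def by (auto intro: finite_subset [of _ F])

lemma finsuppD: "x \<in> finsupp V \<Longrightarrow> x n \<in> V" "x \<in> finsupp V \<Longrightarrow> finite {n. x n \<noteq> 0}"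
  by (auto simp: finsupp_def)

lemma finsupp_UNIV: "x \<in> finsupp V \<Longrightarrow> x \<in> finsupp UNIV"
  by (simp add: finsupp_def)

text \<open>The vector e_0 \<otimes> 1. A finitely supported operator applied to it has the twisted
  coefficients \<open>it (- m) (x m)\<close> as coordinates, which makes the coefficients unique and
  bounds them by the operator norm.\<close>

definition unit_vector :: "'b::unital_cstar l2"
  where "unit_vector = Abs_l2 (\<lambda>n. if n = 0 then 1 else 0)"

lemma coord_unit_vector: "coord (unit_vector :: 'b::unital_cstar l2) = (\<lambda>n. if n = 0 then 1 else 0)"
proof -
  let ?e = "\<lambda>n::int. if n = 0 then 1 else 0 :: 'b"
  have "part_norm G ?e = 0" if "G \<inter> {0} = {}" for G
  proof -
    have "(\<Sum>n\<in>G. star (?e n) * ?e n) = 0"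
      using that by (intro sum.neutral) auto
    then show ?thesis
      by (simp only: part_norm_def norm_zero real_sqrt_zero)
  qed
  then have "?e \<in> l2Z"
    unfolding l2Z_iff tail_small_def by (metis finite.emptyI finite_insert)
  then show ?thesis
    unfolding unit_vector_def by (rule Abs_l2_inverse)
qed

lemma norm_unit_vector: "norm (unit_vector :: 'b::unital_cstar l2) \<le> 1"
proof (rule norm_l2_le)
  fix G :: "int set" assume G: "finite G"
  have "part_norm G (coord (unit_vector :: 'b l2)) \<le> part_norm (insert 0 G) (coord (unit_vector :: 'b l2))"
    using G by (intro part_norm_mono) auto
  also have "(\<Sum>n\<in>insert 0 G. star (coord (unit_vector :: 'b l2) n) * coord unit_vector n)
      = (\<Sum>n\<in>{0}. star (coord (unit_vector :: 'b l2) n) * coord unit_vector n)"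
    using G by (intro sum.mono_neutral_right) (auto simp: coord_unit_vector)
  then have "part_norm (insert 0 G) (coord (unit_vector :: 'b l2)) = part_norm {0} (coord (unit_vector :: 'b l2))"
    by (simp only: part_norm_def)
  also have "\<dots> \<le> 1"
    by (simp add: coord_unit_vector norm_one_le)
  finally show "part_norm G (coord (unit_vector :: 'b l2)) \<le> 1" .
qed

lemma norm_app_unit_vector_le: "norm (app T unit_vector) \<le> norm T" for T :: "'b::unital_cstar adjop"
  using norm_app_le [of T unit_vector] mult_left_mono [OF norm_unit_vector [where 'b = 'b] norm_ge_zero [of T]] by linarith

context cstar_automorphism
begin

lemma cc_add:
  assumes "x \<in> finsupp V" "y \<in> finsupp V"
  shows "cc (\<lambda>n. x n + y n) = cc x + cc y"
proof -
  let ?F = "{n. x n \<noteq> 0} \<union> {n. y n \<noteq> 0}"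
  have F: "finite ?F"
    using assms by (simp add: finsupp_def)
  show ?thesis
    by (subst (1 2 3) cc_eq_sum [OF F]) (auto simp: M_add distrib_right sum.distrib)
qed

lemma cc_scaleC:
  assumes "x \<in> finsupp V"
  shows "cc (\<lambda>n. scaleC c (x n)) = scaleC c (cc x)"
proof -
  have F: "finite {n. x n \<noteq> 0}"
    using assms by (simp add: finsupp_def)
  show ?thesis
    by (subst (1 2) cc_eq_sum [OF F]) (auto simp: M_scaleC scaleC_sum_right scaleC_mult_left)
qed

lemma cc_sum_finsupp:
  assumes "finite F"
  shows "cc (\<lambda>n. if n \<in> F then b n else 0) = (\<Sum>n\<in>F. M (b n) * U n)"
  using assms by (subst cc_eq_sum [of F]) auto

lemma cc_one: "cc (\<lambda>n. if n = 0 then 1 else 0) = 1"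
  using cc_sum_finsupp [of "{0}" "\<lambda>_. 1"] by simp

definition cstar_adj :: "(int \<Rightarrow> 'b) \<Rightarrow> int \<Rightarrow> 'b"
  where "cstar_adj x n = it n (star (x (- n)))"

lemma cstar_adj_finsupp:
  assumes "x \<in> finsupp V" "\<And>n v. v \<in> V \<Longrightarrow> it n (star v) \<in> V"
  shows "cstar_adj x \<in> finsupp V"
proof (rule finsuppI)
  show "finite (uminus ` {n. x n \<noteq> 0})"
    using assms by (simp add: finsupp_def)
  show "cstar_adj x n \<in> V" for n
    using assms(2) finsuppD(1) [OF assms(1)] by (simp add: cstar_adj_def)
  show "cstar_adj x n = 0" if "n \<notin> uminus ` {n. x n \<noteq> 0}" for n
  proof -
    have "x (- n) = 0"
      using that by (metis (mono_tags, lifting) image_eqI mem_Collect_eq minus_minus)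
    then show ?thesis
      by (simp add: cstar_adj_def)
  qed
qed

lemma cc_cstar_adj:
  assumes "x \<in> finsupp V"
  shows "cc (cstar_adj x) = star (cc x)"
proof -
  let ?F = "{n. x n \<noteq> 0}"
  have F: "finite ?F"
    using assms by (simp add: finsupp_def)
  have sub: "{n. cstar_adj x n \<noteq> 0} \<subseteq> uminus ` ?F"
  proof
    fix n assume "n \<in> {n. cstar_adj x n \<noteq> 0}"
    then have "x (- n) \<noteq> 0"
      by (auto simp: cstar_adj_def)
    then show "n \<in> uminus ` ?F"
      by (metis (mono_tags, lifting) image_eqI mem_Collect_eq minus_minus)
  qed
  have "cc (cstar_adj x) = (\<Sum>n\<in>uminus ` ?F. M (cstar_adj x n) * U n)"
    using F sub by (intro cc_eq_sum) auto
  also have "\<dots> = (\<Sum>n\<in>?F. M (it (- n) (star (x n))) * U (- n))"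
    by (subst sum.reindex) (auto simp: cstar_adj_def)
  also have "\<dots> = (\<Sum>n\<in>?F. star (M (x n) * U n))"
    by (intro sum.cong refl) (simp add: star_mult star_M star_U U_M)
  finally show ?thesis
    by (simp add: cc_def star_sum)
qed

lemma coord_cc_unit_vector:
  assumes "x \<in> finsupp V"
  shows "coord (app (cc x) unit_vector) m = it (- m) (x m)"
proof -
  have F: "finite (insert m {n. x n \<noteq> 0})"
    using assms by (simp add: finsupp_def)
  have "coord (app (cc x) unit_vector) m
      = (\<Sum>n\<in>insert m {n. x n \<noteq> 0}. it (- m) (x n) * (if m - n = 0 then 1 else 0))"
    by (subst cc_eq_sum [OF F]) (auto simp: app_sum coord_sum app_mult coord_unit_vector)
  also have "\<dots> = (\<Sum>n\<in>insert m {n. x n \<noteq> 0}. if n = m then it (- m) (x m) else 0)"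
    by (intro sum.cong) auto
  finally show ?thesis
    using F by simp
qed

lemma inj_on_cc: "inj_on cc (finsupp V)"
proof (rule inj_onI)
  fix x y assume xy: "x \<in> finsupp V" "y \<in> finsupp V" "cc x = cc y"
  have "x m = y m" for m
  proof -
    have "it (- m) (x m) = it (- m) (y m)"
      using coord_cc_unit_vector [OF xy(1), of m] coord_cc_unit_vector [OF xy(2), of m] xy(3) by simp
    then have "it (m + - m) (x m) = it (m + - m) (y m)"
      by (simp only: it_add)
    then show ?thesis by simp
  qed
  then show "x = y" by blast
qed

lemma norm_coeff_le:
  assumes "x \<in> finsupp V"
  shows "norm (x n) \<le> norm (cc x)"
proof -
  have "norm (x n) = norm (it (n + - n) (x n))"
    by simp
  also have "\<dots> \<le> norm (it (- n) (x n))"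
    by (simp only: it_add norm_it_le)
  also have "\<dots> \<le> norm (app (cc x) unit_vector)"
    using norm_coord_le [of "app (cc x) unit_vector" n] by (simp add: coord_cc_unit_vector [OF assms])
  also have "\<dots> \<le> norm (cc x)"
    by (rule norm_app_unit_vector_le)
  finally show ?thesis .
qed

text \<open>The conditional expectation of \<open>x x\<^sup>*\<close> onto the coefficient algebra is \<open>\<Sum>n. x(n) x(n)\<^sup>*\<close>.\<close>

lemma norm_row_le:
  assumes x: "x \<in> finsupp UNIV" and F: "finite F"
  shows "norm (\<Sum>n\<in>F. x n * star (x n)) \<le> (norm (cc x))\<^sup>2"
proof -
  have adj: "cstar_adj x \<in> finsupp UNIV"
    by (rule cstar_adj_finsupp [OF x]) simp
  \<comment> \<open>The adjoint is applied because its coefficients carry exactly the automorphisms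
    that the coordinates undo; what remains are the adjoints of the coefficients of x, with reversed
    index.\<close>
  have "coord (app (star (cc x)) unit_vector) = (\<lambda>m. star (x (- m)))"
  proof
    fix m
    show "coord (app (star (cc x)) unit_vector) m = star (x (- m))"
      using it_add [of "- m" m "star (x (- m))"]
      by (simp add: coord_cc_unit_vector [OF adj] cstar_adj_def flip: cc_cstar_adj [OF x])
  qed
  then have "part_norm (uminus ` F) (\<lambda>m. star (x (- m))) \<le> norm (app (star (cc x)) unit_vector)"
    using part_norm_le_norm [of "uminus ` F" "app (star (cc x)) unit_vector"] F by simp
  also have "\<dots> \<le> norm (cc x)"
    using norm_app_unit_vector_le [of "star (cc x)"] by simp
  finally have "(part_norm (uminus ` F) (\<lambda>m. star (x (- m))))\<^sup>2 \<le> (norm (cc x))\<^sup>2"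
    by (intro power_mono) auto
  moreover have "(\<Sum>m\<in>uminus ` F. star (star (x (- m))) * star (x (- m))) = (\<Sum>n\<in>F. x n * star (x n))"
    by (subst sum.reindex) (auto simp: star_star)
  ultimately show ?thesis
    by (simp add: part_norm_power2)
qed

text \<open>Coefficients of the commutator with the number operator, the unbounded operator that
  multiplies the coordinate m by m.\<close>

definition deriv :: "(int \<Rightarrow> 'b) \<Rightarrow> int \<Rightarrow> 'b"
  where "deriv x n = scaleC (of_int n) (x n)"

lemma deriv_finsupp: "x \<in> finsupp UNIV \<Longrightarrow> deriv x \<in> finsupp UNIV"
  using finsuppI [of "{n. x n \<noteq> 0}" "deriv x" UNIV] by (simp add: deriv_def finsupp_def)

lemma norm_tail_le:
  assumes x: "x \<in> finsupp UNIV" and F: "finite F" "0 \<notin> F"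
  shows "norm (\<Sum>n\<in>F. M (x n) * U n) \<le> sqrt (\<Sum>n\<in>F. 1 / (of_int n)\<^sup>2) * norm (cc (deriv x))"
proof -
  \<comment> \<open>Each x(n) U^n is split as n x(n) times U^n / n. The first factors form the row
    of the derivation; the second are multiples of unitaries, so their squares add up to a scalar.
    Division by n is the place where 0 must be absent from F.\<close>
  let ?f = "\<lambda>n. star (M (deriv x n))"
  let ?g = "\<lambda>n. (1 / of_int n :: real) *\<^sub>R U n"
  have fg: "star (?f n) * ?g n = M (x n) * U n" if "n \<in> F" for n
  proof -
    have "scaleC (of_int n) y = (of_int n :: real) *\<^sub>R y" for y :: "'b adjop"
      by (metis scaleC_of_real of_real_of_int_eq)
    then have "M (deriv x n) = (of_int n :: real) *\<^sub>R M (x n)"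
      by (simp add: deriv_def M_scaleC)
    then show ?thesis
      using that F by (auto simp: star_star)
  qed
  have "(\<Sum>n\<in>F. star (?f n) * ?f n) = M (\<Sum>n\<in>F. deriv x n * star (deriv x n))"
    by (simp add: star_star star_M M_sum M_mult)
  then have 1: "norm (\<Sum>n\<in>F. star (?f n) * ?f n) \<le> (norm (cc (deriv x)))\<^sup>2"
    using norm_M_le norm_row_le [OF deriv_finsupp [OF x] F(1)] by (metis order.trans)
  have "(\<Sum>n\<in>F. star (?g n) * ?g n) = (\<Sum>n\<in>F. 1 / (of_int n)\<^sup>2 :: real) *\<^sub>R 1"
    by (simp add: star_scaleR star_U power2_eq_square scaleR_sum_left flip: U_add)
  then have 2: "norm (\<Sum>n\<in>F. star (?g n) * ?g n) \<le> (\<Sum>n\<in>F. 1 / (of_int n)\<^sup>2)"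
    using mult_left_le [OF norm_one_le [where 'a = "'b adjop"], of "\<Sum>n\<in>F. 1 / (of_int n)\<^sup>2 :: real"]
    by (simp add: sum_nonneg)
  have "(norm (\<Sum>n\<in>F. M (x n) * U n))\<^sup>2 = (norm (\<Sum>n\<in>F. star (?f n) * ?g n))\<^sup>2"
    by (simp only: fg cong: sum.cong)
  also have "\<dots> \<le> norm (\<Sum>n\<in>F. star (?f n) * ?f n) * norm (\<Sum>n\<in>F. star (?g n) * ?g n)"
    by (rule sum_cauchy_schwarz)
  also have "\<dots> \<le> (norm (cc (deriv x)))\<^sup>2 * (\<Sum>n\<in>F. 1 / (of_int n)\<^sup>2)"
    by (intro mult_mono 1 2) auto
  also have "\<dots> = (sqrt (\<Sum>n\<in>F. 1 / (of_int n)\<^sup>2) * norm (cc (deriv x)))\<^sup>2"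
    by (simp add: power_mult_distrib sum_nonneg mult.commute)
  finally show ?thesis
    by (rule power2_le_imp_le) (simp add: sum_nonneg)
qed

section \<open>The algebra of finitely supported elements and its closure\<close>

abbreviation alg :: "'b adjop set"
  where "alg \<equiv> cc ` finsupp UNIV"

lemma alg_add: "a \<in> alg \<Longrightarrow> b \<in> alg \<Longrightarrow> a + b \<in> alg"
proof -
  assume "a \<in> alg" "b \<in> alg"
  then obtain x y where xy: "x \<in> finsupp UNIV" "a = cc x" "y \<in> finsupp UNIV" "b = cc y" by blast
  have "(\<lambda>n. x n + y n) \<in> finsupp UNIV"
    using xy by (intro finsuppI [of "{n. x n \<noteq> 0} \<union> {n. y n \<noteq> 0}"]) (auto simp: finsupp_def)
  then show ?thesis
    using xy cc_add [OF xy(1,3)] by (metis imageI)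
qed

lemma alg_monomial: "M b * U n \<in> alg"
proof
  show "M b * U n = cc (\<lambda>m. if m \<in> {n} then b else 0)"
    by (subst cc_sum_finsupp) auto
qed (rule finsuppI [of "{n}"], auto)

lemma alg_sum: "(\<And>i. i \<in> A \<Longrightarrow> f i \<in> alg) \<Longrightarrow> sum f A \<in> alg"
proof (induction A rule: infinite_finite_induct)
  case (infinite A)
  then show ?case
    using alg_monomial [of 0 0] by simp
next
  case empty
  show ?case
    using alg_monomial [of 0 0] by simp
qed (auto intro: alg_add)

lemma alg_mult: "a \<in> alg \<Longrightarrow> b \<in> alg \<Longrightarrow> a * b \<in> alg"
proof -
  assume "a \<in> alg" "b \<in> alg"
  then obtain x y where "a = cc x" "b = cc y" by blast
  then have "a * b = (\<Sum>n | x n \<noteq> 0. \<Sum>m | y m \<noteq> 0. M (x n) * U n * (M (y m) * U m))"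
    by (simp add: cc_def sum_product)
  also have "\<dots> = (\<Sum>n | x n \<noteq> 0. \<Sum>m | y m \<noteq> 0. M (x n * it n (y m)) * U (n + m))"
  proof (intro sum.cong refl)
    fix n m
    have "M (x n) * U n * (M (y m) * U m) = M (x n) * (U n * M (y m)) * U m"
      by (simp only: mult.assoc)
    then show "M (x n) * U n * (M (y m) * U m) = M (x n * it n (y m)) * U (n + m)"
      by (simp add: U_M M_mult U_add mult.assoc)
  qed
  also have "\<dots> \<in> alg"
    by (intro alg_sum alg_monomial)
  finally show ?thesis .
qed

lemma alg_scaleC: "a \<in> alg \<Longrightarrow> scaleC c a \<in> alg"
  using alg_mult [OF alg_monomial [of "scaleC c 1" 0]] by (simp add: M_scaleC scaleC_mult_left)

lemma alg_star: "a \<in> alg \<Longrightarrow> star a \<in> alg"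
proof -
  assume "a \<in> alg"
  then obtain x where x: "x \<in> finsupp UNIV" "a = cc x" by blast
  then have "cstar_adj x \<in> finsupp UNIV"
    by (intro cstar_adj_finsupp) auto
  then show ?thesis
    using x cc_cstar_adj [OF x(1)] by (metis imageI)
qed

lemma cc_elem_image: "cc_elem \<beta> ` finsupp V = op_fun ` cc ` finsupp V"
  unfolding image_image by (intro image_cong refl) (rule cc_elem_eq)

lemma cstar_embedding_crossed_product:
  "cstar_embedding op_fun (closure alg) (reduced_crossed_product \<beta>)"
proof
  let ?R = "reduced_crossed_product \<beta>"
  show "carrier ?R = op_fun ` closure alg"
    unfolding reduced_crossed_product_def by (simp add: cc_elem_image adjointable.closure_of_eq)
  show "inj_on op_fun (closure alg)"
    using inj_op_fun by (rule inj_on_subset) simp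
  fix a b :: "'b adjop" and c
  show "\<one>\<^bsub>?R\<^esub> = op_fun 1" "\<zero>\<^bsub>?R\<^esub> = op_fun 0"
    by (simp_all add: reduced_crossed_product_def adjointable.one_eq adjointable.zero_eq)
  show "op_fun a \<otimes>\<^bsub>?R\<^esub> op_fun b = op_fun (a * b)" "op_fun a \<oplus>\<^bsub>?R\<^esub> op_fun b = op_fun (a + b)"
    "scal ?R c (op_fun a) = op_fun (scaleC c a)" "adj ?R (op_fun a) = op_fun (star a)"
    "nrm ?R (op_fun a) = norm a"
    by (simp_all add: reduced_crossed_product_def adjointable.mult_eq adjointable.add_eq adjointable.scal_eq
        adjointable.adj_eq adjointable.nrm_eq)
  show "1 \<in> closure alg"
    using alg_monomial [of 1 0] closure_subset [of alg] by auto
  show "closed (closure alg)" by simp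
  show "scaleC c a \<in> closure alg" if "a \<in> closure alg"
    using that alg_scaleC bounded_linear.tendsto [OF bounded_linear_scaleC [of c]]
    unfolding closure_sequential by (metis (no_types, lifting))
  show "star a \<in> closure alg" if "a \<in> closure alg"
    using that alg_star tendsto_star unfolding closure_sequential by (metis (no_types, lifting))
  assume "a \<in> closure alg" "b \<in> closure alg"
  then obtain u v where uv: "\<And>n. u n \<in> alg" "\<And>n. v n \<in> alg" "u \<longlonglongrightarrow> a" "v \<longlonglongrightarrow> b"
    unfolding closure_sequential by blast
  show "a * b \<in> closure alg"
    unfolding closure_sequential
    by (intro exI [of _ "\<lambda>n. u n * v n"] conjI allI alg_mult tendsto_mult uv)
  show "a + b \<in> closure alg"
    unfolding closure_sequential
    by (intro exI [of _ "\<lambda>n. u n + v n"] conjI allI alg_add tendsto_add uv)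
qed

lemma cc_coeff_cc: "x \<in> finsupp UNIV \<Longrightarrow> cc_coeff \<beta> (op_fun (cc x)) = x"
proof -
  assume x: "x \<in> finsupp UNIV"
  have "inj_on (cc_elem \<beta>) (finsupp UNIV)"
  proof (rule inj_onI)
    fix y z assume "y \<in> finsupp UNIV" "z \<in> finsupp UNIV" "cc_elem \<beta> y = cc_elem \<beta> z"
    then show "y = z"
      using injD [OF inj_op_fun, of "cc y" "cc z"] inj_onD [OF inj_on_cc] by (simp add: cc_elem_eq)
  qed
  from the_inv_into_f_f [OF this x] show ?thesis
    by (simp add: cc_coeff_def cc_elem_eq [OF x])
qed

end

section \<open>The seminorm on the crossed product\<close>

text \<open>The term at n = 0 is 1/0 = 0.\<close>

lemma inverse_squares_summable_on_int: "(\<lambda>n::int. 1 / (of_int n)\<^sup>2 :: real) summable_on UNIV"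
proof -
  have nat: "(\<lambda>k::nat. 1 / (real k)\<^sup>2) summable_on UNIV"
    using inverse_power_summable [of 2] by (intro summable_nonneg_imp_summable_on) (auto simp: field_simps)
  have "(\<lambda>n::int. 1 / (of_int n)\<^sup>2 :: real) summable_on range int"
    using nat by (subst summable_on_reindex) (auto simp: o_def inj_def)
  moreover have "(\<lambda>n::int. 1 / (of_int n)\<^sup>2 :: real) summable_on (\<lambda>k. - int k) ` {0<..}"
    using summable_on_subset_banach [OF nat, of "{0<..}"]
    by (subst summable_on_reindex) (auto simp: o_def inj_on_def)
  moreover have "range int \<inter> (\<lambda>k. - int k) ` {0<..} = {}"
    by auto
  moreover have "range int \<union> (\<lambda>k. - int k) ` {0<..} = UNIV"
  proof -
    have "n \<in> range int \<union> (\<lambda>k. - int k) ` {0<..}" for n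
      by (cases n rule: int_cases3) auto
    then show ?thesis by blast
  qed
  ultimately show ?thesis
    using summable_on_Un_disjoint by metis
qed

locale crossed_product_lip = cstar_automorphism \<beta> for \<beta> :: "'b::unital_cstar \<Rightarrow> 'b" +
  fixes V :: "'b set" and L :: "'b \<Rightarrow> real" and N :: "(int \<Rightarrow> complex) \<Rightarrow> real"
  assumes cqms: "compact_quantum_metric_space type_cstar V L"
    and image: "\<beta> ` V = V"
    and order_norm: "order_preserving_norm N"
begin

interpretation B: compact_quantum_metric_space "type_cstar :: 'b cstar" V L
  by (rule cqms)

lemma V_closed [simp]:
  "1 \<in> V" "x \<in> V \<Longrightarrow> y \<in> V \<Longrightarrow> x + y \<in> V" "x \<in> V \<Longrightarrow> scaleC c x \<in> V" "x \<in> V \<Longrightarrow> star x \<in> V"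
  using B.V_one B.V_add B.V_scal B.V_adj by auto

lemma V_0 [simp]: "0 \<in> V"
  using V_closed(3) [OF V_closed(1), of 0] by simp

lemma it_V [simp]: "x \<in> V \<Longrightarrow> it n x \<in> V"
  by (rule it_image [OF image])

lemma L_rules:
  "x \<in> V \<Longrightarrow> 0 \<le> L x" "x \<in> V \<Longrightarrow> y \<in> V \<Longrightarrow> L (x + y) \<le> L x + L y"
  "x \<in> V \<Longrightarrow> L (scaleC c x) = cmod c * L x" "L 1 = 0"
  using B.L_nonneg B.L_triangle B.L_scal B.L_one by auto

lemma L_0 [simp]: "L 0 = 0"
  using L_rules(3) [of 1 0] by simp

abbreviation W :: "(int \<Rightarrow> 'b) set" where "W \<equiv> finsupp V"

definition NL :: "(int \<Rightarrow> 'b) \<Rightarrow> real"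
  where "NL x = N (\<lambda>n. complex_of_real (L (x n)))"

lemma of_real_finsupp:
  "finite {n. h n \<noteq> 0} \<Longrightarrow> (\<lambda>n. complex_of_real (h n)) \<in> finsupp UNIV"
  by (simp add: finsupp_def)

lemma N_mono:
  assumes "finite {n. k n \<noteq> 0}" "\<And>n. 0 \<le> h n \<and> h n \<le> k n"
  shows "N (\<lambda>n. complex_of_real (h n)) \<le> N (\<lambda>n. complex_of_real (k n))"
proof -
  have "k \<in> finsupp UNIV"
    using assms by (simp add: finsupp_def)
  moreover have "{n. h n \<noteq> 0} \<subseteq> {n. k n \<noteq> 0}"
    using assms(2) by (auto simp: order.antisym) (metis order.antisym)
  then have "h \<in> finsupp UNIV"
    using assms(1) by (simp add: finsupp_def finite_subset)
  ultimately show ?thesis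
    using order_norm assms(2) unfolding order_preserving_norm_def by blast
qed

lemma N_triangle: "h \<in> finsupp UNIV \<Longrightarrow> k \<in> finsupp UNIV \<Longrightarrow> N (\<lambda>n. h n + k n) \<le> N h + N k"
  using order_norm by (simp add: order_preserving_norm_def)

lemma N_scale: "h \<in> finsupp UNIV \<Longrightarrow> N (\<lambda>n. c * h n) = cmod c * N h"
  using order_norm by (simp add: order_preserving_norm_def)

lemma N_pos: "h \<in> finsupp UNIV \<Longrightarrow> h n \<noteq> 0 \<Longrightarrow> N h > 0"
  using order_norm unfolding order_preserving_norm_def by (metis order_le_less)

lemma N_0: "N (\<lambda>n. 0) = 0"
  using order_norm unfolding order_preserving_norm_def by (simp add: finsupp_def)

lemma L_support: "x \<in> W \<Longrightarrow> finite {n. L (x n) \<noteq> 0}"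
  unfolding finsupp_def by (auto elim!: rev_finite_subset)

lemma NL_add:
  assumes x: "x \<in> W" and y: "y \<in> W"
  shows "NL (\<lambda>n. x n + y n) \<le> NL x + NL y"
proof -
  have fin: "finite {n. L (x n) + L (y n) \<noteq> 0}"
    by (rule finite_subset [OF _ finite_UnI [OF L_support [OF x] L_support [OF y]]]) auto
  have "N (\<lambda>n. complex_of_real (L (x n + y n))) \<le> N (\<lambda>n. complex_of_real (L (x n) + L (y n)))"
    using x y by (intro N_mono fin) (auto simp: L_rules finsuppD(1))
  also have "\<dots> \<le> N (\<lambda>n. complex_of_real (L (x n))) + N (\<lambda>n. complex_of_real (L (y n)))"
    unfolding of_real_add by (intro N_triangle of_real_finsupp L_support x y)
  finally show ?thesis
    by (simp add: NL_def)
qed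

lemma NL_scaleC: "x \<in> W \<Longrightarrow> NL (\<lambda>n. scaleC c (x n)) = cmod c * NL x"
  using N_scale [OF of_real_finsupp [OF L_support], of x "complex_of_real (cmod c)"]
  by (simp add: NL_def L_rules finsuppD(1))

text \<open>Order preservation, applied to the function of all values L(x(m)) and its restriction to
  the single index n. The norm of the indicator of n is not normalised and stays as a
  weight.\<close>

lemma NL_coeff_le:
  assumes "x \<in> W"
  shows "L (x n) * N (\<lambda>m. if m = n then 1 else 0) \<le> NL x"
proof -
  have "(\<lambda>m. if m = n then 1 else 0 :: complex) \<in> finsupp UNIV"
    by (rule finsuppI [of "{n}"]) auto
  then have "L (x n) * N (\<lambda>m. if m = n then 1 else 0)
      = N (\<lambda>m. complex_of_real (L (x n)) * (if m = n then 1 else 0))"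
    using L_rules(1) [OF finsuppD(1) [OF assms]] by (simp add: N_scale)
  also have "\<dots> = N (\<lambda>m. complex_of_real (if m = n then L (x n) else 0))"
    by (rule arg_cong [of _ _ N]) auto
  also have "\<dots> \<le> NL x"
    unfolding NL_def using assms by (intro N_mono L_support) (auto simp: L_rules finsuppD(1))
  finally show ?thesis .
qed

lemma adj_W: "x \<in> W \<Longrightarrow> cstar_adj x \<in> W"
  by (rule cstar_adj_finsupp) auto

lemma cstar_adj_cstar_adj: "cstar_adj (cstar_adj x) = x"
proof
  fix n
  have "it n (it (- n) (x n)) = x n"
    using it_add [of n "- n" "x n"] by simp
  then show "cstar_adj (cstar_adj x) n = x n"
    by (simp add: cstar_adj_def star_star flip: it_simps(4))
qed

lemma add_W: "x \<in> W \<Longrightarrow> y \<in> W \<Longrightarrow> (\<lambda>n. x n + y n) \<in> W"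
  by (rule finsuppI [of "{n. x n \<noteq> 0} \<union> {n. y n \<noteq> 0}"]) (auto simp: finsuppD)

lemma scaleC_W: "x \<in> W \<Longrightarrow> (\<lambda>n. scaleC c (x n)) \<in> W"
  by (rule finsuppI [of "{n. x n \<noteq> 0}"]) (auto simp: finsuppD)

abbreviation lip :: "'b l2_op \<Rightarrow> real" where "lip \<equiv> crossed_seminorm \<beta> L N"

lemma lip_eq:
  assumes "x \<in> W"
  shows "lip (op_fun (cc x)) = max (norm (cc (deriv x))) (max (NL x) (NL (cstar_adj x)))"
proof -
  have x: "x \<in> finsupp UNIV" "cstar_adj x \<in> finsupp UNIV"
    using finsupp_UNIV [OF assms] finsupp_UNIV [OF adj_W [OF assms]] by auto
  interpret C: cstar_embedding op_fun "closure alg" "reduced_crossed_product \<beta>"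
    by (rule cstar_embedding_crossed_product)
  have in_alg: "cc y \<in> closure alg" if "y \<in> finsupp UNIV" for y
    using that closure_subset [of alg] by blast
  have "nrm (reduced_crossed_product \<beta>) (cc_elem \<beta> (deriv x)) = norm (cc (deriv x))"
    using deriv_finsupp [OF x(1)] by (simp add: cc_elem_eq C.nrm_eq in_alg)
  moreover have "adj (reduced_crossed_product \<beta>) (op_fun (cc x)) = op_fun (cc (cstar_adj x))"
    using x by (simp add: C.adj_eq in_alg cc_cstar_adj)
  ultimately show ?thesis
    unfolding crossed_seminorm_def using x by (simp add: cc_coeff_cc NL_def flip: deriv_def)
qed

text \<open>The derivation sends the adjoint to minus the adjoint of the derivative, since the index
  changes sign. So the first term of the seminorm is invariant under the adjoint, while the other
  two are exchanged.\<close>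

lemma deriv_cstar_adj:
  assumes "x \<in> finsupp UNIV"
  shows "norm (cc (deriv (cstar_adj x))) = norm (cc (deriv x))"
proof -
  have d: "deriv x \<in> finsupp UNIV" "cstar_adj (deriv x) \<in> finsupp UNIV"
    using deriv_finsupp [OF assms] by (auto intro: cstar_adj_finsupp)
  have "deriv (cstar_adj x) = (\<lambda>n. scaleC (- 1) (cstar_adj (deriv x) n))"
    by (simp add: fun_eq_iff deriv_def cstar_adj_def star_scaleC it_simps scaleC_scaleC
        del: scaleC_minus_one)
  then show ?thesis
    using cc_scaleC [OF d(2), of "- 1"] cc_cstar_adj [OF d(1)] by simp
qed

lemma W_dense: "alg \<subseteq> closure (cc ` W)"
proof
  fix a assume "a \<in> alg"
  then obtain x where x: "x \<in> finsupp UNIV" "a = cc x" by blast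
  define F where "F = {n. x n \<noteq> 0}"
  have F: "finite F"
    using x by (simp add: F_def finsupp_def)
  have "closure V = UNIV"
    using B.V_dense type_cstar.closure_of_eq [of V] by simp
  then have dense: "\<exists>v\<in>V. norm (b - v) < e" if "e > 0" for b e
    using that closure_approachable [of b V] by (auto simp: dist_norm norm_minus_commute)
  show "a \<in> closure (cc ` W)"
    unfolding closure_approachable
  proof (intro allI impI)
    fix e :: real assume "e > 0"
    then have e': "e / (card F + 1) > 0" by simp
    have "\<forall>n. \<exists>v. v \<in> V \<and> norm (x n - v) < e / (card F + 1)"
      using dense [OF e'] by blast
    then obtain v where v: "\<And>n. v n \<in> V" "\<And>n. norm (x n - v n) < e / (card F + 1)"
      by metis
    let ?y = "\<lambda>n. if n \<in> F then v n else 0"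
    have "?y \<in> W"
      by (rule finsuppI [OF F]) (auto simp: v)
    moreover have "dist (cc ?y) a < e"
    proof -
      have "a - cc ?y = (\<Sum>n\<in>F. (M (x n) - M (v n)) * U n)"
        unfolding x(2) cc_sum_finsupp [OF F] by (simp add: cc_def F_def sum_subtractf left_diff_distrib)
      also have "norm \<dots> \<le> (\<Sum>n\<in>F. e / (card F + 1))"
      proof (rule sum_norm_le)
        fix n
        have "M (x n) - M (v n) = M (x n - v n)"
          using M_add [of "x n - v n" "v n"] by simp
        then have "norm ((M (x n) - M (v n)) * U n) \<le> norm (x n - v n) * 1"
          by (metis order.trans [OF norm_mult_ineq mult_mono [OF norm_M_le norm_U_le]] norm_ge_zero)
        then show "norm ((M (x n) - M (v n)) * U n) \<le> e / (card F + 1)"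
          using v(2) [of n] by simp
      qed
      also have "\<dots> < e"
        using \<open>e > 0\<close> by (simp add: field_simps)
      finally show ?thesis
        by (simp add: dist_norm norm_minus_commute)
    qed
    ultimately show "\<exists>b\<in>cc ` W. dist b a < e" by blast
  qed
qed

text \<open>Off a finite set of indices the Fourier coefficients are controlled by \<open>norm_tail_le\<close>, on the
  finite set by the Lipschitz balls of the coefficient algebra.\<close>

lemma lip_ball_net:
  assumes e: "e > 0"
  shows "\<exists>K\<subseteq>alg. finite K \<and>
    (\<forall>a\<in>cc ` W. lip (op_fun a) \<le> 1 \<longrightarrow> (\<exists>k\<in>K. \<exists>c. norm (a - k - scaleC c 1) \<le> e))"
proof -
  \<comment> \<open>The tail estimate takes the square root of the sum of 1/n^2; squaring in advance
    leaves e/2 for the tail and e/2 for the finite part.\<close>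
  have "(e / 2)\<^sup>2 > 0"
    using e by simp
  then obtain F0 where F0: "finite F0"
    "\<And>G. finite G \<Longrightarrow> G \<inter> F0 = {} \<Longrightarrow> norm (\<Sum>n\<in>G. 1 / (of_int n)\<^sup>2 :: real) < (e / 2)\<^sup>2"
    using tail_smallE [OF inverse_squares_summable_on_int [unfolded summable_on_UNIV_iff_Cauchy]] by blast
  define F where "F = insert 0 F0"
  have F: "finite F" "0 \<in> F"
    using F0 by (auto simp: F_def)
  \<comment> \<open>The bound on L(x(n)) that the weight in \<open>NL_coeff_le\<close> gives when NL
    x \<le> 1.\<close>
  define C where "C n = 1 / N (\<lambda>m. if m = n then 1 else 0)" for n :: int
  have Npos: "N (\<lambda>m. if m = n then 1 else 0) > 0" for n :: int
    by (rule N_pos [of _ n], rule finsuppI [of "{n}"]) auto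
  then have C: "C n > 0" for n
    by (simp add: C_def)
  obtain D where D: "D \<ge> 0" "\<And>b. b \<in> V \<Longrightarrow> L b \<le> 1 \<Longrightarrow> \<exists>c. norm (b - scaleC c 1) \<le> D"
    using lip_bounded_mod_constants [OF cqms] by blast
  define \<delta> where "\<delta> = e / (2 * (card F + 1))"
  have \<delta>: "\<delta> > 0" "card F * \<delta> \<le> e / 2"
    using e by (simp_all add: \<delta>_def field_simps)
  \<comment> \<open>For nonzero n, n x(n) is a coefficient of the derivation, so norm (x n) \<le> 1.
    At 0, D bounds elements with L \<le> 1 modulo constants, and C 0 restores the scale.\<close>
  define r where "r n = (if n = 0 then C 0 * D else 1)" for n :: int
  have "\<exists>K. finite K \<and> (\<forall>b. b \<in> V \<longrightarrow> L b \<le> C n \<longrightarrow> norm b \<le> r n \<longrightarrow> (\<exists>k\<in>K. norm (b - k) \<le> \<delta>))" for n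
    using lip_totally_bounded [OF cqms \<delta>(1), of "C n" "r n"] C [of n] by (metis less_imp_le)
  then obtain K where K: "\<And>n. finite (K n)"
    "\<And>n b. b \<in> V \<Longrightarrow> L b \<le> C n \<Longrightarrow> norm b \<le> r n \<Longrightarrow> \<exists>k\<in>K n. norm (b - k) \<le> \<delta>"
    by metis
  define E where "E = (\<lambda>k. \<Sum>n\<in>F. M (k n) * U n) ` PiE F K"
  have "finite E"
    unfolding E_def using F K by (intro finite_imageI finite_PiE) auto
  moreover have "E \<subseteq> alg"
    unfolding E_def by (auto intro: alg_sum alg_monomial)
  moreover have "\<exists>k\<in>E. \<exists>c. norm (a - k - scaleC c 1) \<le> e" if a: "a \<in> cc ` W" "lip (op_fun a) \<le> 1" for a
  proof -
    obtain x where x: "x \<in> W" "a = cc x"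
      using a by blast
    have x': "x \<in> finsupp UNIV"
      using x finsupp_UNIV by blast
    have le1: "norm (cc (deriv x)) \<le> 1" "NL x \<le> 1"
      using a(2) unfolding x(2) lip_eq [OF x(1)] by auto
    have Lx: "L (x n) \<le> C n" for n
      using NL_coeff_le [OF x(1), of n] le1(2) Npos [of n] by (simp add: C_def field_simps)
    have nx: "norm (x n) \<le> 1" if "n \<noteq> 0" for n
    proof -
      have "\<bar>real_of_int n\<bar> * norm (x n) \<le> 1"
        using norm_coeff_le [OF deriv_finsupp [OF x'], of n] le1(1) by (simp add: deriv_def norm_scaleC)
      moreover have "1 * norm (x n) \<le> \<bar>real_of_int n\<bar> * norm (x n)"
        using that by (intro mult_right_mono) auto
      ultimately show ?thesis by simp
    qed
    have xV: "x n \<in> V" for n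
      using x finsuppD by blast
    have "\<exists>c. norm (scaleC (1 / C 0) (x 0) - scaleC c 1) \<le> D"
      using C [of 0] Lx [of 0] xV by (intro D(2)) (simp_all add: L_rules norm_divide field_simps)
    then obtain c0 where c0: "norm (scaleC (1 / C 0) (x 0) - scaleC c0 1) \<le> D" by blast
    define c where "c = of_real (C 0) * c0"
    have "x 0 - scaleC c 1 = scaleC (of_real (C 0)) (scaleC (1 / C 0) (x 0) - scaleC c0 1)"
      using C [of 0] by (simp add: c_def scaleC_diff_right scaleC_scaleC)
    then have nc: "norm (x 0 - scaleC c 1) \<le> C 0 * D"
      using mult_left_mono [OF c0, of "C 0"] C [of 0] by (simp add: norm_scaleC)
    \<comment> \<open>Only the coefficient at 0 is shifted. Since M 1 and U 0 are the identity, this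
      shift is a constant of the crossed product, and L(1) = 0 preserves the bound on L.\<close>
    define y where "y n = (if n = 0 then x 0 + scaleC (- c) 1 else x n)" for n
    have yV: "y n \<in> V" for n
      using xV by (simp add: y_def)
    have "L (x 0 + scaleC (- c) 1) \<le> L (x 0)"
      using L_rules(2) [of "x 0" "scaleC (- c) 1"] L_rules(3) [of 1 "- c"] xV by (simp add: L_rules(4))
    then have Ly: "L (y n) \<le> C n" for n
      using Lx [of n] order.trans [OF _ Lx [of 0]] by (auto simp: y_def)
    have ny: "norm (y n) \<le> r n" for n
      using nx nc by (simp add: y_def r_def scaleC_minus_left)
    obtain k0 where k0: "\<And>n. k0 n \<in> K n" "\<And>n. norm (y n - k0 n) \<le> \<delta>"
      using K(2) [OF yV Ly ny] by metis
    define k where "k = (\<Sum>n\<in>F. M (k0 n) * U n)"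
    have "k = (\<Sum>n\<in>F. M (restrict k0 F n) * U n)"
      by (simp add: k_def)
    then have kE: "k \<in> E"
      unfolding E_def by (rule image_eqI [of _ _ "restrict k0 F"]) (use k0(1) in \<open>simp add: restrict_PiE_iff\<close>)
    define G where "G = {n. x n \<noteq> 0} - F"
    have G: "finite G" "0 \<notin> G" "G \<inter> F0 = {}"
      using x' F by (auto simp: G_def finsupp_def F_def)
    have "cc x = (\<Sum>n\<in>F \<union> G. M (x n) * U n)"
      using F G by (intro cc_eq_sum) (auto simp: G_def)
    then have split: "cc x = (\<Sum>n\<in>F. M (x n) * U n) + (\<Sum>n\<in>G. M (x n) * U n)"
      using F G by (subst (asm) sum.union_disjoint) (auto simp: G_def)
    have "(\<Sum>n\<in>F. M (y n) * U n) + scaleC c 1 = (\<Sum>n\<in>F. M (x n) * U n)"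
    proof -
      have F': "F = insert 0 (F - {0})" "finite (F - {0})"
        using F by auto
      have "(\<Sum>n\<in>F - {0}. M (y n) * U n) = (\<Sum>n\<in>F - {0}. M (x n) * U n)"
        by (intro sum.cong refl) (simp add: y_def)
      moreover have "M (y 0) * U 0 + scaleC c 1 = M (x 0) * U 0"
      proof -
        have "M (y 0) = M (x 0) + scaleC (- c) (M 1)"
          by (simp only: y_def if_True M_add M_scaleC refl)
        then show ?thesis
          by (simp add: scaleC_minus_left)
      qed
      ultimately show ?thesis
        using F by (simp add: sum.remove [of F 0] algebra_simps)
    qed
    then have "a - k - scaleC c 1 = (\<Sum>n\<in>F. M (y n) * U n) - k + (\<Sum>n\<in>G. M (x n) * U n)"
      unfolding x(2) split by (simp add: algebra_simps)
    also have "(\<Sum>n\<in>F. M (y n) * U n) - k = (\<Sum>n\<in>F. M (y n - k0 n) * U n)"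
    proof -
      have "M (y n - k0 n) = M (y n) - M (k0 n)" for n
        using M_add [of "y n - k0 n" "k0 n"] by simp
      then show ?thesis
        by (simp add: k_def sum_subtractf left_diff_distrib)
    qed
    finally have "norm (a - k - scaleC c 1)
        \<le> norm (\<Sum>n\<in>F. M (y n - k0 n) * U n) + norm (\<Sum>n\<in>G. M (x n) * U n)"
      using norm_triangle_ineq by simp
    also have "norm (\<Sum>n\<in>F. M (y n - k0 n) * U n) \<le> (\<Sum>n\<in>F. \<delta>)"
    proof (rule sum_norm_le)
      fix n
      have "norm (M (y n - k0 n) * U n) \<le> norm (M (y n - k0 n)) * norm (U n)"
        by (rule norm_mult_ineq)
      also have "\<dots> \<le> \<delta> * 1"
        using order.trans [OF norm_M_le k0(2)] \<delta> by (intro mult_mono norm_U_le) auto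
      finally show "norm (M (y n - k0 n) * U n) \<le> \<delta>" by simp
    qed
    also have "(\<Sum>n\<in>F. \<delta>) \<le> e / 2"
      using \<delta> by simp
    also have "norm (\<Sum>n\<in>G. M (x n) * U n) \<le> e / 2"
    proof -
      have "sqrt (\<Sum>n\<in>G. 1 / (of_int n)\<^sup>2 :: real) \<le> sqrt ((e / 2)\<^sup>2)"
        using F0(2) [OF G(1,3)] by (intro real_sqrt_le_mono) simp
      also have "sqrt ((e / 2)\<^sup>2) = e / 2"
        using e by (subst real_sqrt_abs) simp
      finally have "sqrt (\<Sum>n\<in>G. 1 / (of_int n)\<^sup>2 :: real) * norm (cc (deriv x)) \<le> e / 2 * 1"
        using le1(1) e by (intro mult_mono) auto
      then show ?thesis
        using norm_tail_le [OF x' G(1,2)] by simp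
    qed
    finally have "norm (a - k - scaleC c 1) \<le> e" by simp
    then show ?thesis
      using kE by blast
  qed
  ultimately show ?thesis by blast
qed

theorem compact_quantum_metric_space_crossed_product:
  "compact_quantum_metric_space (reduced_crossed_product \<beta>) (cc_elem \<beta> ` W) lip"
proof -
  interpret C: cstar_embedding op_fun "closure alg" "reduced_crossed_product \<beta>"
    by (rule cstar_embedding_crossed_product)
  have W_alg: "cc ` W \<subseteq> alg"
    using finsupp_UNIV by blast
  have finsupp: "x \<in> finsupp UNIV" if "x \<in> W" for x
    using that by (rule finsupp_UNIV)
  interpret lip_net op_fun "closure alg" "reduced_crossed_product \<beta>" "cc ` W" lip
  proof
    show "cc ` W \<subseteq> closure alg"
      using W_alg closure_subset by blast
    have one: "(\<lambda>n. if n = 0 then 1 else 0) \<in> W"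
      by (rule finsuppI [of "{0}"]) auto
    then show "1 \<in> cc ` W"
      using cc_one by (metis imageI)
    have "deriv (\<lambda>n. if n = 0 then 1 else 0) = (\<lambda>n. 0)"
      "cstar_adj (\<lambda>n. if n = 0 then 1 else 0) = (\<lambda>n. if n = 0 then 1 else 0)"
      by (auto simp: deriv_def cstar_adj_def fun_eq_iff)
    moreover have "NL (\<lambda>n. if n = 0 then 1 else 0) = 0"
    proof -
      have "(\<lambda>n. complex_of_real (L (if n = 0 then 1 else 0))) = (\<lambda>n::int. 0)"
        by (auto simp: L_rules)
      then show ?thesis
        by (simp add: NL_def N_0)
    qed
    ultimately show "lip (op_fun 1) = 0"
      using lip_eq [OF one] by (simp add: cc_one) (simp add: cc_def)
  next
    fix a b :: "'b adjop" and c
    assume "a \<in> cc ` W"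
    then obtain x where x: "x \<in> W" "a = cc x" by blast
    have deriv_scaleC: "deriv (\<lambda>n. scaleC c (x n)) = (\<lambda>n. scaleC c (deriv x n))"
      by (simp add: deriv_def fun_eq_iff scaleC_scaleC mult.commute)
    have adj_scaleC: "cstar_adj (\<lambda>n. scaleC c (x n)) = (\<lambda>n. scaleC (cnj c) (cstar_adj x n))"
      by (simp add: cstar_adj_def fun_eq_iff star_scaleC it_simps)
    show "scaleC c a \<in> cc ` W"
      using scaleC_W [OF x(1), of c] cc_scaleC [OF x(1), of c] x(2) by (metis imageI)
    show "lip (op_fun (scaleC c a)) = cmod c * lip (op_fun a)"
      unfolding x(2) cc_scaleC [OF x(1), symmetric] lip_eq [OF x(1)] lip_eq [OF scaleC_W [OF x(1)]]
        deriv_scaleC adj_scaleC NL_scaleC [OF x(1)] NL_scaleC [OF adj_W [OF x(1)]]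
        cc_scaleC [OF deriv_finsupp [OF finsupp [OF x(1)]]]
      by (simp add: norm_scaleC max_mult_distrib_left)
    show "0 \<le> lip (op_fun a)"
      unfolding x(2) lip_eq [OF x(1)] by (simp add: le_max_iff_disj)
    show "star a \<in> cc ` W"
      using adj_W [OF x(1)] cc_cstar_adj [OF x(1)] x(2) by (metis imageI)
    show "lip (op_fun (star a)) = lip (op_fun a)"
      unfolding x(2) cc_cstar_adj [OF x(1), symmetric] lip_eq [OF x(1)] lip_eq [OF adj_W [OF x(1)]]
        cstar_adj_cstar_adj deriv_cstar_adj [OF finsupp [OF x(1)]]
      by (simp add: max.commute)
    assume "b \<in> cc ` W"
    then obtain y where y: "y \<in> W" "b = cc y" by blast
    have deriv_add: "deriv (\<lambda>n. x n + y n) = (\<lambda>n. deriv x n + deriv y n)"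
      by (simp add: deriv_def fun_eq_iff scaleC_add_right)
    have adj_add: "cstar_adj (\<lambda>n. x n + y n) = (\<lambda>n. cstar_adj x n + cstar_adj y n)"
      by (simp add: cstar_adj_def fun_eq_iff star_add it_simps)
    show "a + b \<in> cc ` W"
      using add_W [OF x(1) y(1)] cc_add [OF x(1) y(1)] x(2) y(2) by (metis imageI)
    have "norm (cc (deriv x) + cc (deriv y)) \<le> norm (cc (deriv x)) + norm (cc (deriv y))"
      by (rule norm_triangle_ineq)
    then show "lip (op_fun (a + b)) \<le> lip (op_fun a) + lip (op_fun b)"
      unfolding x(2) y(2) cc_add [OF x(1) y(1), symmetric] lip_eq [OF x(1)] lip_eq [OF y(1)]
        lip_eq [OF add_W [OF x(1) y(1)]] deriv_add adj_add
        cc_add [OF deriv_finsupp [OF finsupp [OF x(1)]] deriv_finsupp [OF finsupp [OF y(1)]]]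
      using NL_add [OF x(1) y(1)] NL_add [OF adj_W [OF x(1)] adj_W [OF y(1)]] by linarith
  next
    show "closure alg \<subseteq> closure (cc ` W)"
      by (rule closure_minimal [OF W_dense]) simp
    show "\<exists>K\<subseteq>closure alg. finite K \<and> (\<forall>a\<in>cc ` W. lip (op_fun a) \<le> 1 \<longrightarrow> (\<exists>k\<in>K. \<exists>c. norm (a - k - scaleC c 1) \<le> e))"
      if "e > 0" for e
      using lip_ball_net [OF that] closure_subset [of alg] by (meson order.trans)
  qed
  show ?thesis
    using compact_quantum_metric_space by (simp add: cc_elem_image)
qed

end

theorem theoremA:
  fixes \<beta> :: "'b::unital_cstar \<Rightarrow> 'b"
    and V\<^sub>B :: "'b set"
    and L\<^sub>B :: "'b \<Rightarrow> real"
    and N :: "(int \<Rightarrow> complex) \<Rightarrow> real"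
  assumes "compact_quantum_metric_space type_cstar V\<^sub>B L\<^sub>B"
    and "star_automorphism \<beta>"
    and "lower_semicontinuous_on V\<^sub>B L\<^sub>B"
    and "\<beta> ` V\<^sub>B = V\<^sub>B"
    and "order_preserving_norm N"
  shows "compact_quantum_metric_space (reduced_crossed_product \<beta>)
           (cc_elem \<beta> ` finsupp V\<^sub>B) (crossed_seminorm \<beta> L\<^sub>B N)"
proof -
  interpret crossed_product_lip \<beta> V\<^sub>B L\<^sub>B N
    using assms
    by (intro crossed_product_lip.intro cstar_automorphism.intro crossed_product_lip_axioms.intro)
  show ?thesis
    by (rule compact_quantum_metric_space_crossed_product)
qed

end
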